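(* Let $\Omega\subset\mathbb{R}^d$ be a connected, bounded, open domain with regular boundary $\partial\Omega$. Let $p,q>1$ and $\alpha,\beta>0$ be real numbers satisfying $\frac{\alpha}{p}+\frac{\beta}{q}=1$. Let $$\lambda_1(p,q)=\inf\Big\{\frac{\alpha}{p}\int_\Omega|\nabla u|^p\,dx+\frac{\beta}{q}\int_\Omega|\nabla v|^q\,dx \;:\; (u,v)\in W^{1,p}_0(\Omega)\times W^{1,q}_0(\Omega),\ \int_\Omega|u|^{\alpha-1}|v|^{\beta-1}u\,v\,dx=1\Big\}.$$ Then $\lambda_1(p,q)$ is simple; that is, if $(u,v)$ and $(\phi,\psi)$ are any two eigenfunctions associated with $\lambda_1(p,q)$, then there exist real numbers $k_1,k_2$ such that $u=k_1\phi$ and $v=k_2\psi$ almost everywhere in $\Omega$.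
   Context: Write $\Delta_p u=\operatorname{div}(|\nabla u|^{p-2}\nabla u)$. Consider the eigenvalue system $$-\Delta_p u=\lambda|u|^{\alpha-1}|v|^{\beta-1}v\ \text{ in }\Omega,\qquad -\Delta_q v=\lambda|u|^{\alpha-1}|v|^{\beta-1}u\ \text{ in }\Omega,\qquad u=v=0\ \text{ on }\partial\Omega.$$ A (weak) solution is a pair $(u,v)\in W^{1,p}_0(\Omega)\times W^{1,q}_0(\Omega)$ such that for all $(\eta,\zeta)\in W^{1,p}_0(\Omega)\times W^{1,q}_0(\Omega)$, $$\int_\Omega|\nabla u|^{p-2}\nabla u\cdot\nabla\eta\,dx+\int_\Omega|\nabla v|^{q-2}\nabla v\cdot\nabla\zeta\,dx=\lambda\Big(\int_\Omega|u|^{\alpha-1}|v|^{\beta-1}v\,\eta\,dx+\int_\Omega|u|^{\alpha-1}|v|^{\beta-1}u\,\zeta\,dx\Big).$$ Here the expressions $|u|^{\alpha-1}|v|^{\beta-1}uv$, $|u|^{\alpha-1}|v|^{\beta-1}v$ and $|u|^{\alpha-1}|v|^{\beta-1}u$ are those appearing in the system and the constraint. The first eigenvalue is the least real $\lambda$ for which the system has a solution $(u,v)$ with $u\neq0$ and $v\neq0$ (neither component identically zero); it is variationally characterized by the infimum $\lambda_1(p,q)$ in the claim. An eigenfunction (eigenvector) associated with $\lambda_1(p,q)$ is a solution $(u,v)$ of the system with $\lambda=\lambda_1(p,q)$, $u\neq0$ and $v\neq0$. *)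

theory Defs
  imports "HOL-Analysis.Analysis"
begin

(* A bounded open set with regular boundary: near every boundary point, \<Omega> is the region strictly
   below the graph of a Lipschitz function in some orthonormal frame with "vertical" unit vector n.
   This is the weakest of the usual regularity classes; C^1, C^2, ..., smooth boundaries satisfy it.
   As U is open and g continuous, the condition forces the part of the boundary in U to be the
   graph itself. *)
definition lipschitz_boundary :: "'a::euclidean_space set \<Rightarrow> bool" where
  "lipschitz_boundary \<Omega> \<longleftrightarrow>
     (\<forall>z\<in>frontier \<Omega>. \<exists>U n g L. open U \<and> z \<in> U \<and> norm n = 1 \<and>
        L-lipschitz_on {y. y \<bullet> n = 0} (g :: 'a \<Rightarrow> real) \<and>
        \<Omega> \<inter> U = {x\<in>U. x \<bullet> n < g (x - (x \<bullet> n) *\<^sub>R n)})"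

definition grad :: "('a::euclidean_space \<Rightarrow> real) \<Rightarrow> 'a \<Rightarrow> 'a" where
  "grad f x = (\<Sum>i\<in>Basis. frechet_derivative f (at x) i *\<^sub>R i)"

primrec C_k :: "nat \<Rightarrow> ('a::euclidean_space \<Rightarrow> real) \<Rightarrow> bool" where
  "C_k 0 f \<longleftrightarrow> continuous_on UNIV f"
| "C_k (Suc k) f \<longleftrightarrow>
     (\<forall>x. f differentiable at x) \<and> (\<forall>i\<in>Basis. C_k k (\<lambda>x. frechet_derivative f (at x) i))"

definition test_function :: "'a::euclidean_space set \<Rightarrow> ('a \<Rightarrow> real) \<Rightarrow> bool" where
  "test_function \<Omega> f \<longleftrightarrow>
     (\<forall>k. C_k k f) \<and> compact (closure {x. f x \<noteq> 0}) \<and> closure {x. f x \<noteq> 0} \<subseteq> \<Omega>"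

definition locally_integrable ::
    "'a::euclidean_space set \<Rightarrow> ('a \<Rightarrow> 'b::euclidean_space) \<Rightarrow> bool" where
  "locally_integrable \<Omega> f \<longleftrightarrow>
     (\<forall>K. compact K \<and> K \<subseteq> \<Omega> \<longrightarrow> integrable (lebesgue_on K) f)"

definition has_weak_gradient ::
    "'a::euclidean_space set \<Rightarrow> ('a \<Rightarrow> real) \<Rightarrow> ('a \<Rightarrow> 'a) \<Rightarrow> bool" where
  "has_weak_gradient \<Omega> u G \<longleftrightarrow>
     locally_integrable \<Omega> u \<and> locally_integrable \<Omega> G \<and>
     (\<forall>f. test_function \<Omega> f \<longrightarrow>
        (LINT x|lebesgue_on \<Omega>. u x *\<^sub>R grad f x) = - (LINT x|lebesgue_on \<Omega>. f x *\<^sub>R G x))"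

(* Determined up to null subsets of \<Omega> when a weak gradient exists. *)
definition weak_grad :: "'a::euclidean_space set \<Rightarrow> ('a \<Rightarrow> real) \<Rightarrow> 'a \<Rightarrow> 'a" where
  "weak_grad \<Omega> u = (SOME G. has_weak_gradient \<Omega> u G)"

definition in_Lp ::
    "real \<Rightarrow> 'a::euclidean_space set \<Rightarrow> ('a \<Rightarrow> 'b::euclidean_space) \<Rightarrow> bool" where
  "in_Lp p \<Omega> f \<longleftrightarrow>
     f \<in> borel_measurable (lebesgue_on \<Omega>) \<and>
     integrable (lebesgue_on \<Omega>) (\<lambda>x. norm (f x) powr p)"

(* Elements of the Sobolev spaces are functions defined on the whole space; only their values on
   \<Omega>, up to null sets, are relevant. *)
definition W1p :: "real \<Rightarrow> 'a::euclidean_space set \<Rightarrow> ('a \<Rightarrow> real) set" where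
  "W1p p \<Omega> =
     {u. in_Lp p \<Omega> u \<and> (\<exists>G. has_weak_gradient \<Omega> u G) \<and> in_Lp p \<Omega> (weak_grad \<Omega> u)}"

definition W1p_norm :: "real \<Rightarrow> 'a::euclidean_space set \<Rightarrow> ('a \<Rightarrow> real) \<Rightarrow> real" where
  "W1p_norm p \<Omega> u =
     ((LINT x|lebesgue_on \<Omega>. \<bar>u x\<bar> powr p) +
      (LINT x|lebesgue_on \<Omega>. norm (weak_grad \<Omega> u x) powr p)) powr (1 / p)"

definition W1p_0 :: "real \<Rightarrow> 'a::euclidean_space set \<Rightarrow> ('a \<Rightarrow> real) set" where
  "W1p_0 p \<Omega> =
     {u \<in> W1p p \<Omega>. \<exists>f :: nat \<Rightarrow> 'a \<Rightarrow> real. (\<forall>n. test_function \<Omega> (f n)) \<and>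
        (\<lambda>n. W1p_norm p \<Omega> (\<lambda>x. u x - f n x)) \<longlonglongrightarrow> 0}"

(* t^a for t \<ge> 0. Since 0 powr 0 = 0 in HOL, the exponent 0 is treated separately so that
   t^0 = 1. For a < 0 the value at t = 0 is 0: expressions that are singular there
   contribute only where they are defined. *)
definition rpow :: "real \<Rightarrow> real \<Rightarrow> real" where
  "rpow t a = (if a = 0 then 1 else t powr a)"

definition coupling ::
    "'a::euclidean_space set \<Rightarrow> real \<Rightarrow> real \<Rightarrow> ('a \<Rightarrow> real) \<Rightarrow> ('a \<Rightarrow> real) \<Rightarrow> real" where
  "coupling \<Omega> \<alpha> \<beta> u v =
     (LINT x|lebesgue_on \<Omega>. rpow \<bar>u x\<bar> (\<alpha> - 1) * rpow \<bar>v x\<bar> (\<beta> - 1) * u x * v x)"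

definition energy ::
    "'a::euclidean_space set \<Rightarrow> real \<Rightarrow> real \<Rightarrow> real \<Rightarrow> real \<Rightarrow> ('a \<Rightarrow> real) \<Rightarrow> ('a \<Rightarrow> real) \<Rightarrow> real" where
  "energy \<Omega> p q \<alpha> \<beta> u v =
     \<alpha> / p * (LINT x|lebesgue_on \<Omega>. norm (weak_grad \<Omega> u x) powr p) +
     \<beta> / q * (LINT x|lebesgue_on \<Omega>. norm (weak_grad \<Omega> v x) powr q)"

definition lambda1 ::
    "'a::euclidean_space set \<Rightarrow> real \<Rightarrow> real \<Rightarrow> real \<Rightarrow> real \<Rightarrow> real" where
  "lambda1 \<Omega> p q \<alpha> \<beta> =
     Inf {energy \<Omega> p q \<alpha> \<beta> u v | u v.
            u \<in> W1p_0 p \<Omega> \<and> v \<in> W1p_0 q \<Omega> \<and> coupling \<Omega> \<alpha> \<beta> u v = 1}"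

(* \<integral> |\<nabla>u|^(p-2) \<nabla>u \<cdot> \<nabla>\<eta> dx *)
definition plaplace_form ::
    "'a::euclidean_space set \<Rightarrow> real \<Rightarrow> ('a \<Rightarrow> real) \<Rightarrow> ('a \<Rightarrow> real) \<Rightarrow> real" where
  "plaplace_form \<Omega> p u \<eta> =
     (LINT x|lebesgue_on \<Omega>.
        rpow (norm (weak_grad \<Omega> u x)) (p - 2) * (weak_grad \<Omega> u x \<bullet> weak_grad \<Omega> \<eta> x))"

(* The integrability requirement says that the right-hand side makes sense: the Bochner integral
   of a non-integrable function is 0 by convention. On the left-hand side integrability follows
   from Hoelder's inequality. *)
definition weak_solution ::
    "'a::euclidean_space set \<Rightarrow> real \<Rightarrow> real \<Rightarrow> real \<Rightarrow> real \<Rightarrow> real \<Rightarrow>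
     ('a \<Rightarrow> real) \<Rightarrow> ('a \<Rightarrow> real) \<Rightarrow> bool" where
  "weak_solution \<Omega> p q \<alpha> \<beta> \<mu> u v \<longleftrightarrow>
     u \<in> W1p_0 p \<Omega> \<and> v \<in> W1p_0 q \<Omega> \<and>
     (\<forall>\<eta>\<in>W1p_0 p \<Omega>. \<forall>\<zeta>\<in>W1p_0 q \<Omega>.
        integrable (lebesgue_on \<Omega>)
          (\<lambda>x. rpow \<bar>u x\<bar> (\<alpha> - 1) * rpow \<bar>v x\<bar> (\<beta> - 1) * v x * \<eta> x) \<and>
        integrable (lebesgue_on \<Omega>)
          (\<lambda>x. rpow \<bar>u x\<bar> (\<alpha> - 1) * rpow \<bar>v x\<bar> (\<beta> - 1) * u x * \<zeta> x) \<and>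
        plaplace_form \<Omega> p u \<eta> + plaplace_form \<Omega> q v \<zeta> =
          \<mu> * ((LINT x|lebesgue_on \<Omega>.
                  rpow \<bar>u x\<bar> (\<alpha> - 1) * rpow \<bar>v x\<bar> (\<beta> - 1) * v x * \<eta> x) +
               (LINT x|lebesgue_on \<Omega>.
                  rpow \<bar>u x\<bar> (\<alpha> - 1) * rpow \<bar>v x\<bar> (\<beta> - 1) * u x * \<zeta> x)))"

definition eigenfunction ::
    "'a::euclidean_space set \<Rightarrow> real \<Rightarrow> real \<Rightarrow> real \<Rightarrow> real \<Rightarrow> real \<Rightarrow>
     ('a \<Rightarrow> real) \<Rightarrow> ('a \<Rightarrow> real) \<Rightarrow> bool" where
  "eigenfunction \<Omega> p q \<alpha> \<beta> \<mu> u v \<longleftrightarrow>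
     weak_solution \<Omega> p q \<alpha> \<beta> \<mu> u v \<and>
     \<not> (AE x in lebesgue_on \<Omega>. u x = 0) \<and> \<not> (AE x in lebesgue_on \<Omega>. v x = 0)"

end

theory Submission
  imports Defs
begin

text \<open>
  The coupling is the integral of \<open>(|u|^p)^(\<alpha>/p) (|v|^q)^(\<beta>/q)\<close>, a concave and homogeneous
  function of \<open>(|u|^p, |v|^q)\<close>, while by convexity the energy is subadditive under the \<open>p\<close>-sum
  \<open>(|u|^p + |\<phi>|^p)^(1/p)\<close> (hidden convexity, Diaz and Saa). Hence the \<open>p\<close>-sum and \<open>q\<close>-sum of
  two minimizing pairs again minimize, and the equality case of the convexity inequality says
  \<open>\<nabla>u/u = \<nabla>\<phi>/\<phi>\<close> where both functions are nonzero. For such functions the bounded quotients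
  \<open>u\<^sup>2/(u\<^sup>2 + \<phi>\<^sup>2)\<close> and \<open>u\<phi>/(u\<^sup>2 + \<phi>\<^sup>2)\<close> have vanishing weak gradient, so they are constant on the
  connected domain, and \<open>u/\<phi>\<close> is constant.

  That \<open>u\<close> vanishes almost nowhere replaces the strong maximum principle: comparing \<open>u\<close> with
  \<open>(|u|^p + t \<zeta>^p)^(1/p)\<close> for a cutoff \<open>\<zeta>\<close> bounds \<open>\<nabla>u/u\<close> in \<open>L^p\<close> locally, and then
  \<open>u\<^sup>2/(u\<^sup>2 + \<epsilon>)\<close> tends to the indicator of \<open>u \<noteq> 0\<close> while its gradient tends to 0 locally in \<open>L^1\<close>.
\<close>

section \<open>Smooth functions\<close>

text \<open>An eigenfunction is only known to lie in \<open>W1p_0\<close>: beforehand it may change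
  sign, be unbounded or vanish on a large set, and u/\<phi> need not be a Sobolev function. This
  shapes the proof in four places. Signs: the equation gives the energy as \<lambda> times the
  signed coupling; the variational bound for moduli then forces equality with the coupling of
  absolute values, and only the latter is used afterwards. Singularities: the p-sum is not
  differentiable at the origin, and |s|^(p-2) blows up at 0 for p < 2, so s^2 is replaced by s^2 +
  d, with derivatives bounded independently of d. Quotients: u/\<phi> is replaced by bounded
  functions homogeneous of degree 0, since their gradient is orthogonal to (u, \<phi>), the
  direction in which a common logarithmic gradient moves the pair; two of them determine u/\<phi>.
  Limits: Sobolev convergence is first turned into convergence almost everywhere under an integrable
  majorant, the form that survives nonlinear compositions.\<close>

lemma C_k_SucI:
  fixes f :: "'a::euclidean_space \<Rightarrow> real"
  assumes "\<And>x. (f has_derivative f' x) (at x)" and "\<And>i. i \<in> Basis \<Longrightarrow> C_k k (\<lambda>x. f' x i)"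
  shows "C_k (Suc k) f"
proof -
  have "frechet_derivative f (at x) = f' x" for x
    using assms(1) frechet_derivative_at by metis
  then show ?thesis
    using assms by (auto simp: differentiable_def)
qed

lemma C_k_SucD:
  fixes f :: "'a::euclidean_space \<Rightarrow> real"
  assumes "C_k (Suc k) f"
  shows "(f has_derivative frechet_derivative f (at x)) (at x)"
    and "i \<in> Basis \<Longrightarrow> C_k k (\<lambda>x. frechet_derivative f (at x) i)"
  using assms frechet_derivative_works by auto

lemma C_k_Suc_imp:
  fixes f :: "'a::euclidean_space \<Rightarrow> real"
  shows "C_k (Suc k) f \<Longrightarrow> C_k k f"
proof (induction k arbitrary: f)
  case 0
  then show ?case
    by (auto intro!: continuous_at_imp_continuous_on differentiable_imp_continuous_within)
next
  case (Suc k)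
  then show ?case by (metis C_k.simps(2))
qed

lemma C_k_const: "C_k k (\<lambda>x::'a::euclidean_space. c::real)"
proof (induction k arbitrary: c)
  case (Suc k)
  show ?case by (rule C_k_SucI[where f' = "\<lambda>x h. 0"]) (auto intro: Suc)
qed simp

lemma C_k_add:
  fixes f g :: "'a::euclidean_space \<Rightarrow> real"
  assumes "C_k k f" "C_k k g"
  shows "C_k k (\<lambda>x. f x + g x)"
  using assms
proof (induction k arbitrary: f g)
  case (Suc k)
  show ?case
    by (rule C_k_SucI[OF has_derivative_add[OF C_k_SucD(1)[OF Suc.prems(1)] C_k_SucD(1)[OF Suc.prems(2)]]])
      (intro Suc.IH C_k_SucD(2) Suc.prems)
qed (auto intro: continuous_intros)

lemma C_k_mult:
  fixes f g :: "'a::euclidean_space \<Rightarrow> real"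
  assumes "C_k k f" "C_k k g"
  shows "C_k k (\<lambda>x. f x * g x)"
  using assms
proof (induction k arbitrary: f g)
  case (Suc k)
  show ?case
    by (rule C_k_SucI[OF has_derivative_mult[OF C_k_SucD(1)[OF Suc.prems(1)] C_k_SucD(1)[OF Suc.prems(2)]]])
      (intro C_k_add Suc.IH C_k_SucD(2)[OF Suc.prems(1)] C_k_SucD(2)[OF Suc.prems(2)]
        C_k_Suc_imp[OF Suc.prems(1)] C_k_Suc_imp[OF Suc.prems(2)])
qed (auto intro: continuous_intros)

lemma C_k_inner: "C_k k (\<lambda>x::'a::euclidean_space. x \<bullet> i)"
proof (cases k)
  case (Suc m)
  show ?thesis unfolding Suc
    by (rule C_k_SucI[where f' = "\<lambda>x h. h \<bullet> i"]) (auto intro!: derivative_eq_intros C_k_const)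
qed (auto intro: continuous_intros)

lemma C_k_diff:
  fixes f g :: "'a::euclidean_space \<Rightarrow> real"
  assumes "C_k k f" "C_k k g"
  shows "C_k k (\<lambda>x. f x - g x)"
  using C_k_add[OF assms(1) C_k_mult[OF C_k_const assms(2), of "-1"]] by simp

lemma C_k_prod:
  fixes f :: "'i \<Rightarrow> 'a::euclidean_space \<Rightarrow> real"
  assumes "\<And>i. i \<in> I \<Longrightarrow> C_k k (f i)"
  shows "C_k k (\<lambda>x. \<Prod>i\<in>I. f i x)"
  using assms by (induction I rule: infinite_finite_induct) (auto intro: C_k_const C_k_mult)

text \<open>The exponent stays general in the induction, since the derivative of
  \<open>g x powr r\<close> contains \<open>g x powr (r - 1)\<close>. Reciprocals and roots of
  positive smooth functions both come from here.\<close>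

lemma C_k_powr:
  fixes g :: "'a::euclidean_space \<Rightarrow> real"
  assumes "C_k k g" "\<And>x. g x > 0"
  shows "C_k k (\<lambda>x. g x powr r)"
  using assms(1)
proof (induction k arbitrary: r)
  case 0
  have "g x \<noteq> 0" for x using assms(2)[of x] by simp
  with 0 show ?case by (auto intro!: continuous_intros)
next
  case (Suc k)
  have "((\<lambda>x. g x powr r) has_derivative (\<lambda>h. r * g x powr (r - 1) * frechet_derivative g (at x) h)) (at x)" for x
  proof -
    have "((\<lambda>t. t powr r) has_real_derivative r * g x powr (r - 1)) (at (g x))"
      using assms(2)[of x] by (rule has_real_derivative_powr)
    from has_derivative_compose[OF C_k_SucD(1)[OF Suc.prems, of x] this[unfolded has_field_derivative_def]]
    show ?thesis .
  qed
  then show ?case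
    by (rule C_k_SucI) (intro C_k_mult C_k_const Suc.IH C_k_SucD(2)[OF Suc.prems] C_k_Suc_imp[OF Suc.prems])
qed

text \<open>\<open>flat 0\<close> is the classical smooth function exp(-1/x) extended by 0. The
  power of x in the denominator makes the family closed under linear combinations of derivatives, so
  that smoothness of all orders is a single induction.\<close>

definition flat :: "nat \<Rightarrow> real \<Rightarrow> real" where
  "flat m x = (if x > 0 then exp (- 1 / x) / x ^ m else 0)"

lemma flat_nonneg: "flat m x \<ge> 0"
  by (simp add: flat_def)

lemma flat_0_pos_iff: "flat 0 x > 0 \<longleftrightarrow> x > 0"
  by (simp add: flat_def)

lemma power_over_fact_le_exp:
  fixes y :: real
  assumes "y \<ge> 0"
  shows "y ^ n / fact n \<le> exp y"
proof -
  have "(\<Sum>k\<in>{n}. y ^ k /\<^sub>R fact k) \<le> (\<Sum>k. y ^ k /\<^sub>R fact k)"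
    using assms by (intro sum_le_suminf summable_exp_generic) auto
  then show ?thesis by (simp add: exp_def field_simps)
qed

text \<open>The term of order m + 2 of the exponential series already bounds exp(1/x) from below. A
  quadratic bound is what makes the difference quotient at 0 tend to 0.\<close>

lemma flat_le: "flat m x \<le> fact (m + 2) * x ^ 2"
proof (cases "x > 0")
  case True
  have "(1 / x) ^ (m + 2) / fact (m + 2) \<le> exp (1 / x)"
    using True by (intro power_over_fact_le_exp) simp
  then have "1 \<le> exp (1 / x) * (fact (m + 2) * x ^ (m + 2))"
    using True by (simp add: field_simps del: fact_Suc power_Suc add_2_eq_Suc')
  then have "exp (- 1 / x) * 1 \<le> exp (- 1 / x) * (exp (1 / x) * (fact (m + 2) * x ^ (m + 2)))"
    by (intro mult_left_mono) auto
  also have "\<dots> = fact (m + 2) * x ^ (m + 2)"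
    by (simp add: exp_minus)
  finally have "exp (- 1 / x) \<le> fact (m + 2) * x ^ 2 * x ^ m"
    by (simp only: power_add mult_ac)
  then show ?thesis
    using True by (simp add: flat_def divide_le_eq del: fact_Suc add_2_eq_Suc')
qed (simp add: flat_def)

lemma has_real_derivative_flat:
  "(flat m has_real_derivative flat (m + 2) x - m * flat (m + 1) x) (at x)"
proof -
  consider "x < 0" | "x = 0" | "x > 0" by linarith
  then show ?thesis
  proof cases
    case 1
    have "((\<lambda>x. 0) has_real_derivative flat (m + 2) x - m * flat (m + 1) x) (at x)"
      using 1 by (simp add: flat_def)
    then show ?thesis
      by (rule has_field_derivative_transform_within_open[where S = "{..<0}"])
        (use 1 in \<open>auto simp: flat_def\<close>)
  next
    case 2
    have "((\<lambda>h. flat m h / h) \<longlongrightarrow> 0) (at 0)"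
    proof (rule Lim_null_comparison)
      have "norm (flat m h / h) \<le> fact (m + 2) * \<bar>h\<bar>" if "h \<noteq> 0" for h
        using flat_le[of m h] flat_nonneg[of m h] that
        by (simp add: divide_le_eq mult.assoc abs_mult_self_eq power2_eq_square del: fact_Suc add_2_eq_Suc')
      then show "\<forall>\<^sub>F h in at 0. norm (flat m h / h) \<le> fact (m + 2) * \<bar>h\<bar>"
        by (auto simp: eventually_at_filter)
      show "((\<lambda>h. fact (m + 2) * \<bar>h\<bar>) \<longlongrightarrow> 0) (at (0::real))"
        by (auto intro!: tendsto_eq_intros)
    qed
    then show ?thesis
      unfolding 2 DERIV_def by (simp add: flat_def)
  next
    case 3
    have "((\<lambda>x. exp (- 1 / x) / x ^ m) has_real_derivative
        (exp (- 1 / x) * (1 / x\<^sup>2) * x ^ m - exp (- 1 / x) * (m * x ^ (m - 1))) / (x ^ m * x ^ m)) (at x)"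
      using 3 by (auto intro!: derivative_eq_intros simp: power2_eq_square)
    moreover have "(exp (- 1 / x) * (1 / x\<^sup>2) * x ^ m - exp (- 1 / x) * (m * x ^ (m - 1))) / (x ^ m * x ^ m)
        = flat (m + 2) x - m * flat (m + 1) x"
      using 3 by (cases m) (simp_all add: flat_def field_simps power2_eq_square)
    ultimately have "((\<lambda>x. exp (- 1 / x) / x ^ m) has_real_derivative flat (m + 2) x - m * flat (m + 1) x) (at x)"
      by (simp only:)
    then show ?thesis
      by (rule has_field_derivative_transform_within_open[where S = "{0<..}"])
        (use 3 in \<open>auto simp: flat_def\<close>)
  qed
qed

lemma C_k_flat:
  fixes g :: "'a::euclidean_space \<Rightarrow> real"
  assumes "C_k k g"
  shows "C_k k (\<lambda>x. flat m (g x))"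
  using assms
proof (induction k arbitrary: m)
  case 0
  have "continuous_on UNIV (flat m)"
    using has_real_derivative_flat DERIV_isCont continuous_at_imp_continuous_on by blast
  from continuous_on_compose2[OF this] 0 show ?case by auto
next
  case (Suc k)
  have "((\<lambda>x. flat m (g x)) has_derivative
      (\<lambda>h. (flat (m + 2) (g x) - m * flat (m + 1) (g x)) * frechet_derivative g (at x) h)) (at x)" for x
    using has_derivative_compose[OF C_k_SucD(1)[OF Suc.prems, of x]
        has_real_derivative_flat[unfolded has_field_derivative_def]] .
  then show ?case
  proof (rule C_k_SucI)
    have "C_k k (\<lambda>x. flat m (g x))" for m
      by (rule Suc.IH[OF C_k_Suc_imp[OF Suc.prems]])
    then show "C_k k (\<lambda>x. (flat (m + 2) (g x) - m * flat (m + 1) (g x)) * frechet_derivative g (at x) i)"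
      if "i \<in> Basis" for i
      by (intro C_k_mult C_k_diff C_k_const C_k_SucD(2)[OF Suc.prems that])
  qed
qed

section \<open>Test functions\<close>

lemma test_function_C_k: "test_function \<Omega> f \<Longrightarrow> C_k k f"
  by (simp add: test_function_def)

lemma has_derivative_grad:
  fixes f :: "'a::euclidean_space \<Rightarrow> real"
  assumes "f differentiable at x"
  shows "(f has_derivative (\<lambda>h. grad f x \<bullet> h)) (at x)"
proof -
  have f: "(f has_derivative frechet_derivative f (at x)) (at x)"
    using assms frechet_derivative_works by blast
  then interpret bounded_linear "frechet_derivative f (at x)"
    by (rule has_derivative_bounded_linear)
  have "frechet_derivative f (at x) h = grad f x \<bullet> h" for h
  proof -
    have "frechet_derivative f (at x) h = frechet_derivative f (at x) (\<Sum>i\<in>Basis. (h \<bullet> i) *\<^sub>R i)"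
      by (simp add: euclidean_representation)
    also have "\<dots> = (\<Sum>i\<in>Basis. (h \<bullet> i) * frechet_derivative f (at x) i)"
      by (simp only: sum scaleR real_scaleR_def)
    also have "\<dots> = grad f x \<bullet> h"
      by (simp add: grad_def inner_sum_left inner_commute[of h] mult.commute)
    finally show ?thesis .
  qed
  with f show ?thesis by (metis (no_types, lifting) ext)
qed

lemma grad_eqI:
  fixes f :: "'a::euclidean_space \<Rightarrow> real"
  assumes "(f has_derivative (\<lambda>h. G \<bullet> h)) (at x)"
  shows "grad f x = G"
proof -
  have "frechet_derivative f (at x) = (\<lambda>h. G \<bullet> h)"
    using frechet_derivative_at[OF assms] by simp
  then show ?thesis
    by (simp add: grad_def euclidean_representation)
qed

lemma C_1_continuous_grad:
  assumes "C_k 1 f"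
  shows "continuous_on UNIV (grad f)"
  using assms unfolding grad_def by (auto intro!: continuous_intros)

context
  fixes \<Omega> :: "'a::euclidean_space set" and f :: "'a \<Rightarrow> real"
  assumes f: "test_function \<Omega> f"
begin

lemma test_function_has_derivative: "(f has_derivative (\<lambda>h. grad f x \<bullet> h)) (at x)"
  using test_function_C_k[OF f, of 1] by (intro has_derivative_grad) simp

lemma test_function_continuous: "continuous_on S f"
  using test_function_C_k[OF f, of 0] continuous_on_subset by auto

lemma test_function_continuous_grad: "continuous_on S (grad f)"
  using C_1_continuous_grad[OF test_function_C_k[OF f]] continuous_on_subset by blast

lemma test_function_eq_0: "x \<notin> \<Omega> \<Longrightarrow> f x = 0"
  using f closure_subset[of "{x. f x \<noteq> 0}"] unfolding test_function_def by auto

lemma grad_eq_0_outside_support: "x \<notin> closure {x. f x \<noteq> 0} \<Longrightarrow> grad f x = 0"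
proof (rule grad_eqI)
  assume x: "x \<notin> closure {x. f x \<noteq> 0}"
  have "((\<lambda>x. 0) has_derivative (\<lambda>h. 0 \<bullet> h)) (at x)" by simp
  then show "(f has_derivative (\<lambda>h. 0 \<bullet> h)) (at x)"
  proof (rule has_derivative_transform_within_open[where s = "- closure {x. f x \<noteq> 0}"])
    show "0 = f y" if "y \<in> - closure {x. f x \<noteq> 0}" for y
      using that closure_subset[of "{x. f x \<noteq> 0}"] by auto
  qed (use x in auto)
qed

lemma test_function_grad_eq_0: "x \<notin> \<Omega> \<Longrightarrow> grad f x = 0"
  using grad_eq_0_outside_support f unfolding test_function_def by blast

lemma test_function_bounded:
  obtains B where "B > 0" "\<And>x. \<bar>f x\<bar> \<le> B" "\<And>x. norm (grad f x) \<le> B"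
proof -
  let ?S = "closure {x. f x \<noteq> 0}"
  have S: "compact ?S" using f by (simp add: test_function_def)
  have "bounded (f ` ?S)" "bounded (grad f ` ?S)"
    by (auto intro!: compact_imp_bounded compact_continuous_image S test_function_continuous
        test_function_continuous_grad)
  then obtain B1 B2 where B: "\<And>x. x \<in> ?S \<Longrightarrow> \<bar>f x\<bar> \<le> B1" "\<And>x. x \<in> ?S \<Longrightarrow> norm (grad f x) \<le> B2"
    unfolding bounded_iff by auto
  show thesis
  proof (rule that[of "max 1 (max B1 B2)"])
    show "\<bar>f x\<bar> \<le> max 1 (max B1 B2)" for x
      using B(1)[of x] closure_subset[of "{x. f x \<noteq> 0}"] by (cases "f x = 0") auto
    show "norm (grad f x) \<le> max 1 (max B1 B2)" for x
      using B(2)[of x] grad_eq_0_outside_support[of x] by (cases "x \<in> ?S") auto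
  qed simp
qed

end

lemma test_function_mono: "test_function S f \<Longrightarrow> S \<subseteq> T \<Longrightarrow> test_function T f"
  by (auto simp: test_function_def)

lemma test_functionI:
  assumes "\<And>k. C_k k h" "compact K" "K \<subseteq> \<Omega>" "\<And>x. x \<notin> K \<Longrightarrow> h x = 0"
  shows "test_function \<Omega> h"
proof -
  have "closure {x. h x \<noteq> 0} \<subseteq> K"
    using assms by (intro closure_minimal compact_imp_closed) auto
  then show ?thesis
    using assms compact_Int_closed[OF assms(2), of "closure {x. h x \<noteq> 0}"]
    by (auto simp: test_function_def Int_absorb1)
qed

text \<open>Serves multiples, products and compositions F (f x) (g x) with F 0 0 = 0: the union of
  the two compact supports contains the new one.\<close>

lemma test_function_from_supports:
  assumes "test_function \<Omega> f" "test_function \<Omega> g" "\<And>k. C_k k h"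
    and "\<And>x. f x = 0 \<Longrightarrow> g x = 0 \<Longrightarrow> h x = 0"
  shows "test_function \<Omega> h"
proof (rule test_functionI)
  let ?K = "closure {x. f x \<noteq> 0} \<union> closure {x. g x \<noteq> 0}"
  show "compact ?K" "?K \<subseteq> \<Omega>"
    using assms by (auto simp: test_function_def)
  show "h x = 0" if "x \<notin> ?K" for x
    using that assms(4)[of x] closure_subset[of "{x. f x \<noteq> 0}"] closure_subset[of "{x. g x \<noteq> 0}"] by auto
qed (use assms in auto)

lemma test_function_0: "test_function \<Omega> (\<lambda>x. 0)"
  by (rule test_functionI[where K = "{}"]) (auto intro: C_k_const)

lemma test_function_cmult: "test_function \<Omega> f \<Longrightarrow> test_function \<Omega> (\<lambda>x. c * f x)"
  by (rule test_function_from_supports[of _ f f]) (auto intro: C_k_const C_k_mult test_function_C_k)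

lemma test_function_mult:
  "test_function \<Omega> f \<Longrightarrow> test_function \<Omega> g \<Longrightarrow> test_function \<Omega> (\<lambda>x. f x * g x)"
  by (rule test_function_from_supports[of _ f g]) (auto intro: C_k_mult test_function_C_k)

lemma grad_mult:
  assumes "test_function \<Omega> f" "test_function \<Omega> g"
  shows "grad (\<lambda>x. f x * g x) x = f x *\<^sub>R grad g x + g x *\<^sub>R grad f x"
  by (rule grad_eqI)
    (auto intro!: derivative_eq_intros test_function_has_derivative[OF assms(1)]
      test_function_has_derivative[OF assms(2)] simp: inner_add_left)

lemma grad_cmult:
  assumes "test_function \<Omega> f"
  shows "grad (\<lambda>x. c * f x) x = c *\<^sub>R grad f x"
  by (rule grad_eqI) (auto intro!: derivative_eq_intros test_function_has_derivative[OF assms])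

section \<open>Bumps on boxes and cutoffs with a plateau\<close>

definition box_bump :: "'a \<Rightarrow> 'a \<Rightarrow> 'a::euclidean_space \<Rightarrow> real" where
  "box_bump a b x = (\<Prod>i\<in>Basis. flat 0 (x \<bullet> i - a \<bullet> i) * flat 0 (b \<bullet> i - x \<bullet> i))"

lemma C_k_box_bump: "C_k k (box_bump a b)"
  unfolding box_bump_def by (intro C_k_prod C_k_mult C_k_flat C_k_diff C_k_const C_k_inner)

lemma box_bump_nonneg: "box_bump a b x \<ge> 0"
  unfolding box_bump_def by (intro prod_nonneg) (simp add: flat_nonneg)

lemma box_bump_pos_iff: "box_bump a b x > 0 \<longleftrightarrow> x \<in> box a b"
proof -
  have "box_bump a b x \<noteq> 0 \<longleftrightarrow> (\<forall>i\<in>Basis. flat 0 (x \<bullet> i - a \<bullet> i) > 0 \<and> flat 0 (b \<bullet> i - x \<bullet> i) > 0)"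
    unfolding box_bump_def
    by (simp add: flat_nonneg order_less_le[of 0] eq_commute[of 0])
  then have "box_bump a b x \<noteq> 0 \<longleftrightarrow> x \<in> box a b"
    by (simp add: flat_0_pos_iff mem_box)
  then show ?thesis
    using box_bump_nonneg[of a b x] by linarith
qed

lemma box_bump_eq_0_iff: "box_bump a b x = 0 \<longleftrightarrow> x \<notin> box a b"
  using box_bump_pos_iff[of a b x] box_bump_nonneg[of a b x] by force

text \<open>As d decreases to 0 these quotients increase to the indicator of the open box; in this
  way integrals over boxes are reached from test functions.\<close>

lemma test_function_box_approx:
  assumes "cbox a b \<subseteq> \<Omega>" "d > 0"
  shows "test_function \<Omega> (\<lambda>x. box_bump a b x / (box_bump a b x + d))"
proof (rule test_functionI)
  have pos: "box_bump a b x + d > 0" for x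
    using box_bump_nonneg[of a b x] assms by linarith
  \<comment> \<open>The division is written as a power with exponent -1, whose smoothness is known
    because the base is positive.\<close>
  have "C_k k (\<lambda>x. box_bump a b x * (box_bump a b x + d) powr - 1)" for k
    by (intro C_k_mult C_k_powr C_k_add C_k_const C_k_box_bump pos)
  moreover have "box_bump a b x * (box_bump a b x + d) powr - 1 = box_bump a b x / (box_bump a b x + d)" for x
    using pos[of x] by (simp add: powr_minus divide_inverse)
  ultimately show "C_k k (\<lambda>x. box_bump a b x / (box_bump a b x + d))" for k
    by (simp only:)
  show "box_bump a b x / (box_bump a b x + d) = 0" if "x \<notin> cbox a b" for x
  proof -
    have "box_bump a b x = 0"
      using that box_subset_cbox[of a b] unfolding box_bump_eq_0_iff by blast
    then show ?thesis by simp
  qed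
qed (use assms in \<open>simp_all add: compact_cbox\<close>)

text \<open>The smooth step A / (A + B) applied to a bump g, with A positive exactly where g > c and
  B positive exactly where g < 2c. These regions cover everything, so the denominator never
  vanishes; the quotient is 1 where g \<ge> 2c and 0 where g \<le> c.\<close>

lemma plateau_exists:
  fixes z :: "'a::euclidean_space"
  assumes "open \<Omega>" "z \<in> \<Omega>"
  obtains \<zeta> r where "test_function \<Omega> \<zeta>" "r > 0" "ball z r \<subseteq> \<Omega>"
    "\<And>x. x \<in> ball z r \<Longrightarrow> \<zeta> x = 1" "\<And>x. x \<in> ball z r \<Longrightarrow> grad \<zeta> x = 0"
    "\<And>x. \<zeta> x \<ge> 0"
proof -
  obtain a b where ab: "z \<in> box a b" "cbox a b \<subseteq> \<Omega>"
    by (rule open_contains_cbox[OF assms])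
  define g where "g = box_bump a b"
  \<comment> \<open>One third, so that g z = 3c lies strictly above the upper threshold 2c and a
    whole ball around z does so too.\<close>
  define c where "c = g z / 3"
  have c: "c > 0" using ab by (simp add: c_def g_def box_bump_pos_iff)
  have Cg: "C_k k g" for k by (simp add: g_def C_k_box_bump)
  define D where "D x = flat 0 (g x - c) + flat 0 (2 * c - g x)" for x
  have D: "D x > 0" for x
  proof (cases "g x > c")
    case True
    then have "flat 0 (g x - c) > 0" by (simp add: flat_0_pos_iff)
    then show ?thesis using flat_nonneg[of 0 "2 * c - g x"] by (simp add: D_def)
  next
    case False
    then have "flat 0 (2 * c - g x) > 0" using c by (simp add: flat_0_pos_iff)
    then show ?thesis using flat_nonneg[of 0 "g x - c"] by (simp add: D_def)
  qed
  define \<zeta> where "\<zeta> x = flat 0 (g x - c) * D x powr - 1" for x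
  have \<zeta>: "test_function \<Omega> \<zeta>"
  proof (rule test_functionI[where K = "cbox a b"])
    show "C_k k \<zeta>" for k
      unfolding \<zeta>_def using D unfolding D_def
      by (intro C_k_mult C_k_powr C_k_add C_k_const C_k_flat C_k_diff Cg) auto
    show "\<zeta> x = 0" if "x \<notin> cbox a b" for x
    proof -
      have "g x = 0"
        using that box_subset_cbox[of a b] unfolding g_def box_bump_eq_0_iff by blast
      then show ?thesis using c by (simp add: \<zeta>_def flat_def)
    qed
  qed (use ab in auto)
  have "continuous_on UNIV g" using Cg[of 0] by simp
  then have "open {x. g x > 2 * c}"
    by (intro open_Collect_less) (auto intro: continuous_intros)
  then have "open ({x. g x > 2 * c} \<inter> \<Omega>)" using assms by blast
  moreover have "z \<in> {x. g x > 2 * c} \<inter> \<Omega>" using c assms by (simp add: c_def)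
  ultimately obtain r where r: "r > 0" "ball z r \<subseteq> {x. g x > 2 * c} \<inter> \<Omega>"
    by (meson openE)
  have 1: "\<zeta> x = 1" if "x \<in> ball z r" for x
  proof -
    have "flat 0 (2 * c - g x) = 0" using r that by (force simp: flat_def)
    then show ?thesis
      using D[of x] by (simp add: \<zeta>_def D_def powr_minus)
  qed
  have 2: "grad \<zeta> x = 0" if "x \<in> ball z r" for x
  proof (rule grad_eqI)
    have "((\<lambda>x. 1) has_derivative (\<lambda>h. 0 \<bullet> h)) (at x)" by simp
    then show "(\<zeta> has_derivative (\<lambda>h. 0 \<bullet> h)) (at x)"
      by (rule has_derivative_transform_within_open[where s = "ball z r"]) (use that 1 in auto)
  qed
  show thesis
    using that[OF \<zeta> r(1) _ 1 2] r(2) by (auto simp: \<zeta>_def flat_nonneg)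
qed

section \<open>The fundamental lemma of the calculus of variations\<close>

text \<open>The positive and the negative part of g are densities of two finite measures that agree
  on boxes. Boxes form an intersection-stable generator, so the measures coincide, and with them the
  densities almost everywhere.\<close>

lemma AE_lborel_eq_0_if_integral_boxes_0:
  fixes g :: "'a::euclidean_space \<Rightarrow> real"
  assumes g: "integrable lborel g"
    and box: "\<And>a b. (LINT x|lborel. indicator (box a b) x * g x) = 0"
  shows "AE x in lborel. g x = 0"
proof -
  have [measurable]: "g \<in> borel_measurable borel" using g by auto
  \<comment> \<open>\<open>ennreal\<close> sends negative numbers to 0, so these densities are the
    positive and the negative part of g.\<close>
  let ?M = "density lborel (\<lambda>x. ennreal (g x))" and ?N = "density lborel (\<lambda>x. ennreal (- g x))"
  have fin: "(\<integral>\<^sup>+x\<in>A. ennreal (g x) \<partial>lborel) < top" "(\<integral>\<^sup>+x\<in>A. ennreal (- g x) \<partial>lborel) < top"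
    for A
  proof -
    have bound: "(\<integral>\<^sup>+x. norm (g x) \<partial>lborel) < top"
      using g by (simp add: integrable_iff_bounded infinity_ennreal_def)
    show "(\<integral>\<^sup>+x\<in>A. ennreal (g x) \<partial>lborel) < top"
      by (rule le_less_trans[OF nn_integral_mono bound]) (auto simp: indicator_def intro: ennreal_leI)
    show "(\<integral>\<^sup>+x\<in>A. ennreal (- g x) \<partial>lborel) < top"
      by (rule le_less_trans[OF nn_integral_mono bound]) (auto simp: indicator_def intro: ennreal_leI)
  qed
  have eq: "emeasure ?M (box a b) = emeasure ?N (box a b)" for a b
  proof -
    have "integrable lborel (\<lambda>x. indicator (box a b) x * g x)"
      using integrable_real_mult_indicator[OF _ g, of "box a b"] by (simp add: mult.commute)
    then have "enn2real (\<integral>\<^sup>+x. ennreal (indicator (box a b) x * g x) \<partial>lborel) =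
        enn2real (\<integral>\<^sup>+x. ennreal (- (indicator (box a b) x * g x)) \<partial>lborel)"
      using box[of a b] by (simp add: real_lebesgue_integral_def)
    moreover have "ennreal (indicator (box a b) x * g x) = ennreal (g x) * indicator (box a b) x"
      "ennreal (- (indicator (box a b) x * g x)) = ennreal (- g x) * indicator (box a b) x" for x
      by (auto simp: indicator_def)
    ultimately have "enn2real (\<integral>\<^sup>+x\<in>box a b. ennreal (g x) \<partial>lborel) =
        enn2real (\<integral>\<^sup>+x\<in>box a b. ennreal (- g x) \<partial>lborel)"
      by simp
    then have "ennreal (enn2real (\<integral>\<^sup>+x\<in>box a b. ennreal (g x) \<partial>lborel)) =
        ennreal (enn2real (\<integral>\<^sup>+x\<in>box a b. ennreal (- g x) \<partial>lborel))"
      by (simp only:)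
    then show ?thesis
      unfolding ennreal_enn2real[OF fin(1)] ennreal_enn2real[OF fin(2)] by (simp add: emeasure_density)
  qed
  have "?M = ?N"
  proof (rule measure_eqI_generator_eq)
    let ?E = "range (\<lambda>(a, b). box a b :: 'a set)"
    show "Int_stable ?E"
      by (auto simp: Int_stable_def box_Int_box)
    show "range (\<lambda>n::nat. box (- (real n *\<^sub>R One)) (real n *\<^sub>R One)) \<subseteq> ?E"
      by auto
    show "(\<Union>n::nat. box (- (real n *\<^sub>R One)) (real n *\<^sub>R One)) = (UNIV :: 'a set)"
      by (rule UN_box_eq_UNIV)
    show "emeasure ?M (box (- (real n *\<^sub>R One)) (real n *\<^sub>R One)) \<noteq> \<infinity>" for n :: nat
      using fin(1) by (simp add: emeasure_density less_top)
    have "sets borel = sigma_sets UNIV ?E"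
      by (subst borel_eq_box) simp
    then show "sets ?M = sigma_sets UNIV ?E" "sets ?N = sigma_sets UNIV ?E"
      by simp_all
  qed (auto simp: eq)
  then have "AE x in lborel. ennreal (g x) = ennreal (- g x)"
    by (intro sigma_finite_measure.density_unique[OF sigma_finite_lborel]) auto
  then show ?thesis
  proof eventually_elim
    fix x assume eq: "ennreal (g x) = ennreal (- g x)"
    show "g x = 0"
    proof (cases "g x \<ge> 0")
      case True
      then have "ennreal (- g x) = 0" by (simp add: ennreal_neg)
      then have "ennreal (g x) = 0" by (rule trans[OF eq])
      then show ?thesis using True by (simp add: ennreal_eq_0_iff)
    next
      case False
      then have "ennreal (g x) = 0" by (simp add: ennreal_neg)
      then have "ennreal (- g x) = 0" by (rule trans[OF eq[symmetric]])
      then show ?thesis using False by (simp add: ennreal_eq_0_iff)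
    qed
  qed
qed

text \<open>Each coordinate of g agrees almost everywhere with a Borel function that has the same
  integrals over boxes, which reduces the claim to the Borel case.\<close>

lemma AE_lebesgue_eq_0_if_integral_boxes_0:
  fixes g :: "'a::euclidean_space \<Rightarrow> 'b::euclidean_space"
  assumes g: "integrable lebesgue g"
    and box: "\<And>a b. (LINT x|lebesgue. indicator (box a b) x *\<^sub>R g x) = 0"
  shows "AE x in lebesgue. g x = 0"
proof -
  have "AE x in lebesgue. g x \<bullet> i = 0" if i: "i \<in> Basis" for i
  proof -
    have gi: "integrable lebesgue (\<lambda>x. g x \<bullet> i)" using g by simp
    then obtain h where h [measurable]: "h \<in> borel_measurable lborel"
      and eq: "AE x in lborel. g x \<bullet> i = h x"
      using completion_ex_borel_measurable_real by blast
    have eq': "AE x in lebesgue. g x \<bullet> i = h x"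
      using eq by (simp add: AE_completion_iff)
    have hm: "h \<in> borel_measurable lebesgue"
      using h by (rule measurable_completion)
    have "integrable lborel h"
    proof -
      have "integrable lebesgue h"
        using integrable_cong_AE_imp[OF gi hm] eq' by (simp add: eq_commute)
      then show ?thesis by (simp add: integrable_completion)
    qed
    moreover have "(LINT x|lborel. indicator (box a b) x * h x) = 0" for a b
    proof -
      have "integrable lebesgue (\<lambda>x. indicator (box a b) x *\<^sub>R g x)"
        by (rule integrable_mult_indicator[OF _ g]) simp
      then have "(LINT x|lebesgue. (indicator (box a b) x *\<^sub>R g x) \<bullet> i) =
          (LINT x|lebesgue. indicator (box a b) x *\<^sub>R g x) \<bullet> i"
        by (intro integral_inner_left)
      then have "0 = (LINT x|lebesgue. (indicator (box a b) x *\<^sub>R g x) \<bullet> i)"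
        by (simp only: box inner_zero_left)
      also have "\<dots> = (LINT x|lebesgue. indicator (box a b) x * h x)"
      proof (rule integral_cong_AE)
        show "(\<lambda>x. indicator (box a b) x * h x) \<in> borel_measurable lebesgue"
          by (intro borel_measurable_times hm borel_measurable_indicator) simp
        show "AE x in lebesgue. (indicator (box a b) x *\<^sub>R g x) \<bullet> i = indicator (box a b) x * h x"
          using eq' by eventually_elim simp
        show "(\<lambda>x. (indicator (box a b) x *\<^sub>R g x) \<bullet> i) \<in> borel_measurable lebesgue"
          using borel_measurable_integrable[OF \<open>integrable lebesgue (\<lambda>x. indicator (box a b) x *\<^sub>R g x)\<close>]
          by (rule borel_measurable_inner[OF _ borel_measurable_const])
      qed
      also have "\<dots> = (LINT x|lborel. indicator (box a b) x * h x)"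
        by (rule integral_completion) measurable
      finally show ?thesis by simp
    qed
    ultimately have "AE x in lborel. h x = 0"
      by (rule AE_lborel_eq_0_if_integral_boxes_0)
    then have "AE x in lebesgue. h x = 0" by (simp add: AE_completion_iff)
    with eq' show ?thesis by eventually_elim simp
  qed
  then have "AE x in lebesgue. \<forall>i\<in>Basis. g x \<bullet> i = 0"
    by (simp add: AE_ball_countable countable_finite)
  then show ?thesis
    by eventually_elim (simp add: euclidean_all_zero_iff)
qed

lemma set_integrable_lebesgue_on_iff:
  fixes f :: "'a::euclidean_space \<Rightarrow> 'b::euclidean_space"
  assumes "S \<in> sets lebesgue"
  shows "integrable (lebesgue_on S) f \<longleftrightarrow> integrable lebesgue (\<lambda>x. indicator S x *\<^sub>R f x)"
  using assms by (simp add: integrable_restrict_space)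

text \<open>The factor f vanishes off K, so integrability of G on K suffices, and the integral over
  \<Omega> may be taken over the whole space, where boxes and translations are available.\<close>

lemma locally_integrable_mult_compact_support:
  fixes G :: "'a::euclidean_space \<Rightarrow> 'b::euclidean_space"
  assumes G: "locally_integrable \<Omega> G" and K: "compact K" "K \<subseteq> \<Omega>" and \<Omega>: "\<Omega> \<in> sets lebesgue"
    and f: "f \<in> borel_measurable borel" "\<And>x. \<bar>f x\<bar> \<le> B" "\<And>x. x \<notin> K \<Longrightarrow> f x = 0"
  shows "integrable (lebesgue_on \<Omega>) (\<lambda>x. f x *\<^sub>R G x)"
    and "integrable lebesgue (\<lambda>x. f x *\<^sub>R G x)"
    and "(LINT x|lebesgue_on \<Omega>. f x *\<^sub>R G x) = (LINT x|lebesgue. f x *\<^sub>R G x)"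
proof -
  have Ks: "K \<in> sets lebesgue" using K by (simp add: compact_imp_closed)
  have GK: "integrable lebesgue (\<lambda>x. indicator K x *\<^sub>R G x)"
    using G K unfolding locally_integrable_def set_integrable_lebesgue_on_iff[OF Ks, symmetric] by blast
  have B: "0 \<le> B" using f(2)[of undefined] by linarith
  have eq: "f x *\<^sub>R G x = f x *\<^sub>R (indicator K x *\<^sub>R G x)" for x
    using f(3)[of x] by (auto simp: indicator_def)
  have fm: "f \<in> borel_measurable lebesgue"
    using f(1) by (intro measurable_completion) simp
  have "integrable lebesgue (\<lambda>x. f x *\<^sub>R (indicator K x *\<^sub>R G x))"
  proof (rule Bochner_Integration.integrable_bound)
    show "integrable lebesgue (\<lambda>x. B *\<^sub>R (indicator K x *\<^sub>R G x))"
      using GK by (rule integrable_scaleR_right)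
    show "(\<lambda>x. f x *\<^sub>R (indicator K x *\<^sub>R G x)) \<in> borel_measurable lebesgue"
      using fm borel_measurable_integrable[OF GK] by (rule borel_measurable_scaleR)
    show "AE x in lebesgue. norm (f x *\<^sub>R (indicator K x *\<^sub>R G x)) \<le> norm (B *\<^sub>R (indicator K x *\<^sub>R G x))"
      using f(2) B by (intro AE_I2) (auto intro!: mult_right_mono simp del: scaleR_scaleR)
  qed
  then show 1: "integrable lebesgue (\<lambda>x. f x *\<^sub>R G x)" by (simp only: eq[symmetric])
  have eq\<Omega>: "f x *\<^sub>R G x = indicator \<Omega> x *\<^sub>R (f x *\<^sub>R G x)" for x
    using f(3)[of x] K by (auto simp: indicator_def)
  show "integrable (lebesgue_on \<Omega>) (\<lambda>x. f x *\<^sub>R G x)"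
    using 1 \<Omega> by (simp add: integrable_restrict_space eq\<Omega>[symmetric] del: scaleR_scaleR)
  show "(LINT x|lebesgue_on \<Omega>. f x *\<^sub>R G x) = (LINT x|lebesgue. f x *\<^sub>R G x)"
    using \<Omega> by (simp add: integral_restrict_space eq\<Omega>[symmetric] del: scaleR_scaleR)
qed

text \<open>The quotients b / (b + 1/(n+1)) of the bump b tend to the indicator of the open box and
  stay below that of the closed box, on which G is integrable.\<close>

lemma integral_box_eq_0_if_test_functions:
  fixes G :: "'a::euclidean_space \<Rightarrow> 'b::euclidean_space"
  assumes G: "locally_integrable \<Omega> G" and \<Omega>: "\<Omega> \<in> sets lebesgue"
    and test: "\<And>f. test_function \<Omega> f \<Longrightarrow> (LINT x|lebesgue_on \<Omega>. f x *\<^sub>R G x) = 0"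
    and ab: "cbox a b \<subseteq> \<Omega>"
  shows "(LINT x|lebesgue. indicator (box a b) x *\<^sub>R G x) = 0"
proof -
  define f where "f n x = box_bump a b x / (box_bump a b x + 1 / real (Suc n))" for n x
  have pos: "box_bump a b x + 1 / real (Suc n) > 0" for n x
    using box_bump_nonneg[of a b x] by (smt (verit) of_nat_0_less_iff zero_less_Suc zero_less_divide_1_iff)
  have f: "test_function \<Omega> (f n)" for n
    unfolding f_def by (rule test_function_box_approx[OF ab]) simp
  have f1: "\<bar>f n x\<bar> \<le> 1" for n x
  proof -
    have "box_bump a b x \<le> box_bump a b x + 1 / real (Suc n)" by simp
    then show ?thesis
      using pos[of x n] box_bump_nonneg[of a b x] by (simp only: f_def abs_divide abs_of_pos abs_of_nonneg divide_le_eq_1_pos)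
  qed
  have f0: "f n x = 0" if "x \<notin> box a b" for n x
    using that by (simp add: f_def box_bump_eq_0_iff)
  have lim: "(\<lambda>n. f n x) \<longlonglongrightarrow> indicator (box a b) x" for x
  proof (cases "x \<in> box a b")
    case True
    then have "box_bump a b x > 0" by (simp add: box_bump_pos_iff)
    moreover have "(\<lambda>n. f n x) \<longlonglongrightarrow> box_bump a b x / (box_bump a b x + 0)"
      unfolding f_def using \<open>box_bump a b x > 0\<close>
      by (intro tendsto_intros LIMSEQ_Suc[OF lim_1_over_n]) auto
    ultimately show ?thesis using True by simp
  qed (simp add: f0)
  have K: "compact (cbox a b)" by (rule compact_cbox)
  have ind: "indicator (box a b) \<in> borel_measurable (borel :: 'a measure)" by simp
  have fm: "f n \<in> borel_measurable borel" for n
    using test_function_continuous[OF f] by (intro borel_measurable_continuous_onI)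
  have b: "x \<in> cbox a b" if "x \<in> box a b" for x using that box_subset_cbox[of a b] by blast
  have f0': "f n x = 0" if "x \<notin> cbox a b" for n x
    using that b f0 by blast
  have int: "integrable lebesgue (\<lambda>x. indicator (cbox a b) x *\<^sub>R G x)"
    using locally_integrable_mult_compact_support(2)[OF G K ab \<Omega>, of "indicator (cbox a b)" 1]
    by (simp add: indicator_def)
  have "(\<lambda>n. LINT x|lebesgue. f n x *\<^sub>R G x) \<longlonglongrightarrow> (LINT x|lebesgue. indicator (box a b) x *\<^sub>R G x)"
  proof (rule integral_dominated_convergence)
    show "integrable lebesgue (\<lambda>x. norm (indicator (cbox a b) x *\<^sub>R G x))"
      using int by (rule integrable_norm)
    show "(\<lambda>x. indicator (box a b) x *\<^sub>R G x) \<in> borel_measurable lebesgue"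
      using locally_integrable_mult_compact_support(2)[OF G K ab \<Omega> ind, of 1] b
      by (intro borel_measurable_integrable) (auto simp: indicator_def)
    show "(\<lambda>x. f n x *\<^sub>R G x) \<in> borel_measurable lebesgue" for n
      using locally_integrable_mult_compact_support(2)[OF G K ab \<Omega> fm f1 f0']
      by (rule borel_measurable_integrable)
    show "AE x in lebesgue. (\<lambda>n. f n x *\<^sub>R G x) \<longlonglongrightarrow> indicator (box a b) x *\<^sub>R G x"
      by (intro AE_I2 tendsto_scaleR lim tendsto_const)
    have "norm (f n x *\<^sub>R G x) \<le> norm (indicator (cbox a b) x *\<^sub>R G x)" for n x
      using f1[of n x] f0[of x n] b[of x] by (cases "x \<in> box a b") (auto intro: mult_left_le_one_le)
    then show "AE x in lebesgue. norm (f n x *\<^sub>R G x) \<le> norm (indicator (cbox a b) x *\<^sub>R G x)" for n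
      by simp
  qed
  moreover have "(LINT x|lebesgue. f n x *\<^sub>R G x) = 0" for n
    using locally_integrable_mult_compact_support(3)[OF G K ab \<Omega> fm f1 f0'] test[OF f]
    by simp
  ultimately show ?thesis by (simp add: LIMSEQ_const_iff)
qed

text \<open>The exceptional null sets of all neighbourhoods may be uncountably many; by Lindelof
  countably many neighbourhoods already cover \<Omega>.\<close>

lemma AE_lebesgue_on_locally:
  fixes \<Omega> :: "'a::euclidean_space set"
  assumes \<Omega>: "open \<Omega>"
    and local: "\<And>z. z \<in> \<Omega> \<Longrightarrow> \<exists>U. open U \<and> z \<in> U \<and> (AE x in lebesgue. x \<in> U \<longrightarrow> P x)"
  shows "AE x in lebesgue_on \<Omega>. P x"
proof -
  define F where "F = {U. open U \<and> (AE x in lebesgue. x \<in> U \<longrightarrow> P x)}"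
  obtain F' where F': "F' \<subseteq> F" "countable F'" "\<Union>F' = \<Union>F"
    using Lindelof[of F] by (auto simp: F_def)
  have "AE x in lebesgue. \<forall>U\<in>F'. x \<in> U \<longrightarrow> P x"
    using F' by (subst AE_ball_countable) (auto simp: F_def)
  then have "AE x in lebesgue. x \<in> \<Omega> \<longrightarrow> P x"
  proof eventually_elim
    fix x assume *: "\<forall>U\<in>F'. x \<in> U \<longrightarrow> P x"
    have "x \<in> \<Union>F'" if "x \<in> \<Omega>"
      unfolding F'(3) using local[OF that] unfolding F_def by blast
    with * show "x \<in> \<Omega> \<longrightarrow> P x" by blast
  qed
  then show ?thesis
    using \<Omega> by (simp add: AE_restrict_space_iff)
qed

lemma fundamental_lemma_of_variations:
  fixes G :: "'a::euclidean_space \<Rightarrow> 'b::euclidean_space"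
  assumes G: "locally_integrable \<Omega> G" and \<Omega>: "open \<Omega>"
    and test: "\<And>f. test_function \<Omega> f \<Longrightarrow> (LINT x|lebesgue_on \<Omega>. f x *\<^sub>R G x) = 0"
  shows "AE x in lebesgue_on \<Omega>. G x = 0"
proof -
  have \<Omega>s: "\<Omega> \<in> sets lebesgue" using \<Omega> by simp
  have local: "AE x in lebesgue. x \<in> box a b \<longrightarrow> G x = 0" if ab: "cbox a b \<subseteq> \<Omega>" for a b
  proof -
    let ?g = "\<lambda>x. indicator (box a b) x *\<^sub>R G x"
    have "AE x in lebesgue. ?g x = 0"
    proof (rule AE_lebesgue_eq_0_if_integral_boxes_0)
      show "integrable lebesgue ?g"
        using box_subset_cbox[of a b]
        by (intro locally_integrable_mult_compact_support(2)[OF G compact_cbox ab \<Omega>s, of _ 1])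
          (auto simp: indicator_def)
      fix c d
      obtain e f where ef: "box a b \<inter> box c d = box e f" by (rule that[OF box_Int_box])
      \<comment> \<open>If \<open>box e f\<close> is empty, a degenerate \<open>cbox e f\<close> may
        stick out of \<Omega>. A nonempty open box has the closed box as its closure, which then
        lies in \<open>cbox a b\<close>.\<close>
      have "cbox e f \<subseteq> \<Omega> \<or> box e f = {}"
      proof (cases "box e f = {}")
        case False
        then have "cbox e f \<subseteq> cbox a b"
          using closure_minimal[OF _ closed_cbox, of "box e f" a b] ef box_subset_cbox[of a b]
          by (auto simp: closure_box)
        then show ?thesis using ab by blast
      qed simp
      then have "(LINT x|lebesgue. indicator (box e f) x *\<^sub>R G x) = 0"
      proof
        assume "cbox e f \<subseteq> \<Omega>"
        with G \<Omega>s test show ?thesis by (rule integral_box_eq_0_if_test_functions)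
      qed simp
      moreover have "indicator (box c d) x *\<^sub>R ?g x = indicator (box e f) x *\<^sub>R G x" for x
        unfolding ef[symmetric] by (auto simp: indicator_def)
      ultimately show "(LINT x|lebesgue. indicator (box c d) x *\<^sub>R ?g x) = 0" by (simp only:)
    qed
    then show ?thesis by eventually_elim (auto simp: indicator_def)
  qed
  show ?thesis
  proof (rule AE_lebesgue_on_locally[OF \<Omega>])
    fix z assume "z \<in> \<Omega>"
    then obtain a b where "cbox a b \<subseteq> \<Omega>" "z \<in> box a b"
      by (rule open_contains_cbox[OF \<Omega>])
    then show "\<exists>U. open U \<and> z \<in> U \<and> (AE x in lebesgue. x \<in> U \<longrightarrow> G x = 0)"
      using local open_box by blast
  qed
qed

section \<open>Integration by parts\<close>

lemma test_function_Lipschitz: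
  assumes f: "test_function \<Omega> f" and B: "\<And>x. norm (grad f x) \<le> B"
  shows "\<bar>f y - f x\<bar> \<le> B * norm (y - x)"
proof -
  have "norm (f y - f x) \<le> B * norm (y - x)"
  proof (rule differentiable_bound[of UNIV f "\<lambda>x h. grad f x \<bullet> h"])
    show "(f has_derivative (\<lambda>h. grad f x \<bullet> h)) (at x within UNIV)" for x
      using test_function_has_derivative[OF f] by simp
    show "onorm (\<lambda>h. grad f x \<bullet> h) \<le> B" for x
    proof (rule onorm_le)
      fix h
      have "norm (grad f x \<bullet> h) \<le> norm (grad f x) * norm h" by (simp add: Cauchy_Schwarz_ineq2)
      also have "\<dots> \<le> B * norm h" using B[of x] by (intro mult_right_mono) auto
      finally show "norm (grad f x \<bullet> h) \<le> B * norm h" .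
    qed
  qed auto
  then show ?thesis by simp
qed

text \<open>Dominated convergence: the Lipschitz bound controls the quotients, and as the steps are
  bounded, all shifted supports lie in one ball. T is merely bounded and measurable, so that it can
  later be the function to be shown constant.\<close>

lemma integral_difference_quotient_tendsto:
  fixes f :: "'a::euclidean_space \<Rightarrow> real" and T :: "'a \<Rightarrow> real"
  assumes f: "test_function \<Omega> f" and T: "T \<in> borel_measurable borel" "\<And>x. \<bar>T x\<bar> \<le> C"
    and r: "r \<longlonglongrightarrow> 0" "\<And>n. r n \<noteq> 0"
  shows "(\<lambda>n. LINT x|lborel. T x * ((f (x + r n *\<^sub>R e) - f x) / r n))
      \<longlonglongrightarrow> (LINT x|lborel. T x * (grad f x \<bullet> e))"
proof -
  obtain B where B: "B > 0" "\<And>x. norm (grad f x) \<le> B"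
    using test_function_bounded[OF f] by metis
  obtain s where s: "\<And>n. \<bar>r n\<bar> \<le> s"
    using convergent_imp_bounded[OF r(1)] by (auto simp: bounded_iff)
  obtain R where R: "\<And>x. f x \<noteq> 0 \<Longrightarrow> norm x \<le> R"
  proof -
    have "bounded {x. f x \<noteq> 0}"
      using f bounded_subset[OF compact_imp_bounded closure_subset] by (auto simp: test_function_def)
    then show thesis using that by (auto simp: bounded_iff)
  qed
  define w where "w x = C * (B * norm e) * indicator (cball 0 (R + s * norm e)) x" for x :: 'a
  have C: "C \<ge> 0" using T(2)[of 0] by linarith
  have meas: "(\<lambda>x. T x * ((f (x + h *\<^sub>R e) - f x) / h)) \<in> borel_measurable lborel" for h
  proof -
    have "f \<in> borel_measurable borel"
      using test_function_continuous[OF f] by (rule borel_measurable_continuous_onI)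
    moreover have "(\<lambda>x. f (x + h *\<^sub>R e)) \<in> borel_measurable borel"
      by (intro borel_measurable_continuous_onI continuous_intros
          continuous_on_compose2[OF test_function_continuous[OF f, of UNIV]]) auto
    ultimately show ?thesis using T(1) by simp
  qed
  show ?thesis
  proof (rule integral_dominated_convergence)
    show "integrable lborel w"
      unfolding w_def by (intro integrable_mult_right integrable_real_indicator) (use emeasure_bounded_finite[OF bounded_cball] in auto)
    show "(\<lambda>x. T x * (grad f x \<bullet> e)) \<in> borel_measurable lborel"
    proof -
      have "grad f \<in> borel_measurable borel"
        using test_function_continuous_grad[OF f] by (rule borel_measurable_continuous_onI)
      then show ?thesis using T(1) by simp
    qed
    show "AE x in lborel. (\<lambda>n. T x * ((f (x + r n *\<^sub>R e) - f x) / r n)) \<longlonglongrightarrow> T x * (grad f x \<bullet> e)"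
    proof (intro AE_I2 tendsto_mult tendsto_const)
      fix x
      have "((\<lambda>t. x + t *\<^sub>R e) has_derivative (\<lambda>t. t *\<^sub>R e)) (at 0)"
        by (auto intro!: derivative_eq_intros)
      from has_derivative_compose[OF this, of f "\<lambda>h. grad f x \<bullet> h"]
      have "((\<lambda>t. f (x + t *\<^sub>R e)) has_derivative (\<lambda>t. grad f x \<bullet> (t *\<^sub>R e))) (at 0)"
        using test_function_has_derivative[OF f, of x] by simp
      then have "((\<lambda>t. f (x + t *\<^sub>R e)) has_real_derivative grad f x \<bullet> e) (at 0)"
        by (rule has_derivative_imp_has_field_derivative) simp
      then have "((\<lambda>t. (f (x + t *\<^sub>R e) - f x) / t) \<longlongrightarrow> grad f x \<bullet> e) (at 0)"
        by (simp add: DERIV_def)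
      then show "(\<lambda>n. (f (x + r n *\<^sub>R e) - f x) / r n) \<longlonglongrightarrow> grad f x \<bullet> e"
        by (rule filterlim_compose) (use r in \<open>auto simp: filterlim_at\<close>)
    qed
    have "norm (T x * ((f (x + r n *\<^sub>R e) - f x) / r n)) \<le> w x" for n x
    proof (cases "x \<in> cball 0 (R + s * norm e)")
      case True
      have "\<bar>f (x + r n *\<^sub>R e) - f x\<bar> \<le> B * (\<bar>r n\<bar> * norm e)"
        using test_function_Lipschitz[OF f B(2), of "x + r n *\<^sub>R e" x] by simp
      then have "\<bar>(f (x + r n *\<^sub>R e) - f x) / r n\<bar> \<le> B * norm e"
        using r(2)[of n] by (simp add: divide_le_eq mult_ac)
      then have "\<bar>T x\<bar> * \<bar>(f (x + r n *\<^sub>R e) - f x) / r n\<bar> \<le> C * (B * norm e)"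
        using T(2)[of x] C by (intro mult_mono) auto
      then show ?thesis
        using True by (simp add: w_def abs_mult)
    next
      case False
      have "norm e \<ge> 0" by simp
      have "\<bar>r n\<bar> * norm e \<le> s * norm e" using s[of n] by (intro mult_right_mono) auto
      moreover have "norm x \<le> norm (x + r n *\<^sub>R e) + \<bar>r n\<bar> * norm e"
        using norm_triangle_ineq4[of "x + r n *\<^sub>R e" "r n *\<^sub>R e"] by simp
      ultimately have "norm (x + r n *\<^sub>R e) > R"
        using False by simp
      then have "f (x + r n *\<^sub>R e) = 0" using R[of "x + r n *\<^sub>R e"] by fastforce
      moreover have "f x = 0"
      proof -
        have "0 \<le> s" using s[of 0] by linarith
        then have "0 \<le> s * norm e" by simp
        then show ?thesis using R[of x] False by fastforce
      qed
      ultimately show ?thesis by (simp add: w_def C B less_imp_le)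
    qed
    then show "AE x in lborel. norm (T x * ((f (x + r n *\<^sub>R e) - f x) / r n)) \<le> w x" for n
      by simp
  qed (rule meas)
qed

lemma integral_lborel_translate:
  fixes f :: "'a::euclidean_space \<Rightarrow> real"
  assumes "f \<in> borel_measurable borel"
  shows "(LINT x|lborel. f (x + c)) = (LINT x|lborel. f x)"
proof -
  have "(LINT x|lborel. f x) = (LINT x|distr lborel borel ((+) c). f x)"
    by (simp only: lborel_distr_plus)
  also have "\<dots> = (LINT x|lborel. f (c + x))"
    using assms by (intro integral_distr) auto
  finally show ?thesis by (simp add: add.commute)
qed

lemma integrable_test_function_lborel:
  assumes f: "test_function \<Omega> f"
  shows "integrable lborel f"
proof -
  let ?K = "closure {x. f x \<noteq> 0}"
  have "integrable lborel (\<lambda>x. indicator ?K x *\<^sub>R f x)"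
    using f test_function_continuous[OF f]
    by (intro borel_integrable_compact) (auto simp: test_function_def)
  moreover have "indicator ?K x *\<^sub>R f x = f x" for x
    using closure_subset[of "{x. f x \<noteq> 0}"] by (auto simp: indicator_def)
  ultimately show ?thesis by (simp only:)
qed

text \<open>With T = 1 the integrals of the difference quotients vanish by translation invariance of
  Lebesgue measure, and so does their limit.\<close>

lemma integral_grad_test_function:
  fixes f :: "'a::euclidean_space \<Rightarrow> real"
  assumes f: "test_function \<Omega> f"
  shows "(LINT x|lborel. grad f x \<bullet> e) = 0"
proof -
  have fm: "f \<in> borel_measurable borel"
    using test_function_continuous[OF f] by (rule borel_measurable_continuous_onI)
  have shift: "integrable lborel (\<lambda>x. f (x + c))" for c
  proof -
    have "integrable (distr lborel borel ((+) c)) f"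
      using integrable_test_function_lborel[OF f] by (simp only: lborel_distr_plus)
    then show ?thesis
      using fm by (subst (asm) integrable_distr_eq) (auto simp: add.commute)
  qed
  let ?r = "\<lambda>n. 1 / real (Suc n)"
  have "(\<lambda>n. LINT x|lborel. 1 * ((f (x + ?r n *\<^sub>R e) - f x) / ?r n)) \<longlonglongrightarrow> (LINT x|lborel. 1 * (grad f x \<bullet> e))"
    by (rule integral_difference_quotient_tendsto[OF f, of _ 1]) (use LIMSEQ_Suc[OF lim_1_over_n] in auto)
  moreover have "(LINT x|lborel. 1 * ((f (x + ?r n *\<^sub>R e) - f x) / ?r n)) = 0" for n
  proof -
    have "(LINT x|lborel. (f (x + ?r n *\<^sub>R e) - f x)) = 0"
      using shift integrable_test_function_lborel[OF f] integral_lborel_translate[OF fm, of "?r n *\<^sub>R e"]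
      by (subst Bochner_Integration.integral_diff) auto
    then show ?thesis by simp
  qed
  ultimately show ?thesis by (simp add: LIMSEQ_const_iff)
qed

section \<open>Bounded open sets and integration by parts for test functions\<close>

locale bounded_domain =
  fixes \<Omega> :: "'a::euclidean_space set"
  assumes open_domain: "open \<Omega>" and bounded_domain: "bounded \<Omega>"
begin

abbreviation M :: "'a measure" where
  "M \<equiv> lebesgue_on \<Omega>"

abbreviation weak_gradient :: "('a \<Rightarrow> real) \<Rightarrow> 'a \<Rightarrow> 'a" (\<open>\<nabla>\<close>) where
  "\<nabla> \<equiv> weak_grad \<Omega>"

lemma sets_domain [simp]: "\<Omega> \<in> sets lebesgue"
  using open_domain by simp

sublocale finite_measure "lebesgue_on \<Omega>"
  using bounded_domain by (intro finite_measure_lebesgue_on bounded_set_imp_lmeasurable) auto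

lemma borel_measurable_continuous:
  fixes f :: "'a \<Rightarrow> 'b::euclidean_space"
  assumes "continuous_on UNIV f"
  shows "f \<in> borel_measurable M"
  using continuous_on_subset[OF assms] by (intro continuous_imp_measurable_on_sets_lebesgue) auto

lemma integrable_bounded:
  fixes f :: "'a \<Rightarrow> 'b::euclidean_space"
  assumes "f \<in> borel_measurable M" "\<And>x. norm (f x) \<le> B"
  shows "integrable M f"
  using assms by (intro integrable_const_bound[of f B]) auto

lemma test_function_measurable:
  assumes "test_function S f"
  shows "f \<in> borel_measurable M" "grad f \<in> borel_measurable M"
  by (rule borel_measurable_continuous, rule test_function_continuous[OF assms] test_function_continuous_grad[OF assms])+

lemma integrable_mult_bounded:
  fixes f :: "'a \<Rightarrow> real" and G :: "'a \<Rightarrow> 'b::euclidean_space"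
  assumes "integrable M G" "f \<in> borel_measurable M" "\<And>x. \<bar>f x\<bar> \<le> B"
  shows "integrable M (\<lambda>x. f x *\<^sub>R G x)"
proof (rule Bochner_Integration.integrable_bound)
  show "integrable M (\<lambda>x. B *\<^sub>R G x)" using assms by simp
  have "norm (f x *\<^sub>R G x) \<le> norm (B *\<^sub>R G x)" for x
    using assms(3)[of x] by (auto intro!: mult_right_mono)
  then show "AE x in M. norm (f x *\<^sub>R G x) \<le> norm (B *\<^sub>R G x)" by simp
qed (use assms in auto)

lemma integrable_bounded_scaleR:
  fixes f :: "'a \<Rightarrow> 'b::euclidean_space" and u :: "'a \<Rightarrow> real"
  assumes "integrable M u" "f \<in> borel_measurable M" "\<And>x. norm (f x) \<le> B"
  shows "integrable M (\<lambda>x. u x *\<^sub>R f x)"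
proof (rule Bochner_Integration.integrable_bound)
  show "integrable M (\<lambda>x. B * u x)" using assms by simp
  have "norm (u x *\<^sub>R f x) \<le> norm (B * u x)" for x
    using mult_mono[OF order_refl order_trans[OF assms(3)[of x] abs_ge_self], of "\<bar>u x\<bar>"]
    by (simp add: abs_mult mult.commute)
  then show "AE x in M. norm (u x *\<^sub>R f x) \<le> norm (B * u x)" by simp
qed (use assms in auto)

lemma integral_domain_eq_lborel:
  fixes g :: "'a \<Rightarrow> real"
  assumes "g \<in> borel_measurable borel" "\<And>x. x \<notin> \<Omega> \<Longrightarrow> g x = 0"
  shows "(LINT x|M. g x) = (LINT x|lborel. g x)"
proof -
  have "indicator \<Omega> x *\<^sub>R g x = g x" for x
    using assms(2)[of x] by (auto simp: indicator_def)
  then have "(LINT x|M. g x) = (LINT x|lebesgue. g x)"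
    by (subst integral_restrict_space) (simp_all only: sets_domain sets.Int_space_eq2)
  also have "\<dots> = (LINT x|lborel. g x)"
    using assms by (intro integral_completion) simp
  finally show ?thesis .
qed

lemma integrable_test_function:
  assumes f: "test_function S f"
  shows "integrable M f" "integrable M (grad f)"
  using test_function_bounded[OF f] test_function_measurable[OF f] by (metis integrable_bounded real_norm_def)+

text \<open>The product is again a test function, so its gradient integrates to 0, and the product
  rule splits this integral.\<close>

lemma integration_by_parts_test_functions:
  assumes f: "test_function \<Omega> f" and g: "test_function \<Omega> g"
  shows "(LINT x|M. f x *\<^sub>R grad g x) = - (LINT x|M. g x *\<^sub>R grad f x)"
proof -
  let ?h = "\<lambda>x. f x * g x"
  have h: "test_function \<Omega> ?h" by (rule test_function_mult[OF f g])
  have "(LINT x|M. grad ?h x) \<bullet> e = 0" for e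
  proof -
    have "(LINT x|M. grad ?h x) \<bullet> e = (LINT x|M. grad ?h x \<bullet> e)"
      using integrable_test_function[OF h] by simp
    also have "\<dots> = (LINT x|lborel. grad ?h x \<bullet> e)"
    proof (rule integral_domain_eq_lborel)
      show "(\<lambda>x. grad ?h x \<bullet> e) \<in> borel_measurable borel"
        using test_function_continuous_grad[OF h]
        by (intro borel_measurable_continuous_onI continuous_intros)
    qed (simp add: test_function_grad_eq_0[OF h])
    finally show ?thesis using integral_grad_test_function[OF h] by simp
  qed
  then have "(LINT x|M. grad ?h x) = 0" by (metis inner_eq_zero_iff)
  moreover have "integrable M (\<lambda>x. f x *\<^sub>R grad g x)" "integrable M (\<lambda>x. g x *\<^sub>R grad f x)"
    using f g test_function_bounded
    by (metis integrable_bounded_scaleR integrable_test_function(1) test_function_measurable(2))+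
  ultimately have "(LINT x|M. f x *\<^sub>R grad g x) + (LINT x|M. g x *\<^sub>R grad f x) = 0"
    by (simp add: grad_mult[OF f g])
  then show ?thesis by (simp add: eq_neg_iff_add_eq_0)
qed

section \<open>Weak gradients\<close>

lemma integrable_imp_locally_integrable:
  fixes f :: "'a \<Rightarrow> 'b::euclidean_space"
  assumes "integrable M f"
  shows "locally_integrable \<Omega> f"
  unfolding locally_integrable_def
proof (intro allI impI)
  fix K assume K: "compact K \<and> K \<subseteq> \<Omega>"
  then have Ks: "K \<in> sets lebesgue" by (simp add: compact_imp_closed)
  have "integrable lebesgue (\<lambda>x. indicator \<Omega> x *\<^sub>R f x)"
    using assms by (simp add: integrable_restrict_space)
  then have "integrable lebesgue (\<lambda>x. indicator K x *\<^sub>R (indicator \<Omega> x *\<^sub>R f x))"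
    by (rule integrable_mult_indicator[OF Ks])
  moreover have "indicator K x *\<^sub>R (indicator \<Omega> x *\<^sub>R f x) = indicator K x *\<^sub>R f x" for x
    using K by (auto simp: indicator_def)
  ultimately have "integrable lebesgue (\<lambda>x. indicator K x *\<^sub>R f x)" by (simp only:)
  then show "integrable (lebesgue_on K) f"
    using Ks by (simp add: integrable_restrict_space)
qed

lemma has_weak_gradientI:
  assumes "integrable M u" "integrable M G"
    and "\<And>f. test_function \<Omega> f \<Longrightarrow>
        (LINT x|M. u x *\<^sub>R grad f x) = - (LINT x|M. f x *\<^sub>R G x)"
  shows "has_weak_gradient \<Omega> u G"
  using assms by (simp add: has_weak_gradient_def integrable_imp_locally_integrable)

lemma has_weak_gradient_test_function:
  assumes "test_function \<Omega> f"
  shows "has_weak_gradient \<Omega> f (grad f)"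
  using integration_by_parts_test_functions[OF assms] integrable_test_function[OF assms]
  by (intro has_weak_gradientI) auto

text \<open>All test functions annihilate the difference. Uniqueness is what tames the choice in
  \<open>weak_grad\<close>: whichever representative is chosen, it agrees almost everywhere with a
  gradient found by computation.\<close>

lemma has_weak_gradient_unique:
  assumes G: "has_weak_gradient \<Omega> u G" and G': "has_weak_gradient \<Omega> u G'"
  shows "AE x in M. G x = G' x"
proof -
  have loc: "locally_integrable \<Omega> G" "locally_integrable \<Omega> G'"
    using G G' by (auto simp: has_weak_gradient_def)
  have "AE x in M. G x - G' x = 0"
  proof (rule fundamental_lemma_of_variations[OF _ open_domain])
    show "locally_integrable \<Omega> (\<lambda>x. G x - G' x)"
      using loc unfolding locally_integrable_def by auto
    fix f assume f: "test_function \<Omega> f"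
    obtain B where B: "\<And>x. \<bar>f x\<bar> \<le> B" using test_function_bounded[OF f] by metis
    have K: "compact (closure {x. f x \<noteq> 0})" "closure {x. f x \<noteq> 0} \<subseteq> \<Omega>"
      using f by (auto simp: test_function_def)
    have fm: "f \<in> borel_measurable borel"
      using test_function_continuous[OF f] by (rule borel_measurable_continuous_onI)
    have 0: "f x = 0" if "x \<notin> closure {x. f x \<noteq> 0}" for x
      using that closure_subset[of "{x. f x \<noteq> 0}"] by auto
    have "integrable M (\<lambda>x. f x *\<^sub>R G x)" "integrable M (\<lambda>x. f x *\<^sub>R G' x)"
      using locally_integrable_mult_compact_support(1)[OF loc(1) K _ fm B 0]
        locally_integrable_mult_compact_support(1)[OF loc(2) K _ fm B 0] by simp_all
    moreover have "- (LINT x|M. f x *\<^sub>R G x) = - (LINT x|M. f x *\<^sub>R G' x)"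
      using G G' f unfolding has_weak_gradient_def by metis
    ultimately show "(LINT x|M. f x *\<^sub>R (G x - G' x)) = 0"
      by (simp add: scaleR_diff_right)
  qed
  then show ?thesis by simp
qed

lemma has_weak_gradient_weak_grad:
  assumes "has_weak_gradient \<Omega> u G"
  shows "has_weak_gradient \<Omega> u (\<nabla> u)"
  unfolding weak_grad_def using assms by (rule someI[of "has_weak_gradient \<Omega> u"])

lemma weak_grad_AE_eq:
  assumes "has_weak_gradient \<Omega> u G"
  shows "AE x in M. \<nabla> u x = G x"
  using has_weak_gradient_unique[OF has_weak_gradient_weak_grad[OF assms] assms] .

end

section \<open>Sobolev functions as dominated limits\<close>

lemma powr_norm_add_le:
  fixes a b :: "'a::real_normed_vector"
  assumes "p \<ge> 0"
  shows "norm (a + b) powr p \<le> 2 powr p * (norm a powr p + norm b powr p)"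
proof -
  have "norm (a + b) \<le> 2 * max (norm a) (norm b)"
    using norm_triangle_ineq[of a b] by linarith
  then have "norm (a + b) powr p \<le> (2 * max (norm a) (norm b)) powr p"
    using assms by (intro powr_mono2) auto
  also have "\<dots> = 2 powr p * max (norm a) (norm b) powr p"
    by (simp add: powr_mult)
  also have "\<dots> \<le> 2 powr p * (norm a powr p + norm b powr p)"
    by (intro mult_left_mono) (auto simp: max_def)
  finally show ?thesis .
qed

lemma le_one_plus_powr:
  fixes t p :: real
  assumes "t \<ge> 0" "p \<ge> 1"
  shows "t \<le> 1 + t powr p"
proof (cases "t \<le> 1")
  case False
  then have "t powr 1 \<le> t powr p" using assms by (intro powr_mono) auto
  then show ?thesis using False by simp
qed (simp add: add_increasing2)

lemma tendsto_powr_zero_iff: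
  fixes f :: "nat \<Rightarrow> real"
  assumes "\<And>n. f n \<ge> 0" "p > 0"
  shows "(\<lambda>n. f n powr p) \<longlonglongrightarrow> 0 \<longleftrightarrow> f \<longlonglongrightarrow> 0"
proof
  assume "(\<lambda>n. f n powr p) \<longlonglongrightarrow> 0"
  then have "(\<lambda>n. (f n powr p) powr (1 / p)) \<longlonglongrightarrow> 0 powr (1 / p)"
    using assms by (intro tendsto_powr2 tendsto_const) auto
  then show "f \<longlonglongrightarrow> 0" using assms by (simp add: powr_powr)
next
  assume "f \<longlonglongrightarrow> 0"
  then have "(\<lambda>n. f n powr p) \<longlonglongrightarrow> 0 powr p"
    using assms by (intro tendsto_powr2 tendsto_const) auto
  then show "(\<lambda>n. f n powr p) \<longlonglongrightarrow> 0" by simp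
qed

lemma powr_tendsto_zero:
  fixes f :: "nat \<Rightarrow> 'a::real_normed_vector"
  assumes "(\<lambda>n. norm (f n) powr p) \<longlonglongrightarrow> 0" "p > 0"
  shows "f \<longlonglongrightarrow> 0"
  using assms tendsto_powr_zero_iff[of "\<lambda>n. norm (f n)" p] by (simp add: tendsto_norm_zero_iff)

text \<open>Indices are selected with integrals below 2^(-n). The sum of the selected functions is
  then integrable; it is the common majorant, and its finiteness almost everywhere forces the terms
  to 0. The selection r need not be increasing.\<close>

lemma dominated_subsequence:
  fixes e :: "nat \<Rightarrow> 'a \<Rightarrow> real"
  assumes int: "\<And>n. integrable M (e n)" and nonneg: "\<And>n x. e n x \<ge> 0"
    and lim: "(\<lambda>n. LINT x|M. e n x) \<longlonglongrightarrow> 0"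
  obtains r :: "nat \<Rightarrow> nat" and H where "integrable M H"
    "AE x in M. (\<lambda>n. e (r n) x) \<longlonglongrightarrow> 0" "AE x in M. \<forall>n. e (r n) x \<le> H x"
proof -
  have "\<exists>m. (LINT x|M. e m x) < (1 / 2) ^ n" for n
    using order_tendstoD(2)[OF lim, of "(1 / 2) ^ n"] by (auto simp: eventually_sequentially)
  then obtain r where r: "\<And>n. (LINT x|M. e (r n) x) < (1 / 2) ^ n" by metis
  define S where "S x = (\<Sum>n. ennreal (e (r n) x))" for x
  have [measurable]: "e n \<in> borel_measurable M" for n using int by auto
  have Sm [measurable]: "S \<in> borel_measurable M" unfolding S_def by measurable
  have "(\<integral>\<^sup>+x. S x \<partial>M) = (\<Sum>n. \<integral>\<^sup>+x. ennreal (e (r n) x) \<partial>M)"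
    unfolding S_def by (rule nn_integral_suminf) measurable
  also have "\<dots> = (\<Sum>n. ennreal (LINT x|M. e (r n) x))"
    using int nonneg by (simp add: nn_integral_eq_integral)
  also have "\<dots> \<le> (\<Sum>n. ennreal ((1 / 2) ^ n))"
    using r by (intro suminf_le ennreal_leI) (auto simp: less_imp_le)
  also have "\<dots> < top"
    by (subst suminf_ennreal2) (auto simp: summable_geometric)
  finally have fin: "(\<integral>\<^sup>+x. S x \<partial>M) < top" .
  then have AE: "AE x in M. S x \<noteq> top"
    using nn_integral_noteq_infinite[OF Sm] by (auto simp: infinity_ennreal_def)
  show thesis
  proof (rule that[of "\<lambda>x. enn2real (S x)" r])
    show "integrable M (\<lambda>x. enn2real (S x))"
    proof (rule integrableI_bounded)
      have "(\<integral>\<^sup>+x. ennreal (norm (enn2real (S x))) \<partial>M) \<le> (\<integral>\<^sup>+x. S x \<partial>M)"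
        by (intro nn_integral_mono) (simp add: enn2real_nonneg ennreal_enn2real_if)
      then show "(\<integral>\<^sup>+x. ennreal (norm (enn2real (S x))) \<partial>M) < \<infinity>"
        using fin by (simp add: le_less_trans infinity_ennreal_def)
    qed measurable
    show "AE x in M. (\<lambda>n. e (r n) x) \<longlonglongrightarrow> 0"
      using AE by eventually_elim (auto simp: S_def nonneg intro!: summable_LIMSEQ_zero summable_suminf_not_top)
    show "AE x in M. \<forall>n. e (r n) x \<le> enn2real (S x)"
      using AE
    proof (eventually_elim, intro allI)
      fix x n assume S: "S x \<noteq> top"
      have "ennreal (e (r n) x) \<le> S x"
        unfolding S_def using sum_le_suminf[of "\<lambda>n. ennreal (e (r n) x)" "{n}"] by (simp add: summableI)
      then have "enn2real (ennreal (e (r n) x)) \<le> enn2real (S x)"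
        using S by (intro enn2real_mono) (auto simp: less_top)
      then show "e (r n) x \<le> enn2real (S x)" using nonneg by simp
    qed
  qed
qed

context bounded_domain
begin

text \<open>Holds because Lebesgue measure is complete. It supplies measurability of a
  \<open>weak_grad\<close>, an arbitrary representative, from that of a computed gradient.\<close>

lemma measurable_AE_eq:
  fixes f g :: "'a \<Rightarrow> 'b::euclidean_space"
  assumes f: "f \<in> borel_measurable M" and eq: "AE x in M. f x = g x"
  shows "g \<in> borel_measurable M"
proof -
  have "(\<lambda>x. indicator \<Omega> x *\<^sub>R f x) \<in> borel_measurable lebesgue"
    using f by (simp add: borel_measurable_restrict_space_iff)
  moreover have "AE x in lebesgue. indicator \<Omega> x *\<^sub>R f x = indicator \<Omega> x *\<^sub>R g x"
    using eq by (auto simp: AE_restrict_space_iff indicator_def elim!: eventually_mono)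
  ultimately have "(\<lambda>x. indicator \<Omega> x *\<^sub>R g x) \<in> borel_measurable lebesgue"
    by (rule borel_measurable_AE)
  then show ?thesis by (simp add: borel_measurable_restrict_space_iff)
qed

lemma in_Lp_AE_eq:
  fixes f g :: "'a \<Rightarrow> 'b::euclidean_space"
  assumes f: "in_Lp p \<Omega> f" and eq: "AE x in M. f x = g x"
  shows "in_Lp p \<Omega> g"
proof -
  have gm: "g \<in> borel_measurable M"
    using f eq measurable_AE_eq by (auto simp: in_Lp_def)
  have "integrable M (\<lambda>x. norm (g x) powr p)"
  proof (rule integrable_cong_AE_imp)
    show "integrable M (\<lambda>x. norm (f x) powr p)" using f by (simp add: in_Lp_def)
    show "AE x in M. norm (f x) powr p = norm (g x) powr p"
      using eq by eventually_elim simp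
  qed (use gm in measurable)
  with gm show ?thesis by (simp add: in_Lp_def)
qed

lemma in_Lp_dominated:
  fixes f :: "'a \<Rightarrow> 'b::euclidean_space"
  assumes "f \<in> borel_measurable M" "integrable M H"
    and "AE x in M. norm (f x) powr p \<le> H x"
  shows "in_Lp p \<Omega> f"
  unfolding in_Lp_def
proof
  show "integrable M (\<lambda>x. norm (f x) powr p)"
  proof (rule Bochner_Integration.integrable_bound[OF assms(2)])
    show "AE x in M. norm (norm (f x) powr p) \<le> norm (H x)"
      using assms(3) by eventually_elim auto
  qed (use assms(1) in measurable)
qed fact

lemma in_Lp_imp_integrable:
  fixes f :: "'a \<Rightarrow> 'b::euclidean_space"
  assumes f: "in_Lp p \<Omega> f" and p: "p \<ge> 1"
  shows "integrable M f"
proof (rule Bochner_Integration.integrable_bound)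
  show "integrable M (\<lambda>x. 1 + norm (f x) powr p)"
    using f by (simp add: in_Lp_def)
  show "AE x in M. norm (f x) \<le> norm (1 + norm (f x) powr p)"
    using le_one_plus_powr[OF norm_ge_zero p] by (intro AE_I2) (simp add: add_nonneg_nonneg)
qed (use f in \<open>simp add: in_Lp_def\<close>)

lemma in_Lp_add:
  fixes f g :: "'a \<Rightarrow> 'b::euclidean_space"
  assumes "in_Lp p \<Omega> f" "in_Lp p \<Omega> g" "p \<ge> 0"
  shows "in_Lp p \<Omega> (\<lambda>x. f x + g x)"
proof (rule in_Lp_dominated)
  show "integrable M (\<lambda>x. 2 powr p * (norm (f x) powr p + norm (g x) powr p))"
    using assms by (simp add: in_Lp_def)
qed (use assms powr_norm_add_le in \<open>auto simp: in_Lp_def\<close>)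

lemma in_Lp_scaleR:
  fixes f :: "'a \<Rightarrow> 'b::euclidean_space"
  assumes "in_Lp p \<Omega> f"
  shows "in_Lp p \<Omega> (\<lambda>x. c *\<^sub>R f x)"
  using assms by (auto simp: in_Lp_def powr_mult)

lemma in_Lp_diff:
  fixes f g :: "'a \<Rightarrow> 'b::euclidean_space"
  assumes "in_Lp p \<Omega> f" "in_Lp p \<Omega> g" "p \<ge> 0"
  shows "in_Lp p \<Omega> (\<lambda>x. f x - g x)"
  using in_Lp_add[OF assms(1) in_Lp_scaleR[OF assms(2), of "-1"] assms(3)] by simp

lemma in_Lp_test_function:
  assumes f: "test_function S f" and p: "p \<ge> 0"
  shows "in_Lp p \<Omega> f" "in_Lp p \<Omega> (grad f)"
proof -
  obtain B where B: "\<And>x. \<bar>f x\<bar> \<le> B" "\<And>x. norm (grad f x) \<le> B" using test_function_bounded[OF f] by metis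
  show "in_Lp p \<Omega> f"
    by (rule in_Lp_dominated[where H = "\<lambda>x. B powr p"])
      (use B p in \<open>auto intro!: powr_mono2 test_function_measurable[OF f]\<close>)
  show "in_Lp p \<Omega> (grad f)"
    by (rule in_Lp_dominated[where H = "\<lambda>x. B powr p"])
      (use B p in \<open>auto intro!: powr_mono2 test_function_measurable[OF f]\<close>)
qed

lemma W1pD:
  assumes "u \<in> W1p_0 p \<Omega>"
  shows "in_Lp p \<Omega> u" "in_Lp p \<Omega> (\<nabla> u)" "has_weak_gradient \<Omega> u (\<nabla> u)"
  using assms has_weak_gradient_weak_grad by (auto simp: W1p_0_def W1p_def)

lemma has_weak_gradient_diff:
  assumes u: "has_weak_gradient \<Omega> u G" "integrable M u" "integrable M G"
    and v: "has_weak_gradient \<Omega> v F" "integrable M v" "integrable M F"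
  shows "has_weak_gradient \<Omega> (\<lambda>x. u x - v x) (\<lambda>x. G x - F x)"
proof (rule has_weak_gradientI)
  fix f assume f: "test_function \<Omega> f"
  obtain B where B: "\<And>x. \<bar>f x\<bar> \<le> B" "\<And>x. norm (grad f x) \<le> B" using test_function_bounded[OF f] by metis
  note m = test_function_measurable[OF f]
  show "(LINT x|M. (u x - v x) *\<^sub>R grad f x) = - (LINT x|M. f x *\<^sub>R (G x - F x))"
    using u(1) v(1) f integrable_bounded_scaleR[OF u(2) m(2) B(2)] integrable_bounded_scaleR[OF v(2) m(2) B(2)]
      integrable_mult_bounded[OF u(3) m(1) B(1)] integrable_mult_bounded[OF v(3) m(1) B(1)]
    by (simp add: has_weak_gradient_def scaleR_diff_left scaleR_diff_right)
qed (use u v in auto)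

lemma W1p_norm_diff_test_function:
  assumes p: "p > 1" and u: "in_Lp p \<Omega> u" "has_weak_gradient \<Omega> u G" "in_Lp p \<Omega> G" and f: "test_function \<Omega> f"
  shows "W1p_norm p \<Omega> (\<lambda>x. u x - f x) =
    ((LINT x|M. \<bar>u x - f x\<bar> powr p) + (LINT x|M. norm (G x - grad f x) powr p)) powr (1 / p)"
proof -
  have p1: "p \<ge> 1" using p by simp
  have wg: "has_weak_gradient \<Omega> (\<lambda>x. u x - f x) (\<lambda>x. G x - grad f x)"
    by (intro has_weak_gradient_diff has_weak_gradient_test_function u f in_Lp_imp_integrable[OF _ p1]
        integrable_test_function[OF f])
  have "in_Lp p \<Omega> (\<lambda>x. G x - grad f x)"
    using u in_Lp_test_function[OF f] p by (intro in_Lp_diff) auto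
  then have m: "(\<lambda>x. G x - grad f x) \<in> borel_measurable M"
    by (simp add: in_Lp_def)
  have eq: "AE x in M. \<nabla> (\<lambda>x. u x - f x) x = G x - grad f x"
    by (rule weak_grad_AE_eq[OF wg])
  have m': "\<nabla> (\<lambda>x. u x - f x) \<in> borel_measurable M"
    by (rule measurable_AE_eq[OF m AE_symmetric[OF eq]])
  have "(LINT x|M. norm (\<nabla> (\<lambda>x. u x - f x) x) powr p) =
      (LINT x|M. norm (G x - grad f x) powr p)"
  proof (rule integral_cong_AE)
    show "AE x in M. norm (\<nabla> (\<lambda>x. u x - f x) x) powr p = norm (G x - grad f x) powr p"
      using eq by eventually_elim simp
  qed (use m m' in measurable)
  then show ?thesis by (simp add: W1p_norm_def)
qed

text \<open>The norm in the definition uses the chosen weak gradient of u - f n and a p-th root.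
  Here that gradient is the explicit difference and the root is gone, which leaves a single integral
  that can be dominated.\<close>

lemma W1p_0_iff:
  assumes p: "p > 1"
  shows "u \<in> W1p_0 p \<Omega> \<longleftrightarrow> in_Lp p \<Omega> u \<and> has_weak_gradient \<Omega> u (\<nabla> u) \<and> in_Lp p \<Omega> (\<nabla> u) \<and>
    (\<exists>f. (\<forall>n. test_function \<Omega> (f n)) \<and>
      (\<lambda>n. (LINT x|M. \<bar>u x - f n x\<bar> powr p + norm (\<nabla> u x - grad (f n) x) powr p)) \<longlonglongrightarrow> 0)"
proof -
  have eq: "(\<lambda>n. W1p_norm p \<Omega> (\<lambda>x. u x - f n x)) \<longlonglongrightarrow> 0 \<longleftrightarrow>
      (\<lambda>n. (LINT x|M. \<bar>u x - f n x\<bar> powr p + norm (\<nabla> u x - grad (f n) x) powr p)) \<longlonglongrightarrow> 0"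
    if u: "in_Lp p \<Omega> u" "has_weak_gradient \<Omega> u (\<nabla> u)" "in_Lp p \<Omega> (\<nabla> u)"
      and f: "\<And>n. test_function \<Omega> (f n)" for f
  proof -
    have "in_Lp p \<Omega> (\<lambda>x. u x - f n x)" "in_Lp p \<Omega> (\<lambda>x. \<nabla> u x - grad (f n) x)" for n
      using u in_Lp_test_function[OF f] p by (auto intro!: in_Lp_diff)
    then have "W1p_norm p \<Omega> (\<lambda>x. u x - f n x) =
        (LINT x|M. \<bar>u x - f n x\<bar> powr p + norm (\<nabla> u x - grad (f n) x) powr p) powr (1 / p)" for n
      unfolding W1p_norm_diff_test_function[OF p u f]
      by (subst Bochner_Integration.integral_add) (auto simp: in_Lp_def)
    then show ?thesis
      using p by (simp add: tendsto_powr_zero_iff)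
  qed
  show ?thesis
    using eq W1pD[of u p] unfolding W1p_0_def W1p_def by blast
qed

lemma test_function_in_W1p_0:
  assumes p: "p > 1" and f: "test_function \<Omega> f"
  shows "f \<in> W1p_0 p \<Omega>" "AE x in M. \<nabla> f x = grad f x"
proof -
  have wg: "has_weak_gradient \<Omega> f (grad f)" by (rule has_weak_gradient_test_function[OF f])
  show eq: "AE x in M. \<nabla> f x = grad f x" by (rule weak_grad_AE_eq[OF wg])
  have Lp: "in_Lp p \<Omega> (\<nabla> f)"
    using p by (intro in_Lp_AE_eq[OF in_Lp_test_function(2)[OF f] AE_symmetric[OF eq]]) simp
  have "(LINT x|M. \<bar>f x - f x\<bar> powr p + norm (\<nabla> f x - grad f x) powr p) = 0"
    by (rule integral_eq_zero_AE) (use eq in eventually_elim, simp)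
  then have "(\<lambda>n::nat. LINT x|M. \<bar>f x - f x\<bar> powr p + norm (\<nabla> f x - grad f x) powr p) \<longlonglongrightarrow> 0"
    by simp
  then show "f \<in> W1p_0 p \<Omega>"
    unfolding W1p_0_iff[OF p] using Lp in_Lp_test_function(1)[OF f, of p] has_weak_gradient_weak_grad[OF wg] f p
    by (intro conjI exI[of _ "\<lambda>n. f"] allI) simp_all
qed

text \<open>Convergence in the Sobolev norm is upgraded, for selected test functions, to convergence
  almost everywhere of values and gradients under one majorant of their p-th powers.\<close>

lemma W1p_0_dominated_approximation:
  assumes p: "p > 1" and u: "u \<in> W1p_0 p \<Omega>"
  obtains f H where "\<And>n. test_function \<Omega> (f n)" "integrable M H"
    "AE x in M. (\<lambda>n. f n x) \<longlonglongrightarrow> u x"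
    "AE x in M. (\<lambda>n. grad (f n) x) \<longlonglongrightarrow> \<nabla> u x"
    "AE x in M. \<forall>n. \<bar>f n x\<bar> powr p \<le> H x \<and> norm (grad (f n) x) powr p \<le> H x"
proof -
  let ?G = "\<nabla> u"
  obtain f where f: "\<And>n. test_function \<Omega> (f n)"
    and lim: "(\<lambda>n. (LINT x|M. \<bar>u x - f n x\<bar> powr p + norm (?G x - grad (f n) x) powr p)) \<longlonglongrightarrow> 0"
    and Lp: "in_Lp p \<Omega> u" "in_Lp p \<Omega> ?G"
    using u unfolding W1p_0_iff[OF p] by auto
  have d: "in_Lp p \<Omega> (\<lambda>x. u x - f n x)" "in_Lp p \<Omega> (\<lambda>x. ?G x - grad (f n) x)" for n
    using Lp in_Lp_test_function[OF f] p by (auto intro!: in_Lp_diff)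
  obtain r H where H: "integrable M H"
    and r: "AE x in M. (\<lambda>n. \<bar>u x - f (r n) x\<bar> powr p + norm (?G x - grad (f (r n)) x) powr p) \<longlonglongrightarrow> 0"
      "AE x in M. \<forall>n. \<bar>u x - f (r n) x\<bar> powr p + norm (?G x - grad (f (r n)) x) powr p \<le> H x"
  proof (rule dominated_subsequence[OF _ _ lim])
    show "integrable M (\<lambda>x. \<bar>u x - f n x\<bar> powr p + norm (?G x - grad (f n) x) powr p)" for n
      using d[of n] by (simp add: in_Lp_def)
  qed simp_all
  \<comment> \<open>\<open>H\<close> only controls the differences; writing f = u + (f - u) and the
    same for gradients, the p-th power of a sum costs the factor \<open>2 powr p\<close>.\<close>
  define H' where "H' x = 2 powr p * (\<bar>u x\<bar> powr p + norm (?G x) powr p + H x)" for x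
  show thesis
  proof (rule that[of "\<lambda>n. f (r n)" H'])
    show "integrable M H'"
      using H Lp by (simp add: H'_def[abs_def] in_Lp_def)
    show "AE x in M. (\<lambda>n. f (r n) x) \<longlonglongrightarrow> u x"
      using r(1)
    proof eventually_elim
      fix x assume *: "(\<lambda>n. \<bar>u x - f (r n) x\<bar> powr p + norm (?G x - grad (f (r n)) x) powr p) \<longlonglongrightarrow> 0"
      have "(\<lambda>n. norm (u x - f (r n) x) powr p) \<longlonglongrightarrow> 0"
        by (rule tendsto_sandwich[OF _ _ tendsto_const *]) auto
      then have "(\<lambda>n. u x - f (r n) x) \<longlonglongrightarrow> 0" using p powr_tendsto_zero[of "\<lambda>n. u x - f (r n) x"] by simp
      from tendsto_diff[OF tendsto_const[of "u x"] this] show "(\<lambda>n. f (r n) x) \<longlonglongrightarrow> u x" by simp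
    qed
    show "AE x in M. (\<lambda>n. grad (f (r n)) x) \<longlonglongrightarrow> ?G x"
      using r(1)
    proof eventually_elim
      fix x assume *: "(\<lambda>n. \<bar>u x - f (r n) x\<bar> powr p + norm (?G x - grad (f (r n)) x) powr p) \<longlonglongrightarrow> 0"
      have "(\<lambda>n. norm (?G x - grad (f (r n)) x) powr p) \<longlonglongrightarrow> 0"
        by (rule tendsto_sandwich[OF _ _ tendsto_const *]) auto
      then have "(\<lambda>n. ?G x - grad (f (r n)) x) \<longlonglongrightarrow> 0" using p powr_tendsto_zero[of "\<lambda>n. ?G x - grad (f (r n)) x"] by simp
      from tendsto_diff[OF tendsto_const[of "?G x"] this] show "(\<lambda>n. grad (f (r n)) x) \<longlonglongrightarrow> ?G x" by simp
    qed
    show "AE x in M. \<forall>n. \<bar>f (r n) x\<bar> powr p \<le> H' x \<and> norm (grad (f (r n)) x) powr p \<le> H' x"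
      using r(2)
    proof (eventually_elim, intro allI conjI)
      fix x n assume "\<forall>n. \<bar>u x - f (r n) x\<bar> powr p + norm (?G x - grad (f (r n)) x) powr p \<le> H x"
      then have *: "\<bar>u x - f (r n) x\<bar> powr p + norm (?G x - grad (f (r n)) x) powr p \<le> H x" by blast
      have nn: "\<bar>u x - f (r n) x\<bar> powr p \<ge> 0" "norm (?G x - grad (f (r n)) x) powr p \<ge> 0"
        "\<bar>u x\<bar> powr p \<ge> 0" "norm (?G x) powr p \<ge> 0" by simp_all
      have "norm (u x + (f (r n) x - u x)) powr p \<le> 2 powr p * (norm (u x) powr p + norm (f (r n) x - u x) powr p)"
        using p by (intro powr_norm_add_le) simp
      also have "norm (u x) powr p + norm (f (r n) x - u x) powr p \<le> \<bar>u x\<bar> powr p + norm (?G x) powr p + H x"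
        using * nn unfolding real_norm_def abs_minus_commute[of "f (r n) x"] by linarith
      finally have "norm (u x + (f (r n) x - u x)) powr p \<le> H' x"
        by (simp add: H'_def)
      then show "\<bar>f (r n) x\<bar> powr p \<le> H' x" by simp
      have "norm (?G x + (grad (f (r n)) x - ?G x)) powr p \<le>
          2 powr p * (norm (?G x) powr p + norm (grad (f (r n)) x - ?G x) powr p)"
        using p by (intro powr_norm_add_le) simp
      also have "norm (?G x) powr p + norm (grad (f (r n)) x - ?G x) powr p \<le> \<bar>u x\<bar> powr p + norm (?G x) powr p + H x"
        using * nn unfolding norm_minus_commute[of "grad (f (r n)) x"] by linarith
      finally have "norm (?G x + (grad (f (r n)) x - ?G x)) powr p \<le> H' x"
        by (simp add: H'_def)
      then show "norm (grad (f (r n)) x) powr p \<le> H' x" by simp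
    qed
  qed (rule f)
qed

text \<open>Test functions and their gradients are bounded, so both sides of the defining identity
  pass to the limit by dominated convergence.\<close>

lemma has_weak_gradient_limit:
  assumes w: "\<And>n. has_weak_gradient \<Omega> (w n) (F n)"
    and meas: "\<And>n. w n \<in> borel_measurable M" "\<And>n. F n \<in> borel_measurable M"
      "u \<in> borel_measurable M" "G \<in> borel_measurable M"
    and lim: "AE x in M. (\<lambda>n. w n x) \<longlonglongrightarrow> u x" "AE x in M. (\<lambda>n. F n x) \<longlonglongrightarrow> G x"
    and H: "integrable M H"
    and bound: "\<And>n. AE x in M. \<bar>w n x\<bar> \<le> H x" "\<And>n. AE x in M. norm (F n x) \<le> H x"
  shows "has_weak_gradient \<Omega> u G"
proof (rule has_weak_gradientI)
  show "integrable M u"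
    by (rule integrable_dominated_convergence[OF meas(3) meas(1) H lim(1)]) (use bound in auto)
  show "integrable M G"
    by (rule integrable_dominated_convergence[OF meas(4) meas(2) H lim(2)]) (use bound in auto)
  fix f assume f: "test_function \<Omega> f"
  obtain B where B: "\<And>x. \<bar>f x\<bar> \<le> B" "\<And>x. norm (grad f x) \<le> B" using test_function_bounded[OF f] by metis
  note fm = test_function_measurable[OF f]
  have BH: "integrable M (\<lambda>x. B * H x)" using H by simp
  have B0: "B \<ge> 0" using B(1)[of undefined] by linarith
  have lim1: "(\<lambda>n. LINT x|M. w n x *\<^sub>R grad f x) \<longlonglongrightarrow> (LINT x|M. u x *\<^sub>R grad f x)"
  proof (rule integral_dominated_convergence[OF _ _ BH])
    show "AE x in M. (\<lambda>n. w n x *\<^sub>R grad f x) \<longlonglongrightarrow> u x *\<^sub>R grad f x"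
      using lim(1) by eventually_elim (intro tendsto_intros)
    show "AE x in M. norm (w n x *\<^sub>R grad f x) \<le> B * H x" for n
      using bound(1)[of n]
    proof eventually_elim
      fix x assume "\<bar>w n x\<bar> \<le> H x"
      then have "\<bar>w n x\<bar> * norm (grad f x) \<le> H x * B" using B(2)[of x] by (intro mult_mono) auto
      then show "norm (w n x *\<^sub>R grad f x) \<le> B * H x" by (simp add: mult.commute)
    qed
  qed (use meas fm in measurable)
  have lim2: "(\<lambda>n. LINT x|M. f x *\<^sub>R F n x) \<longlonglongrightarrow> (LINT x|M. f x *\<^sub>R G x)"
  proof (rule integral_dominated_convergence[OF _ _ BH])
    show "AE x in M. (\<lambda>n. f x *\<^sub>R F n x) \<longlonglongrightarrow> f x *\<^sub>R G x"
      using lim(2) by eventually_elim (intro tendsto_intros)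
    show "AE x in M. norm (f x *\<^sub>R F n x) \<le> B * H x" for n
      using bound(2)[of n]
    proof eventually_elim
      fix x assume "norm (F n x) \<le> H x"
      then show "norm (f x *\<^sub>R F n x) \<le> B * H x" using B(1)[of x] B0 by (auto intro!: mult_mono)
    qed
  qed (use meas fm in measurable)
  have "(LINT x|M. w n x *\<^sub>R grad f x) = - (LINT x|M. f x *\<^sub>R F n x)" for n
    using w f by (simp add: has_weak_gradient_def)
  then have "(\<lambda>n. LINT x|M. w n x *\<^sub>R grad f x) \<longlonglongrightarrow> - (LINT x|M. f x *\<^sub>R G x)"
    using tendsto_minus[OF lim2] by (simp only:)
  then show "(LINT x|M. u x *\<^sub>R grad f x) = - (LINT x|M. f x *\<^sub>R G x)"
    by (rule LIMSEQ_unique[OF lim1])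
qed

lemma Lp_dominated_convergence:
  fixes w :: "nat \<Rightarrow> 'a \<Rightarrow> 'b::euclidean_space"
  assumes p: "p > 0"
    and meas: "\<And>n. w n \<in> borel_measurable M" "u \<in> borel_measurable M"
    and lim: "AE x in M. (\<lambda>n. w n x) \<longlonglongrightarrow> u x"
    and H: "integrable M H"
    and bound: "\<And>n. AE x in M. norm (w n x) powr p \<le> H x"
  shows "in_Lp p \<Omega> u" "(\<lambda>n. LINT x|M. norm (u x - w n x) powr p) \<longlonglongrightarrow> 0"
proof -
  have all: "AE x in M. \<forall>n. norm (w n x) powr p \<le> H x"
    using bound by (simp add: AE_all_countable)
  have u: "AE x in M. norm (u x) powr p \<le> H x"
    using all lim
  proof eventually_elim
    fix x assume *: "\<forall>n. norm (w n x) powr p \<le> H x" "(\<lambda>n. w n x) \<longlonglongrightarrow> u x"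
    have "(\<lambda>n. norm (w n x) powr p) \<longlonglongrightarrow> norm (u x) powr p"
      using * p by (intro tendsto_powr2 tendsto_norm tendsto_const) auto
    then show "norm (u x) powr p \<le> H x" using * by (intro LIMSEQ_le_const2) auto
  qed
  then show "in_Lp p \<Omega> u" by (rule in_Lp_dominated[OF meas(2) H])
  have "(\<lambda>n. LINT x|M. norm (u x - w n x) powr p) \<longlonglongrightarrow> (LINT x|M. 0)"
  proof (rule integral_dominated_convergence)
    show "integrable M (\<lambda>x. 2 powr p * (H x + H x))" using H by simp
    show "AE x in M. (\<lambda>n. norm (u x - w n x) powr p) \<longlonglongrightarrow> 0"
      using lim
    proof eventually_elim
      fix x assume "(\<lambda>n. w n x) \<longlonglongrightarrow> u x"
      from tendsto_norm[OF tendsto_diff[OF tendsto_const[of "u x"] this]]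
      have "(\<lambda>n. norm (u x - w n x)) \<longlonglongrightarrow> 0" by simp
      then show "(\<lambda>n. norm (u x - w n x) powr p) \<longlonglongrightarrow> 0"
        using p by (subst tendsto_powr_zero_iff) auto
    qed
    show "AE x in M. norm (norm (u x - w n x) powr p) \<le> 2 powr p * (H x + H x)" for n
      using u all
    proof eventually_elim
      fix x assume *: "norm (u x) powr p \<le> H x" "\<forall>n. norm (w n x) powr p \<le> H x"
      have "norm (u x - w n x) powr p \<le> 2 powr p * (norm (u x) powr p + norm (w n x) powr p)"
        using powr_norm_add_le[of p "u x" "- w n x"] p by simp
      also have "\<dots> \<le> 2 powr p * (H x + H x)" using * by (intro mult_left_mono add_mono) auto
      finally show "norm (norm (u x - w n x) powr p) \<le> 2 powr p * (H x + H x)" by simp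
    qed
  qed (use meas in measurable)
  then show "(\<lambda>n. LINT x|M. norm (u x - w n x) powr p) \<longlonglongrightarrow> 0" by simp
qed

text \<open>The companion of the dominated approximation: \<open>W1p_0\<close> is closed under
  dominated limits, because a test function close to each w n may be substituted for it. The
  nonlinear functions of u and v below enter \<open>W1p_0\<close> through this lemma.\<close>

lemma W1p_0_dominated_limit:
  assumes p: "p > 1" and w: "\<And>n. w n \<in> W1p_0 p \<Omega>"
    and meas: "u \<in> borel_measurable M" "G \<in> borel_measurable M"
    and lim: "AE x in M. (\<lambda>n. w n x) \<longlonglongrightarrow> u x"
      "AE x in M. (\<lambda>n. \<nabla> (w n) x) \<longlonglongrightarrow> G x"
    and H: "integrable M H"
    and bound: "\<And>n. AE x in M. \<bar>w n x\<bar> powr p \<le> H x"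
      "\<And>n. AE x in M. norm (\<nabla> (w n) x) powr p \<le> H x"
  shows "u \<in> W1p_0 p \<Omega>" "AE x in M. \<nabla> u x = G x"
proof -
  have p1: "p \<ge> 1" and p0: "p > 0" using p by auto
  note wD = W1pD[OF w]
  have wm: "w n \<in> borel_measurable M" "\<nabla> (w n) \<in> borel_measurable M" for n
    using wD[of n] by (auto simp: in_Lp_def)
  have wg: "has_weak_gradient \<Omega> u G"
  proof (rule has_weak_gradient_limit[OF wD(3) wm meas lim])
    show "integrable M (\<lambda>x. 1 + H x)" using H by simp
    show "AE x in M. \<bar>w n x\<bar> \<le> 1 + H x" for n
      using bound(1)[of n]
    proof eventually_elim
      fix x assume "\<bar>w n x\<bar> powr p \<le> H x"
      then show "\<bar>w n x\<bar> \<le> 1 + H x" using le_one_plus_powr[OF abs_ge_zero p1, of "w n x"] by linarith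
    qed
    show "AE x in M. norm (\<nabla> (w n) x) \<le> 1 + H x" for n
      using bound(2)[of n]
    proof eventually_elim
      fix x assume "norm (\<nabla> (w n) x) powr p \<le> H x"
      then show "norm (\<nabla> (w n) x) \<le> 1 + H x"
        using le_one_plus_powr[OF norm_ge_zero p1, of "\<nabla> (w n) x"] by linarith
    qed
  qed
  show eq: "AE x in M. \<nabla> u x = G x" by (rule weak_grad_AE_eq[OF wg])
  have b1: "AE x in M. norm (w n x) powr p \<le> H x" for n using bound(1) by simp
  note c1 = Lp_dominated_convergence[OF p0 wm(1) meas(1) lim(1) H b1]
  note c2 = Lp_dominated_convergence[OF p0 wm(2) meas(2) lim(2) H bound(2)]
  have Gu: "in_Lp p \<Omega> (\<nabla> u)"
    by (rule in_Lp_AE_eq[OF c2(1) AE_symmetric[OF eq]])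
  have "\<forall>n. \<exists>f. test_function \<Omega> f \<and>
      (LINT x|M. \<bar>w n x - f x\<bar> powr p + norm (\<nabla> (w n) x - grad f x) powr p) < 1 / Suc n"
  proof
    fix n
    obtain f where f: "\<And>k. test_function \<Omega> (f k)"
      "(\<lambda>k. LINT x|M. \<bar>w n x - f k x\<bar> powr p + norm (\<nabla> (w n) x - grad (f k) x) powr p) \<longlonglongrightarrow> 0"
      using w[of n] unfolding W1p_0_iff[OF p] by auto
    from order_tendstoD(2)[OF f(2), of "1 / Suc n"]
    show "\<exists>f. test_function \<Omega> f \<and>
      (LINT x|M. \<bar>w n x - f x\<bar> powr p + norm (\<nabla> (w n) x - grad f x) powr p) < 1 / Suc n"
      using f(1) by (auto simp: eventually_sequentially)
  qed
  from choice[OF this] obtain f where f: "\<And>n. test_function \<Omega> (f n)"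
    "\<And>n. (LINT x|M. \<bar>w n x - f n x\<bar> powr p + norm (\<nabla> (w n) x - grad (f n) x) powr p) < 1 / Suc n"
    by blast
  let ?A = "\<lambda>n. LINT x|M. norm (u x - w n x) powr p"
  let ?B = "\<lambda>n. LINT x|M. norm (G x - \<nabla> (w n) x) powr p"
  let ?C = "\<lambda>n. LINT x|M. \<bar>w n x - f n x\<bar> powr p + norm (\<nabla> (w n) x - grad (f n) x) powr p"
  let ?D = "\<lambda>n. LINT x|M. \<bar>u x - f n x\<bar> powr p + norm (\<nabla> u x - grad (f n) x) powr p"
  \<comment> \<open>The distance from u to f n is split at w n: the first part tends to 0 by
    domination, the second is below 1 / Suc n by the choice of f n.\<close>
  have le: "?D n \<le> 2 powr p * (?A n + ?B n + ?C n)" for n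
  proof -
    have i: "in_Lp p \<Omega> (\<lambda>x. u x - w n x)" "in_Lp p \<Omega> (\<lambda>x. G x - \<nabla> (w n) x)"
      "in_Lp p \<Omega> (\<lambda>x. w n x - f n x)" "in_Lp p \<Omega> (\<lambda>x. \<nabla> (w n) x - grad (f n) x)"
      "in_Lp p \<Omega> (\<lambda>x. u x - f n x)" "in_Lp p \<Omega> (\<lambda>x. \<nabla> u x - grad (f n) x)"
      using c1(1) c2(1) Gu wD[of n] in_Lp_test_function[OF f(1), of p] p0 by (auto intro!: in_Lp_diff)
    then have "?D n \<le> (LINT x|M. 2 powr p * ((norm (u x - w n x) powr p + norm (G x - \<nabla> (w n) x) powr p) +
       (\<bar>w n x - f n x\<bar> powr p + norm (\<nabla> (w n) x - grad (f n) x) powr p)))"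
    proof (intro integral_mono_AE)
      show "AE x in M. \<bar>u x - f n x\<bar> powr p + norm (\<nabla> u x - grad (f n) x) powr p \<le>
        2 powr p * ((norm (u x - w n x) powr p + norm (G x - \<nabla> (w n) x) powr p) +
       (\<bar>w n x - f n x\<bar> powr p + norm (\<nabla> (w n) x - grad (f n) x) powr p))"
        using eq
      proof eventually_elim
        fix x assume eq: "\<nabla> u x = G x"
        show "\<bar>u x - f n x\<bar> powr p + norm (\<nabla> u x - grad (f n) x) powr p \<le>
          2 powr p * ((norm (u x - w n x) powr p + norm (G x - \<nabla> (w n) x) powr p) +
         (\<bar>w n x - f n x\<bar> powr p + norm (\<nabla> (w n) x - grad (f n) x) powr p))"
          using powr_norm_add_le[of p "u x - w n x" "w n x - f n x"] p0
            powr_norm_add_le[of p "G x - \<nabla> (w n) x" "\<nabla> (w n) x - grad (f n) x"]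
          unfolding eq by (simp add: algebra_simps)
      qed
    qed (auto simp: in_Lp_def)
    also have "\<dots> = 2 powr p * (?A n + ?B n + ?C n)"
      using i by (simp add: in_Lp_def)
    finally show ?thesis .
  qed
  have "?C \<longlonglongrightarrow> 0"
  proof (rule tendsto_sandwich[OF _ _ tendsto_const])
    show "\<forall>\<^sub>F n in sequentially. ?C n \<le> 1 / Suc n" using f(2) by (intro always_eventually allI less_imp_le)
    show "(\<lambda>n. 1 / real (Suc n)) \<longlonglongrightarrow> 0" by (rule LIMSEQ_Suc[OF lim_1_over_n])
  qed (auto intro!: Bochner_Integration.integral_nonneg)
  then have "(\<lambda>n. 2 powr p * (?A n + ?B n + ?C n)) \<longlonglongrightarrow> 2 powr p * (0 + 0 + 0)"
    using c1(2) c2(2) by (intro tendsto_intros)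
  then have "(\<lambda>n. 2 powr p * (?A n + ?B n + ?C n)) \<longlonglongrightarrow> 0" by simp
  have "?D \<longlonglongrightarrow> 0"
  proof (rule tendsto_sandwich[OF always_eventually always_eventually tendsto_const])
    show "(\<lambda>n. 2 powr p * (?A n + ?B n + ?C n)) \<longlonglongrightarrow> 0" by fact
    show "\<forall>n. ?D n \<le> 2 powr p * (?A n + ?B n + ?C n)" using le by blast
  qed (auto intro!: Bochner_Integration.integral_nonneg)
  then show "u \<in> W1p_0 p \<Omega>"
    unfolding W1p_0_iff[OF p] using c1(1) Gu has_weak_gradient_weak_grad[OF wg] f(1) by blast
qed

end

section \<open>The chain rule\<close>

text \<open>Outer functions for the chain rule; A and B are the partial derivatives of F. F 0 0 = 0
  keeps the support of F (f x) (g x) compact, and the bound L keeps compositions in L^p.\<close>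

locale smooth_Lipschitz_pair =
  fixes F A B :: "real \<Rightarrow> real \<Rightarrow> real" and L :: real
  assumes has_derivative_F: "\<And>s t. ((\<lambda>z. F (fst z) (snd z)) has_derivative (\<lambda>h. A s t * fst h + B s t * snd h)) (at (s, t))"
    and continuous_A: "continuous_on UNIV (\<lambda>z. A (fst z) (snd z))"
    and continuous_B: "continuous_on UNIV (\<lambda>z. B (fst z) (snd z))"
    and bound_A: "\<And>s t. \<bar>A s t\<bar> \<le> L" and bound_B: "\<And>s t. \<bar>B s t\<bar> \<le> L"
    and F_0: "F 0 0 = 0"
begin

lemma L_nonneg: "L \<ge> 0"
  using bound_A[of 0 0] by linarith

lemma F_bound: "\<bar>F s t\<bar> \<le> 2 * L * (\<bar>s\<bar> + \<bar>t\<bar>)"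
proof -
  let ?F = "\<lambda>z. F (fst z) (snd z)"
  have "norm (?F (s, t) - ?F 0) \<le> 2 * L * norm ((s, t) - 0)"
  proof (rule differentiable_bound[of UNIV])
    show "(?F has_derivative (\<lambda>h. A (fst z) (snd z) * fst h + B (fst z) (snd z) * snd h)) (at z within UNIV)" for z
      using has_derivative_F[of "fst z" "snd z"] by simp
    show "onorm (\<lambda>h. A (fst z) (snd z) * fst h + B (fst z) (snd z) * snd h) \<le> 2 * L" for z :: "real \<times> real"
    proof (rule onorm_le)
      fix h :: "real \<times> real"
      have "\<bar>A (fst z) (snd z)\<bar> * \<bar>fst h\<bar> \<le> L * norm h" "\<bar>B (fst z) (snd z)\<bar> * \<bar>snd h\<bar> \<le> L * norm h"
        using norm_fst_le[of "fst h" "snd h"] norm_snd_le[of "snd h" "fst h"] L_nonneg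
        by (auto intro!: mult_mono bound_A bound_B)
      moreover have "\<bar>A (fst z) (snd z) * fst h + B (fst z) (snd z) * snd h\<bar>
          \<le> \<bar>A (fst z) (snd z)\<bar> * \<bar>fst h\<bar> + \<bar>B (fst z) (snd z)\<bar> * \<bar>snd h\<bar>"
        by (simp add: abs_mult[symmetric] abs_triangle_ineq)
      ultimately show "norm (A (fst z) (snd z) * fst h + B (fst z) (snd z) * snd h) \<le> 2 * L * norm h" by simp
    qed
  qed auto
  also have "\<dots> \<le> 2 * L * (\<bar>s\<bar> + \<bar>t\<bar>)"
    using norm_Pair_le[of s t] L_nonneg by (intro mult_left_mono) auto
  finally show ?thesis by (simp add: F_0)
qed

text \<open>The bounds depend on F through L alone, so a family of outer functions with one common L
  has one common majorant.\<close>

lemma powr_bounds: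
  fixes X Y :: "'b::euclidean_space"
  assumes p: "p \<ge> 0" and H: "\<bar>s\<bar> powr p \<le> H" "\<bar>t\<bar> powr p \<le> H" "norm X powr p \<le> H" "norm Y powr p \<le> H"
  shows "\<bar>F s t\<bar> powr p \<le> (2 * L) powr p * (2 powr p * (H + H))"
    and "norm (A s t *\<^sub>R X + B s t *\<^sub>R Y) powr p \<le> (2 * L) powr p * (2 powr p * (H + H))"
proof -
  have "\<bar>F s t\<bar> powr p \<le> (2 * L * (\<bar>s\<bar> + \<bar>t\<bar>)) powr p"
    using F_bound[of s t] p by (intro powr_mono2) auto
  also have "\<dots> = (2 * L) powr p * norm (\<bar>s\<bar> + \<bar>t\<bar>) powr p"
    using L_nonneg by (simp add: powr_mult)
  also have "\<dots> \<le> (2 * L) powr p * (2 powr p * (norm \<bar>s\<bar> powr p + norm \<bar>t\<bar> powr p))"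
    by (intro mult_left_mono powr_norm_add_le[OF p]) simp
  also have "\<dots> \<le> (2 * L) powr p * (2 powr p * (H + H))"
    using H by (intro mult_left_mono) auto
  finally show "\<bar>F s t\<bar> powr p \<le> (2 * L) powr p * (2 powr p * (H + H))" .
  have "norm (A s t *\<^sub>R X + B s t *\<^sub>R Y) \<le> norm (A s t *\<^sub>R X) + norm (B s t *\<^sub>R Y)"
    by (rule norm_triangle_ineq)
  also have "\<dots> \<le> 2 * L * norm X + 2 * L * norm Y"
    using bound_A[of s t] bound_B[of s t] by (auto intro!: add_mono mult_right_mono)
  finally have "norm (A s t *\<^sub>R X + B s t *\<^sub>R Y) \<le> 2 * L * (norm X + norm Y)"
    by (simp add: distrib_left)
  then have "norm (A s t *\<^sub>R X + B s t *\<^sub>R Y) powr p \<le> (2 * L * (norm X + norm Y)) powr p"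
    using p by (intro powr_mono2) auto
  also have "\<dots> = (2 * L) powr p * norm (norm X + norm Y) powr p"
    using L_nonneg by (simp add: powr_mult)
  also have "\<dots> \<le> (2 * L) powr p * (2 powr p * (norm (norm X) powr p + norm (norm Y) powr p))"
    by (intro mult_left_mono powr_norm_add_le[OF p]) simp
  also have "\<dots> \<le> (2 * L) powr p * (2 powr p * (H + H))"
    using H by (intro mult_left_mono) auto
  finally show "norm (A s t *\<^sub>R X + B s t *\<^sub>R Y) powr p \<le> (2 * L) powr p * (2 powr p * (H + H))" .
qed

lemma measurable_compose_pair:
  assumes [measurable]: "u \<in> borel_measurable M" "v \<in> borel_measurable M"
  shows "(\<lambda>x. F (u x) (v x)) \<in> borel_measurable M" "(\<lambda>x. A (u x) (v x)) \<in> borel_measurable M"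
    "(\<lambda>x. B (u x) (v x)) \<in> borel_measurable M"
proof -
  have "continuous_on UNIV (\<lambda>z. F (fst z) (snd z))"
    using has_derivative_F by (intro continuous_at_imp_continuous_on) (metis has_derivative_continuous prod.collapse)
  note c = this continuous_A continuous_B
  have uv: "(\<lambda>x. (u x, v x)) \<in> borel_measurable M" by (rule borel_measurable_Pair) measurable
  show "(\<lambda>x. F (u x) (v x)) \<in> borel_measurable M"
    using measurable_compose[OF uv borel_measurable_continuous_onI[OF c(1)]] by simp
  show "(\<lambda>x. A (u x) (v x)) \<in> borel_measurable M"
    using measurable_compose[OF uv borel_measurable_continuous_onI[OF c(2)]] by simp
  show "(\<lambda>x. B (u x) (v x)) \<in> borel_measurable M"
    using measurable_compose[OF uv borel_measurable_continuous_onI[OF c(3)]] by simp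
qed

lemma tendsto_compose_pair:
  assumes "f \<longlonglongrightarrow> s" "g \<longlonglongrightarrow> t"
  shows "(\<lambda>n. F (f n) (g n)) \<longlonglongrightarrow> F s t" "(\<lambda>n. A (f n) (g n)) \<longlonglongrightarrow> A s t" "(\<lambda>n. B (f n) (g n)) \<longlonglongrightarrow> B s t"
proof -
  have fg: "(\<lambda>n. (f n, g n)) \<longlonglongrightarrow> (s, t)" using assms by (rule tendsto_Pair)
  show "(\<lambda>n. F (f n) (g n)) \<longlonglongrightarrow> F s t"
    using isCont_tendsto_compose[OF has_derivative_continuous[OF has_derivative_F] fg] by simp
  show "(\<lambda>n. A (f n) (g n)) \<longlonglongrightarrow> A s t"
    using continuous_on_tendsto_compose[OF continuous_A fg] by simp
  show "(\<lambda>n. B (f n) (g n)) \<longlonglongrightarrow> B s t"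
    using continuous_on_tendsto_compose[OF continuous_B fg] by simp
qed

lemma grad_compose_pair:
  assumes f: "test_function \<Omega> f" and g: "test_function \<Omega> g"
  shows "grad (\<lambda>x. F (f x) (g x)) x = A (f x) (g x) *\<^sub>R grad f x + B (f x) (g x) *\<^sub>R grad g x"
proof (rule grad_eqI)
  have "((\<lambda>x. (f x, g x)) has_derivative (\<lambda>h. (grad f x \<bullet> h, grad g x \<bullet> h))) (at x)"
    by (intro has_derivative_Pair test_function_has_derivative[OF f] test_function_has_derivative[OF g])
  from has_derivative_compose[OF this has_derivative_F]
  show "((\<lambda>x. F (f x) (g x)) has_derivative
      (\<lambda>h. (A (f x) (g x) *\<^sub>R grad f x + B (f x) (g x) *\<^sub>R grad g x) \<bullet> h)) (at x)"
    by (simp add: inner_add_left)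
qed

end

text \<open>For test functions this is the classical chain rule; it passes to the limit along
  dominated approximations of u and v. Smoothness of all orders is a separate hypothesis because
  compositions of test functions have to be test functions again.\<close>

lemma (in bounded_domain) W1p_0_compose_pair:
  assumes F: "smooth_Lipschitz_pair F A B L" and p: "p > 1"
    and smooth: "\<And>f g :: 'a \<Rightarrow> real. (\<And>k. C_k k f) \<Longrightarrow> (\<And>k. C_k k g) \<Longrightarrow> (\<And>k. C_k k (\<lambda>x. F (f x) (g x)))"
    and u: "u \<in> W1p_0 p \<Omega>" and v: "v \<in> W1p_0 p \<Omega>"
  shows "(\<lambda>x. F (u x) (v x)) \<in> W1p_0 p \<Omega>"
    and "AE x in M. \<nabla> (\<lambda>x. F (u x) (v x)) x =
      A (u x) (v x) *\<^sub>R \<nabla> u x + B (u x) (v x) *\<^sub>R \<nabla> v x"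
proof -
  interpret smooth_Lipschitz_pair F A B L by fact
  have p0: "p \<ge> 0" using p by simp
  obtain f H1 where f: "\<And>n. test_function \<Omega> (f n)" "integrable M H1"
    "AE x in M. (\<lambda>n. f n x) \<longlonglongrightarrow> u x"
    "AE x in M. (\<lambda>n. grad (f n) x) \<longlonglongrightarrow> \<nabla> u x"
    "AE x in M. \<forall>n. \<bar>f n x\<bar> powr p \<le> H1 x \<and> norm (grad (f n) x) powr p \<le> H1 x"
    by (rule W1p_0_dominated_approximation[OF p u]) (rule that; assumption)
  obtain g H2 where g: "\<And>n. test_function \<Omega> (g n)" "integrable M H2"
    "AE x in M. (\<lambda>n. g n x) \<longlonglongrightarrow> v x"
    "AE x in M. (\<lambda>n. grad (g n) x) \<longlonglongrightarrow> \<nabla> v x"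
    "AE x in M. \<forall>n. \<bar>g n x\<bar> powr p \<le> H2 x \<and> norm (grad (g n) x) powr p \<le> H2 x"
    by (rule W1p_0_dominated_approximation[OF p v]) (rule that; assumption)
  let ?w = "\<lambda>n x. F (f n x) (g n x)"
  let ?G = "\<lambda>x. A (u x) (v x) *\<^sub>R \<nabla> u x + B (u x) (v x) *\<^sub>R \<nabla> v x"
  have w: "test_function \<Omega> (?w n)" for n
    by (rule test_function_from_supports[OF f(1)[of n] g(1)[of n] smooth])
      (auto simp: F_0 test_function_C_k[OF f(1)] test_function_C_k[OF g(1)])
  note wW = test_function_in_W1p_0[OF p w]
  have um: "u \<in> borel_measurable M" "v \<in> borel_measurable M"
    "\<nabla> u \<in> borel_measurable M" "\<nabla> v \<in> borel_measurable M"
    using W1pD[OF u] W1pD[OF v] by (auto simp: in_Lp_def)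
  have wG: "AE x in M. \<forall>n. \<nabla> (?w n) x = grad (?w n) x"
    using wW(2) by (simp add: AE_all_countable)
  define H where "H x = (2 * L) powr p * (2 powr p * (max (H1 x) (H2 x) + max (H1 x) (H2 x)))" for x
  have bound: "AE x in M. \<forall>n. \<bar>?w n x\<bar> powr p \<le> H x \<and> norm (\<nabla> (?w n) x) powr p \<le> H x"
    using f(5) g(5) wG
  proof (eventually_elim, intro allI)
    fix x n
    assume *: "\<forall>n. \<bar>f n x\<bar> powr p \<le> H1 x \<and> norm (grad (f n) x) powr p \<le> H1 x"
      "\<forall>n. \<bar>g n x\<bar> powr p \<le> H2 x \<and> norm (grad (g n) x) powr p \<le> H2 x"
      "\<forall>n. \<nabla> (?w n) x = grad (?w n) x"
    have "\<bar>f n x\<bar> powr p \<le> max (H1 x) (H2 x)" "\<bar>g n x\<bar> powr p \<le> max (H1 x) (H2 x)"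
      "norm (grad (f n) x) powr p \<le> max (H1 x) (H2 x)" "norm (grad (g n) x) powr p \<le> max (H1 x) (H2 x)"
      using *(1,2) by (auto simp: le_max_iff_disj)
    from powr_bounds[OF p0 this]
    show "\<bar>?w n x\<bar> powr p \<le> H x \<and> norm (\<nabla> (?w n) x) powr p \<le> H x"
      using *(3) by (simp add: grad_compose_pair[OF f(1) g(1)] H_def)
  qed
  have meas: "(\<lambda>x. F (u x) (v x)) \<in> borel_measurable M" "?G \<in> borel_measurable M"
    using measurable_compose_pair[OF um(1,2)] um by auto
  have lim: "AE x in M. (\<lambda>n. ?w n x) \<longlonglongrightarrow> F (u x) (v x)"
    using f(3) g(3) by eventually_elim (rule tendsto_compose_pair)
  have limG: "AE x in M. (\<lambda>n. \<nabla> (?w n) x) \<longlonglongrightarrow> ?G x"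
    using f(3) g(3) f(4) g(4) wG
    by eventually_elim (simp add: grad_compose_pair[OF f(1) g(1)] tendsto_compose_pair tendsto_intros)
  have Hint: "integrable M H"
    unfolding H_def[abs_def] using f(2) g(2) by simp
  have b: "AE x in M. \<bar>?w n x\<bar> powr p \<le> H x"
    "AE x in M. norm (\<nabla> (?w n) x) powr p \<le> H x" for n
    using bound by (auto elim: eventually_mono)
  show "(\<lambda>x. F (u x) (v x)) \<in> W1p_0 p \<Omega>"
    by (rule W1p_0_dominated_limit(1)[OF p wW(1) meas lim limG Hint b])
  show "AE x in M. \<nabla> (\<lambda>x. F (u x) (v x)) x = ?G x"
    by (rule W1p_0_dominated_limit(2)[OF p wW(1) meas lim limG Hint b])
qed

lemma (in bounded_domain) W1p_0_cmult:
  assumes p: "p > 1" and u: "u \<in> W1p_0 p \<Omega>"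
  shows "(\<lambda>x. c * u x) \<in> W1p_0 p \<Omega>"
    and "AE x in M. \<nabla> (\<lambda>x. c * u x) x = c *\<^sub>R \<nabla> u x"
proof -
  have "smooth_Lipschitz_pair (\<lambda>s t. c * s) (\<lambda>s t. c) (\<lambda>s t. 0) \<bar>c\<bar>"
    by unfold_locales (auto intro!: derivative_eq_intros continuous_intros)
  from W1p_0_compose_pair[OF this p _ u u]
  show "(\<lambda>x. c * u x) \<in> W1p_0 p \<Omega>"
    "AE x in M. \<nabla> (\<lambda>x. c * u x) x = c *\<^sub>R \<nabla> u x"
    by (simp_all add: C_k_mult C_k_const)
qed

section \<open>The pointwise \<open>p\<close>-sum of two Sobolev functions\<close>

definition psum :: "real \<Rightarrow> real \<Rightarrow> real \<Rightarrow> real" where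
  "psum p s t = (\<bar>s\<bar> powr p + \<bar>t\<bar> powr p) powr (1 / p)"

text \<open>The partial derivative of \<open>psum\<close> in its first argument where s is nonzero;
  the last factor makes it 0 at s = 0, also for p < 2.\<close>

definition psum_coeff :: "real \<Rightarrow> real \<Rightarrow> real \<Rightarrow> real" where
  "psum_coeff p s t = (\<bar>s\<bar> powr p + \<bar>t\<bar> powr p) powr (1 / p - 1) * \<bar>s\<bar> powr (p - 2) * s"

text \<open>|s| is replaced by the square root of s^2 + d, which removes the singularities. The
  subtracted constant is the value at the origin, so that compositions with test functions keep
  compact support.\<close>

definition smooth_psum :: "real \<Rightarrow> real \<Rightarrow> real \<Rightarrow> real \<Rightarrow> real" where
  "smooth_psum p d s t =
     ((s\<^sup>2 + d) powr (p / 2) + (t\<^sup>2 + d) powr (p / 2)) powr (1 / p) - (d powr (p / 2) + d powr (p / 2)) powr (1 / p)"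

definition smooth_psum_coeff :: "real \<Rightarrow> real \<Rightarrow> real \<Rightarrow> real \<Rightarrow> real" where
  "smooth_psum_coeff p d s t =
     ((s\<^sup>2 + d) powr (p / 2) + (t\<^sup>2 + d) powr (p / 2)) powr (1 / p - 1) * (s\<^sup>2 + d) powr (p / 2 - 1) * s"

lemma square_plus_pos: "d > 0 \<Longrightarrow> (s::real)\<^sup>2 + d > 0"
  by (simp add: add_nonneg_pos)

text \<open>With a = s^2 + d one has |s| \<le> a^(1/2) and a^(p/2) \<le> N, and then the powers of N
  cancel. That the bound does not depend on d yields the majorant for the limit as d tends to
  0.\<close>

lemma smooth_psum_coeff_bound:
  assumes p: "p > 1" and d: "d > 0"
  shows "\<bar>smooth_psum_coeff p d s t\<bar> \<le> 1"
proof -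
  define a where "a = s\<^sup>2 + d"
  define N where "N = a powr (p / 2) + (t\<^sup>2 + d) powr (p / 2)"
  have a: "a > 0" using d by (simp add: a_def square_plus_pos)
  have N: "N \<ge> a powr (p / 2)" "N > 0" using a by (auto simp: N_def add_pos_nonneg)
  have "\<bar>s\<bar> = (s\<^sup>2) powr (1 / 2)" by (simp add: powr_half_sqrt)
  also have "\<dots> \<le> a powr (1 / 2)" using d by (intro powr_mono2) (auto simp: a_def)
  finally have "\<bar>smooth_psum_coeff p d s t\<bar> \<le> N powr (1 / p - 1) * a powr (p / 2 - 1) * a powr (1 / 2)"
    unfolding smooth_psum_coeff_def a_def[symmetric] N_def[symmetric] abs_mult
    by (intro mult_mono) auto
  also have "\<dots> = N powr (1 / p - 1) * (a powr (p / 2)) powr (1 - 1 / p)"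
  proof -
    have "p / 2 - 1 + 1 / 2 = p / 2 * (1 - 1 / p)" using p by (simp add: right_diff_distrib)
    then show ?thesis by (simp only: powr_powr mult.assoc powr_add[symmetric])
  qed
  also have "\<dots> \<le> N powr (1 / p - 1) * N powr (1 - 1 / p)"
    using N p by (intro mult_left_mono powr_mono2) auto
  also have "\<dots> = 1" using N by (simp add: powr_add[symmetric])
  finally show ?thesis .
qed

lemma smooth_Lipschitz_pair_smooth_psum:
  assumes p: "p > 1" and d: "d > 0"
  shows "smooth_Lipschitz_pair (smooth_psum p d) (smooth_psum_coeff p d) (\<lambda>s t. smooth_psum_coeff p d t s) 1"
proof
  let ?a = "\<lambda>s::real. (s\<^sup>2 + d) powr (p / 2)"
  have a: "(?a has_real_derivative (p / 2) * (s\<^sup>2 + d) powr (p / 2 - 1) * (2 * s)) (at s)" for s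
  proof -
    have "((\<lambda>s. s\<^sup>2 + d) has_real_derivative 2 * s) (at s)"
      by (auto intro!: derivative_eq_intros)
    from DERIV_chain2[OF has_real_derivative_powr[OF square_plus_pos[OF d, of s], of "p / 2"] this]
    show ?thesis .
  qed
  show "((\<lambda>z. smooth_psum p d (fst z) (snd z)) has_derivative
      (\<lambda>h. smooth_psum_coeff p d s t * fst h + smooth_psum_coeff p d t s * snd h)) (at (s, t))" for s t
  proof -
    let ?N = "?a s + ?a t"
    have N: "?N > 0" using square_plus_pos[OF d] by (intro add_pos_pos) (auto simp: less_le)
    have fs: "((\<lambda>z. ?a (fst z)) has_derivative (\<lambda>h. (p / 2) * (s\<^sup>2 + d) powr (p / 2 - 1) * (2 * s) * fst h)) (at (s, t))"
      using has_derivative_compose[OF has_derivative_fst[OF has_derivative_ident], of ?a _ "(s, t)"] a[of s]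
      by (simp add: has_field_derivative_def)
    have ft: "((\<lambda>z. ?a (snd z)) has_derivative (\<lambda>h. (p / 2) * (t\<^sup>2 + d) powr (p / 2 - 1) * (2 * t) * snd h)) (at (s, t))"
      using has_derivative_compose[OF has_derivative_snd[OF has_derivative_ident], of ?a _ "(s, t)"] a[of t]
      by (simp add: has_field_derivative_def)
    have P: "((\<lambda>y. y powr (1 / p)) has_derivative (\<lambda>h. (1 / p * ?N powr (1 / p - 1)) * h)) (at ?N)"
      using has_real_derivative_powr[OF N, of "1 / p"] by (simp only: has_field_derivative_def)
    have "((\<lambda>z. (?a (fst z) + ?a (snd z)) powr (1 / p)) has_derivative
        (\<lambda>h. (1 / p * ?N powr (1 / p - 1)) * ((p / 2) * (s\<^sup>2 + d) powr (p / 2 - 1) * (2 * s) * fst h +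
          (p / 2) * (t\<^sup>2 + d) powr (p / 2 - 1) * (2 * t) * snd h))) (at (s, t))"
      using has_derivative_compose[OF has_derivative_add[OF fs ft], of "\<lambda>y. y powr (1 / p)"] P by simp
    from has_derivative_diff[OF this has_derivative_const]
    show ?thesis
      unfolding smooth_psum_def smooth_psum_coeff_def
      by (rule has_derivative_eq_rhs) (use p in \<open>simp add: fun_eq_iff field_simps add.commute\<close>)
  qed
  have pos: "(s\<^sup>2 + d) powr (p / 2) + (t\<^sup>2 + d) powr (p / 2) \<noteq> 0" "s\<^sup>2 + d \<noteq> 0" for s t :: real
    using square_plus_pos[OF d, of s] square_plus_pos[OF d, of t]
    by (auto simp: add_nonneg_eq_0_iff)
  show "continuous_on UNIV (\<lambda>z. smooth_psum_coeff p d (fst z) (snd z))"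
    "continuous_on UNIV (\<lambda>z. smooth_psum_coeff p d (snd z) (fst z))"
    unfolding smooth_psum_coeff_def using pos by (auto intro!: continuous_intros)
qed (auto simp: smooth_psum_def smooth_psum_coeff_bound[OF p d])

lemma C_k_smooth_psum:
  fixes f g :: "'a::euclidean_space \<Rightarrow> real"
  assumes d: "d > 0" and f: "C_k k f" and g: "C_k k g"
  shows "C_k k (\<lambda>x. smooth_psum p d (f x) (g x))"
  unfolding smooth_psum_def power2_eq_square
proof (intro C_k_diff C_k_powr C_k_add C_k_mult C_k_const f g)
  show pos: "f x * f x + d > 0" "g x * g x + d > 0" for x
    using square_plus_pos[OF d, of "f x"] square_plus_pos[OF d, of "g x"] by (simp_all add: power2_eq_square)
  show "(f x * f x + d) powr (p / 2) + (g x * g x + d) powr (p / 2) > 0" for x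
    using pos[of x] by (intro add_pos_pos) auto
  show "d powr (p / 2) + d powr (p / 2) > 0" using d by simp
qed (rule d)+

lemma tendsto_smooth_psum:
  assumes p: "p > 1" and d: "d \<longlonglongrightarrow> 0" "\<And>n. d n > 0"
  shows "(\<lambda>n. smooth_psum p (d n) s t) \<longlonglongrightarrow> psum p s t"
    and "(\<lambda>n. smooth_psum_coeff p (d n) s t) \<longlonglongrightarrow> psum_coeff p s t"
proof -
  have sq: "(s\<^sup>2) powr (p / 2) = \<bar>s\<bar> powr p" for s :: real
    using powr_powr[of "\<bar>s\<bar>" 2 "p / 2"] by simp
  have a: "(\<lambda>n. (s\<^sup>2 + d n) powr (p / 2)) \<longlonglongrightarrow> \<bar>s\<bar> powr p" for s :: real
  proof -
    have "(\<lambda>n. (s\<^sup>2 + d n) powr (p / 2)) \<longlonglongrightarrow> (s\<^sup>2 + 0) powr (p / 2)"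
      using p d(2) by (intro tendsto_powr2 tendsto_intros d) (auto intro!: always_eventually less_imp_le[OF square_plus_pos])
    then show ?thesis by (simp add: sq)
  qed
  have N: "(\<lambda>n. (s\<^sup>2 + d n) powr (p / 2) + (t\<^sup>2 + d n) powr (p / 2)) \<longlonglongrightarrow> \<bar>s\<bar> powr p + \<bar>t\<bar> powr p"
    by (intro tendsto_add a)
  have "(\<lambda>n. (d n powr (p / 2) + d n powr (p / 2)) powr (1 / p)) \<longlonglongrightarrow> (0 powr (p / 2) + 0 powr (p / 2)) powr (1 / p)"
    using p d(2) by (intro tendsto_powr2 tendsto_intros d) (auto intro!: always_eventually less_imp_le)
  then have z: "(\<lambda>n. (d n powr (p / 2) + d n powr (p / 2)) powr (1 / p)) \<longlonglongrightarrow> 0" by simp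
  have "(\<lambda>n. ((s\<^sup>2 + d n) powr (p / 2) + (t\<^sup>2 + d n) powr (p / 2)) powr (1 / p)) \<longlonglongrightarrow> psum p s t"
    unfolding psum_def using p by (intro tendsto_powr2 tendsto_intros N) auto
  from tendsto_diff[OF this z] show "(\<lambda>n. smooth_psum p (d n) s t) \<longlonglongrightarrow> psum p s t"
    by (simp add: smooth_psum_def)
  \<comment> \<open>At s = 0 both coefficients are identically 0. For s \<noteq> 0 the limit of the
    sum is nonzero, as the negative exponent 1/p - 1 demands.\<close>
  show "(\<lambda>n. smooth_psum_coeff p (d n) s t) \<longlonglongrightarrow> psum_coeff p s t"
  proof (cases "s = 0")
    case False
    have "(\<lambda>n. (s\<^sup>2 + d n) powr (p / 2 - 1)) \<longlonglongrightarrow> (s\<^sup>2 + 0) powr (p / 2 - 1)"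
      using False by (intro tendsto_powr tendsto_intros d) auto
    moreover have "(s\<^sup>2 + 0) powr (p / 2 - 1) = \<bar>s\<bar> powr (p - 2)"
      using powr_powr[of "\<bar>s\<bar>" 2 "p / 2 - 1"] by (simp add: algebra_simps)
    moreover have "\<bar>s\<bar> powr p + \<bar>t\<bar> powr p \<noteq> 0"
      using False by (auto simp: add_nonneg_eq_0_iff)
    ultimately show ?thesis
      unfolding smooth_psum_coeff_def psum_coeff_def
      by (intro tendsto_mult tendsto_const tendsto_powr[OF N]) auto
  qed (simp add: smooth_psum_coeff_def psum_coeff_def)
qed

text \<open>The chain rule applies to each regularisation. The coefficients converge at every point,
  zeros of u and v included, under a majorant independent of d.\<close>

lemma (in bounded_domain) W1p_0_psum:
  assumes p: "p > 1" and u: "u \<in> W1p_0 p \<Omega>" and v: "v \<in> W1p_0 p \<Omega>"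
  shows "(\<lambda>x. psum p (u x) (v x)) \<in> W1p_0 p \<Omega>"
    and "AE x in M. \<nabla> (\<lambda>x. psum p (u x) (v x)) x =
      psum_coeff p (u x) (v x) *\<^sub>R \<nabla> u x + psum_coeff p (v x) (u x) *\<^sub>R \<nabla> v x"
proof -
  define d where "d n = 1 / real (Suc n)" for n
  have d: "d \<longlonglongrightarrow> 0" "\<And>n. d n > 0"
    unfolding d_def by (rule LIMSEQ_Suc[OF lim_1_over_n]) simp
  have p0: "p \<ge> 0" using p by simp
  let ?w = "\<lambda>n x. smooth_psum p (d n) (u x) (v x)"
  let ?G = "\<lambda>x. psum_coeff p (u x) (v x) *\<^sub>R \<nabla> u x + psum_coeff p (v x) (u x) *\<^sub>R \<nabla> v x"
  note pair = smooth_Lipschitz_pair_smooth_psum[OF p d(2)]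
  have w: "?w n \<in> W1p_0 p \<Omega>"
    "AE x in M. \<nabla> (?w n) x =
      smooth_psum_coeff p (d n) (u x) (v x) *\<^sub>R \<nabla> u x + smooth_psum_coeff p (d n) (v x) (u x) *\<^sub>R \<nabla> v x" for n
    by (rule W1p_0_compose_pair[OF pair p _ u v]; simp add: C_k_smooth_psum[OF d(2)])+
  have um [measurable]: "u \<in> borel_measurable M" "v \<in> borel_measurable M"
    "\<nabla> u \<in> borel_measurable M" "\<nabla> v \<in> borel_measurable M"
    using W1pD[OF u] W1pD[OF v] by (auto simp: in_Lp_def)
  have wG: "AE x in M. \<forall>n. \<nabla> (?w n) x =
      smooth_psum_coeff p (d n) (u x) (v x) *\<^sub>R \<nabla> u x + smooth_psum_coeff p (d n) (v x) (u x) *\<^sub>R \<nabla> v x"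
    by (intro AE_all_countable[THEN iffD2] allI w(2))
  define K where "K x = \<bar>u x\<bar> powr p + \<bar>v x\<bar> powr p + norm (\<nabla> u x) powr p + norm (\<nabla> v x) powr p" for x
  define H where "H x = (2 * 1) powr p * (2 powr p * (K x + K x))" for x
  have K: "\<bar>u x\<bar> powr p \<le> K x" "\<bar>v x\<bar> powr p \<le> K x" "norm (\<nabla> u x) powr p \<le> K x"
    "norm (\<nabla> v x) powr p \<le> K x" for x
    by (simp_all add: K_def)
  have meas: "(\<lambda>x. psum p (u x) (v x)) \<in> borel_measurable M" "?G \<in> borel_measurable M"
    unfolding psum_def psum_coeff_def by measurable
  have lim: "AE x in M. (\<lambda>n. ?w n x) \<longlonglongrightarrow> psum p (u x) (v x)"
    using tendsto_smooth_psum(1)[OF p d] by simp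
  have limG: "AE x in M. (\<lambda>n. \<nabla> (?w n) x) \<longlonglongrightarrow> ?G x"
    using wG by eventually_elim (simp add: tendsto_smooth_psum(2)[OF p d] tendsto_intros)
  have Hint: "integrable M H"
    unfolding H_def[abs_def] K_def[abs_def] using W1pD[OF u] W1pD[OF v] by (simp add: in_Lp_def)
  have b1: "AE x in M. \<bar>?w n x\<bar> powr p \<le> H x" for n
    unfolding H_def by (intro AE_I2 smooth_Lipschitz_pair.powr_bounds(1)[OF pair p0 K])
  have b2: "AE x in M. norm (\<nabla> (?w n) x) powr p \<le> H x" for n
    using w(2)[of n]
    unfolding H_def by eventually_elim (simp only: smooth_Lipschitz_pair.powr_bounds(2)[OF pair p0 K])
  show "(\<lambda>x. psum p (u x) (v x)) \<in> W1p_0 p \<Omega>"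
    by (rule W1p_0_dominated_limit(1)[OF p w(1) meas lim limG Hint b1 b2])
  show "AE x in M. \<nabla> (\<lambda>x. psum p (u x) (v x)) x = ?G x"
    by (rule W1p_0_dominated_limit(2)[OF p w(1) meas lim limG Hint b1 b2])
qed

section \<open>Functions with vanishing weak gradient\<close>

lemma C_k_translate:
  fixes f :: "'a::euclidean_space \<Rightarrow> real"
  shows "C_k k f \<Longrightarrow> C_k k (\<lambda>x. f (x - c))"
proof (induction k arbitrary: f)
  case 0
  then have "continuous_on UNIV f" by simp
  then have "continuous_on UNIV (\<lambda>x. f (x - c))"
    by (rule continuous_on_compose2) (intro continuous_intros, simp)
  then show ?case by simp
next
  case (Suc k)
  show ?case
  proof (rule C_k_SucI)
    show "((\<lambda>x. f (x - c)) has_derivative frechet_derivative f (at (x - c))) (at x)" for x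
    proof -
      have "((\<lambda>x. x - c) has_derivative (\<lambda>h. h)) (at x)"
        by (auto intro!: derivative_eq_intros)
      from has_derivative_compose[OF this C_k_SucD(1)[OF Suc.prems]] show ?thesis .
    qed
    show "C_k k (\<lambda>x. frechet_derivative f (at (x - c)) i)" if "i \<in> Basis" for i
      by (rule Suc.IH[OF C_k_SucD(2)[OF Suc.prems that]])
  qed
qed

lemma test_function_translate:
  fixes f :: "'a::euclidean_space \<Rightarrow> real"
  assumes f: "test_function (ball z r) f" and c: "norm c + r \<le> R"
  shows "test_function (ball z R) (\<lambda>x. f (x - c))"
proof (rule test_functionI)
  let ?K = "closure {x. f x \<noteq> 0}"
  have K: "compact ?K" "?K \<subseteq> ball z r" using f by (auto simp: test_function_def)
  show "C_k k (\<lambda>x. f (x - c))" for k by (rule C_k_translate[OF test_function_C_k[OF f]])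
  show "compact ((+) c ` ?K)" using K by (intro compact_translation)
  show "(+) c ` ?K \<subseteq> ball z R"
  proof
    fix y assume "y \<in> (+) c ` ?K"
    then obtain x where x: "x \<in> ball z r" "y = c + x" using K by blast
    have "dist z (c + x) \<le> dist z x + norm c"
      using norm_triangle_ineq4[of "z - x" c] by (simp add: dist_norm algebra_simps)
    then show "y \<in> ball z R" using x c by simp
  qed
  show "f (x - c) = 0" if "x \<notin> (+) c ` ?K" for x
  proof -
    have "x - c \<notin> ?K" using that by (metis add_diff_cancel_left' diff_add_cancel image_eqI add.commute)
    then show ?thesis using closure_subset[of "{x. f x \<noteq> 0}"] by auto
  qed
qed

lemma integrable_bounded_mult_test_function:
  assumes f: "test_function S f" and T: "T \<in> borel_measurable borel" "\<And>x. \<bar>T x\<bar> \<le> C"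
  shows "integrable lborel (\<lambda>x. T x * f x)"
proof (rule Bochner_Integration.integrable_bound)
  show "integrable lborel (\<lambda>x. C * f x)" using integrable_test_function_lborel[OF f] by simp
  have "f \<in> borel_measurable borel"
    using test_function_continuous[OF f] by (rule borel_measurable_continuous_onI)
  then show "(\<lambda>x. T x * f x) \<in> borel_measurable lborel" using T by simp
  have "norm (T x * f x) \<le> norm (C * f x)" for x
    using T(2)[of x] by (simp add: abs_mult mult_right_mono)
  then show "AE x in lborel. norm (T x * f x) \<le> norm (C * f x)" by simp
qed

text \<open>Differentiating the integral of T against f shifted by s h gives minus the integral of T
  against h \<bullet> grad of the shifted f. This is 0 while the shifted support stays in the ball
  of radius R, which \<open>norm h + r \<le> R\<close> ensures for s from 0 to 1.\<close>

lemma integral_translate_test_function: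
  fixes T :: "'a::euclidean_space \<Rightarrow> real"
  assumes T: "T \<in> borel_measurable borel" "\<And>x. \<bar>T x\<bar> \<le> C"
    and zero: "\<And>f. test_function (ball z R) f \<Longrightarrow> (LINT x|lborel. T x *\<^sub>R grad f x) = 0"
    and f: "test_function (ball z r) f" and h: "norm h + r \<le> R"
  shows "(LINT x|lborel. T x * f (x - h)) = (LINT x|lborel. T x * f x)"
proof -
  define j where "j s = (LINT x|lborel. T x * f (x - s *\<^sub>R h))" for s
  have test: "test_function (ball z R) (\<lambda>x. f (x - s *\<^sub>R h))" if "0 \<le> s" "s \<le> 1" for s
  proof (rule test_function_translate[OF f])
    have "s * norm h \<le> 1 * norm h" using that by (intro mult_right_mono) auto
    then show "norm (s *\<^sub>R h) + r \<le> R" using h that by simp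
  qed
  have testU: "test_function UNIV (\<lambda>x. f (x - c))" for c
    by (rule test_function_mono[OF test_function_translate[OF f order_refl]]) simp
  have int: "integrable lborel (\<lambda>x. T x * f (x - c))" for c
    by (rule integrable_bounded_mult_test_function[OF testU T])
  have D: "(j has_real_derivative 0) (at s)" if s: "0 \<le> s" "s \<le> 1" for s
    unfolding DERIV_def tendsto_at_iff_sequentially o_def
  proof (intro allI impI)
    fix r :: "nat \<Rightarrow> real" assume r0: "\<forall>i. r i \<in> UNIV - {0}" and r: "r \<longlonglongrightarrow> 0"
    let ?f = "\<lambda>x. f (x - s *\<^sub>R h)"
    have gint: "integrable lborel (\<lambda>x. T x *\<^sub>R grad ?f x)"
    proof (rule Bochner_Integration.integrable_bound)
      have c: "compact (closure {x. ?f x \<noteq> 0})" using testU by (simp add: test_function_def)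
      show int: "integrable lborel (\<lambda>x. C *\<^sub>R indicator (closure {x. ?f x \<noteq> 0}) x *\<^sub>R grad ?f x)"
        by (intro integrable_scaleR_right borel_integrable_compact[OF c test_function_continuous_grad[OF testU]])
      have "grad ?f \<in> borel_measurable borel"
        using test_function_continuous_grad[OF testU] by (rule borel_measurable_continuous_onI)
      then show "(\<lambda>x. T x *\<^sub>R grad ?f x) \<in> borel_measurable lborel" using T by simp
      have "norm (T x *\<^sub>R grad ?f x) \<le> norm (C *\<^sub>R indicator (closure {x. ?f x \<noteq> 0}) x *\<^sub>R grad ?f x)" for x
        using T(2)[of x] grad_eq_0_outside_support[OF testU, of x "s *\<^sub>R h"]
        by (cases "x \<in> closure {x. ?f x \<noteq> 0}") (auto intro!: mult_right_mono)
      then show "AE x in lborel. norm (T x *\<^sub>R grad ?f x) \<le> norm (C *\<^sub>R indicator (closure {x. ?f x \<noteq> 0}) x *\<^sub>R grad ?f x)"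
        by simp
    qed
    have "(LINT x|lborel. T x * (grad ?f x \<bullet> (- h))) = (LINT x|lborel. (T x *\<^sub>R grad ?f x) \<bullet> (- h))"
      by simp
    also have "\<dots> = (LINT x|lborel. T x *\<^sub>R grad ?f x) \<bullet> (- h)"
      using gint by (intro integral_inner_left)
    also have "\<dots> = 0" by (simp add: zero[OF test[OF s]])
    finally have K: "(LINT x|lborel. T x * (grad ?f x \<bullet> (- h))) = 0" .
    have "(\<lambda>n. LINT x|lborel. T x * ((?f (x + r n *\<^sub>R (- h)) - ?f x) / r n)) \<longlonglongrightarrow> (LINT x|lborel. T x * (grad ?f x \<bullet> (- h)))"
      by (rule integral_difference_quotient_tendsto[OF test[OF s] T r]) (use r0 in auto)
    moreover have "(LINT x|lborel. T x * ((?f (x + r n *\<^sub>R (- h)) - ?f x) / r n)) = (j (s + r n) - j s) / r n" for n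
    proof -
      have "T x * ((?f (x + r n *\<^sub>R (- h)) - ?f x) / r n) = (T x * f (x - (s + r n) *\<^sub>R h) - T x * f (x - s *\<^sub>R h)) / r n" for x
        by (simp add: algebra_simps diff_divide_distrib)
      then have "(LINT x|lborel. T x * ((?f (x + r n *\<^sub>R (- h)) - ?f x) / r n)) =
          (LINT x|lborel. (T x * f (x - (s + r n) *\<^sub>R h) - T x * f (x - s *\<^sub>R h)) / r n)"
        by (simp only:)
      also have "\<dots> = (j (s + r n) - j s) / r n"
        unfolding j_def integral_divide_zero using int[of "(s + r n) *\<^sub>R h"] int[of "s *\<^sub>R h"]
        by (subst Bochner_Integration.integral_diff) auto
      finally show ?thesis .
    qed
    ultimately show "(\<lambda>n. (j (s + r n) - j s) / r n) \<longlonglongrightarrow> 0" by (simp only: K)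
  qed
  have "j 1 = j 0"
  proof (rule DERIV_isconst2[of 0 1 j 1])
    show "continuous_on {0..1} j"
      by (intro continuous_at_imp_continuous_on ballI DERIV_isCont[OF D]) auto
  qed (use D in auto)
  then show ?thesis by (simp add: j_def)
qed

lemma ex_in_open_if_AE:
  fixes S :: "'a::euclidean_space set"
  assumes "open S" "S \<noteq> {}" "AE x in lebesgue. x \<in> S \<longrightarrow> P x"
  shows "\<exists>x\<in>S. P x"
proof (rule ccontr)
  assume "\<not> (\<exists>x\<in>S. P x)"
  with assms(3) have "AE x in lebesgue. x \<notin> S" by (auto elim: eventually_mono)
  then have "S \<in> null_sets lebesgue"
    using assms(1) by (simp add: AE_iff_null_sets)
  then show False
    using open_not_negligible[OF assms(1,2)] by (simp add: negligible_iff_null_sets)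
qed

text \<open>Testing T (x + h) - T x with f amounts to testing T with the difference of the shifted f
  and f, which gives 0; the fundamental lemma on the smaller ball concludes.\<close>

lemma AE_translate_eq_if_integral_grad_0:
  fixes T :: "'a::euclidean_space \<Rightarrow> real"
  assumes T: "T \<in> borel_measurable borel" "\<And>x. \<bar>T x\<bar> \<le> C"
    and zero: "\<And>f. test_function (ball z R) f \<Longrightarrow> (LINT x|lborel. T x *\<^sub>R grad f x) = 0"
    and h: "norm h + r \<le> R"
  shows "AE x in lborel. x \<in> ball z r \<longrightarrow> T (x + h) = T x"
proof -
  interpret bounded_domain "ball z r" by unfold_locales auto
  have Th: "(\<lambda>x. T (x + h)) \<in> borel_measurable borel" using T(1) by measurable
  have "AE x in lebesgue_on (ball z r). T (x + h) - T x = 0"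
  proof (rule fundamental_lemma_of_variations)
    have m: "(\<lambda>x. T (x + h) - T x) \<in> borel_measurable lebesgue"
      using T(1) Th by (intro measurable_completion) simp
    have b: "\<bar>T (x + h) - T x\<bar> \<le> C + C" for x
      using T(2)[of x] T(2)[of "x + h"] by linarith
    show "locally_integrable (ball z r) (\<lambda>x. T (x + h) - T x)"
      by (rule integrable_imp_locally_integrable, rule integrable_bounded[where B = "C + C"])
        (use m b in \<open>auto intro: measurable_restrict_space1\<close>)
    fix f assume f: "test_function (ball z r) f"
    have fm: "f \<in> borel_measurable borel"
      using test_function_continuous[OF f] by (rule borel_measurable_continuous_onI)
    have "(LINT x|lebesgue_on (ball z r). f x *\<^sub>R (T (x + h) - T x)) = (LINT x|lborel. f x *\<^sub>R (T (x + h) - T x))"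
      by (rule integral_domain_eq_lborel) (use T Th fm test_function_eq_0[OF f] in auto)
    also have "\<dots> = (LINT x|lborel. T (x + h) * f x - T x * f x)"
      by (simp add: algebra_simps)
    also have "\<dots> = (LINT x|lborel. T (x + h) * f x) - (LINT x|lborel. T x * f x)"
      by (intro Bochner_Integration.integral_diff integrable_bounded_mult_test_function[OF f _, of _ C])
        (use T Th in auto)
    also have "(LINT x|lborel. T (x + h) * f x) = (LINT x|lborel. T x * f (x - h))"
    proof -
      have "(\<lambda>x. f (x - h)) \<in> borel_measurable borel" using fm by measurable
      then show ?thesis
        using integral_lborel_translate[of "\<lambda>x. T x * f (x - h)" h] T(1) by simp
    qed
    also have "\<dots> - (LINT x|lborel. T x * f x) = 0"
      using integral_translate_test_function[OF T zero f h] by simp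
    finally show "(LINT x|lebesgue_on (ball z r). f x *\<^sub>R (T (x + h) - T x)) = 0" .
  qed auto
  then have "AE x in lebesgue. x \<in> ball z r \<longrightarrow> T (x + h) = T x"
    by (simp add: AE_restrict_space_iff)
  then show ?thesis by (simp only: AE_completion_iff)
qed

text \<open>Almost every point of the ball has the same value as almost all of its translates, so by
  Fubini some fixed point has the same value as almost all points of a neighbourhood.\<close>

lemma locally_constant_if_integral_grad_0:
  fixes T :: "'a::euclidean_space \<Rightarrow> real"
  assumes T: "T \<in> borel_measurable borel" "\<And>x. \<bar>T x\<bar> \<le> C"
    and zero: "\<And>f. test_function (ball z R) f \<Longrightarrow> (LINT x|lborel. T x *\<^sub>R grad f x) = 0"
    and R: "R > 0"
  shows "\<exists>c. AE x in lebesgue. x \<in> ball z (R / 4) \<longrightarrow> T x = c"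
proof -
  \<comment> \<open>Half of the radius is for the points x and half for the shifts h, so that x + h
    stays in the ball of radius R. The fixed point is then taken within r / 2 = R / 4 of z, so that
    it lies within r of all other points of that ball.\<close>
  define r where "r = R / 2"
  have r: "r > 0" using R by (simp add: r_def)
  let ?P = "\<lambda>h x. h \<in> ball 0 r \<and> x \<in> ball z r \<longrightarrow> T (x + h) = T x"
  have "AE x in lborel. ?P h x" for h
  proof (cases "h \<in> ball 0 r")
    case True
    have "AE x in lborel. x \<in> ball z r \<longrightarrow> T (x + h) = T x"
      by (rule AE_translate_eq_if_integral_grad_0[OF T zero]) (use True in \<open>auto simp: r_def\<close>)
    then show ?thesis by eventually_elim blast
  qed auto
  then have "AE h in lborel. AE x in lborel. ?P h x" by simp
  moreover have "{y \<in> space (lborel \<Otimes>\<^sub>M lborel). ?P (fst y) (snd y)} \<in> sets (lborel \<Otimes>\<^sub>M lborel)"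
  proof -
    have [measurable]: "T \<in> borel_measurable lborel" using T(1) by simp
    have [measurable]: "ball z r \<in> sets lborel" "ball 0 r \<in> sets (lborel :: 'a measure)" by auto
    show ?thesis by measurable
  qed
  ultimately have "AE x in lborel. AE h in lborel. ?P h x"
    by (subst (asm) lborel_pair.AE_commute)
  then have ae: "AE x in lebesgue. x \<in> ball z (r / 2) \<longrightarrow> (AE h in lborel. ?P h x)"
    by (auto simp: AE_completion_iff elim: eventually_mono)
  have "ball z (r / 2) \<noteq> {}" using r by simp
  from ex_in_open_if_AE[OF open_ball this ae]
  obtain x where x: "x \<in> ball z (r / 2)" "AE h in lborel. ?P h x"
    by (rule bexE)
  have "x \<in> ball z r" using x(1) r by simp
  with x(2) have "AE h in lborel. h \<in> ball 0 r \<longrightarrow> T (x + h) = T x" by simp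
  moreover have "Measurable.pred borel (\<lambda>y. y - x \<in> ball 0 r \<longrightarrow> T y = T x)"
  proof -
    have [measurable]: "ball 0 r \<in> sets (borel :: 'a measure)" by auto
    show ?thesis using T(1) by measurable
  qed
  \<comment> \<open>With x fixed, the statement about shifts h becomes one about points y = x + h,
    by translation invariance.\<close>
  ultimately have "AE y in distr lborel borel ((+) x). y - x \<in> ball 0 r \<longrightarrow> T y = T x"
    by (subst AE_distr_iff) auto
  then have "AE y in lborel. y - x \<in> ball 0 r \<longrightarrow> T y = T x" by (simp only: lborel_distr_plus)
  moreover have "y - x \<in> ball 0 r" if "y \<in> ball z (r / 2)" for y
  proof -
    have "dist x y < r" using x(1) that dist_triangle3[of x y z] by simp
    then show ?thesis by (simp add: dist_norm norm_minus_commute)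
  qed
  ultimately have "AE y in lborel. y \<in> ball z (r / 2) \<longrightarrow> T y = T x"
    by (auto elim: eventually_mono)
  then show ?thesis by (auto simp: r_def AE_completion_iff)
qed

section \<open>From local to global constancy on a connected domain\<close>

locale connected_domain = bounded_domain +
  assumes connected_domain: "connected \<Omega>" and nonempty: "\<Omega> \<noteq> {}"
begin

text \<open>Where two of the balls overlap their constants agree, since a nonempty open set is not
  null. The constant is thus a locally constant function of the centre, hence constant by
  connectedness.\<close>

lemma AE_constant_if_locally_constant:
  assumes local: "\<And>z. z \<in> \<Omega> \<Longrightarrow> \<exists>r c. r > 0 \<and> (AE x in lebesgue. x \<in> ball z r \<longrightarrow> T x = c)"
  shows "\<exists>c. AE x in M. T x = c"
proof -
  obtain r c where r: "\<And>z. z \<in> \<Omega> \<Longrightarrow> r z > 0"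
    and c: "\<And>z. z \<in> \<Omega> \<Longrightarrow> AE x in lebesgue. x \<in> ball z (r z) \<longrightarrow> T x = c z"
    using local by metis
  have loc: "c z = c w" if z: "z \<in> \<Omega>" and w: "w \<in> \<Omega>" "w \<in> ball z (r z)" for z w
  proof -
    have ae: "AE x in lebesgue. x \<in> ball z (r z) \<inter> ball w (r w) \<longrightarrow> c z = c w"
      using c[OF z] c[OF w(1)] by eventually_elim auto
    have "w \<in> ball z (r z) \<inter> ball w (r w)" using w r by simp
    then have "ball z (r z) \<inter> ball w (r w) \<noteq> {}" by blast
    from ex_in_open_if_AE[OF open_Int[OF open_ball open_ball] this ae] show ?thesis by simp
  qed
  obtain z0 where z0: "z0 \<in> \<Omega>" using nonempty by blast
  have const: "c z = c z0" if "z \<in> \<Omega>" for z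
  proof (rule connected_local_const[OF connected_domain that z0])
    show "\<forall>a\<in>\<Omega>. \<forall>\<^sub>F b in at a within \<Omega>. c a = c b"
    proof
      fix a assume a: "a \<in> \<Omega>"
      show "\<forall>\<^sub>F b in at a within \<Omega>. c a = c b"
        unfolding eventually_at using loc[OF a] r[OF a] by (intro exI[of _ "r a"]) (simp add: dist_commute)
    qed
  qed
  have "AE x in M. T x = c z0"
  proof (rule AE_lebesgue_on_locally[OF open_domain])
    fix z assume z: "z \<in> \<Omega>"
    show "\<exists>U. open U \<and> z \<in> U \<and> (AE x in lebesgue. x \<in> U \<longrightarrow> T x = c z0)"
      using c[OF z] r[OF z] const[OF z] by (intro exI[of _ "ball z (r z)"]) auto
  qed
  then show ?thesis ..
qed

text \<open>Only test functions supported in small balls are asked for, because the logarithmic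
  gradient in the application is known to be integrable only near each point.\<close>

lemma AE_constant_if_weak_gradient_0:
  assumes T: "T \<in> borel_measurable M" "\<And>x. \<bar>T x\<bar> \<le> C"
    and zero: "\<And>z. z \<in> \<Omega> \<Longrightarrow> \<exists>R>0. ball z R \<subseteq> \<Omega> \<and>
      (\<forall>f. test_function (ball z R) f \<longrightarrow> (LINT x|M. T x *\<^sub>R grad f x) = 0)"
  shows "\<exists>c. AE x in M. T x = c"
proof -
  have "(\<lambda>x. indicator \<Omega> x *\<^sub>R T x) \<in> borel_measurable lebesgue"
    using T(1) by (simp add: borel_measurable_restrict_space_iff)
  then obtain S where S: "S \<in> borel_measurable lborel" "AE x in lborel. indicator \<Omega> x *\<^sub>R T x = S x"
    using completion_ex_borel_measurable_real by blast
  \<comment> \<open>A Borel representative on the whole space, clipped so that the bound holds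
    everywhere and not just almost everywhere; the translation and Fubini arguments work with Borel
    functions.\<close>
  define T' where "T' x = max (- C) (min C (S x))" for x
  have C: "C \<ge> 0" using T(2)[of undefined] by linarith
  have T': "T' \<in> borel_measurable borel" "\<bar>T' x\<bar> \<le> C" for x
    using S(1) C unfolding T'_def by (auto simp: abs_le_iff)
  have eq: "AE x in lebesgue. x \<in> \<Omega> \<longrightarrow> T x = T' x"
    unfolding AE_completion_iff using S(2)
  proof eventually_elim
    fix x assume "indicator \<Omega> x *\<^sub>R T x = S x"
    then show "x \<in> \<Omega> \<longrightarrow> T x = T' x" using T(2)[of x] by (auto simp: T'_def abs_le_iff)
  qed
  have int: "(LINT x|lborel. T' x *\<^sub>R grad f x) = (LINT x|M. T x *\<^sub>R grad f x)"
    if f: "test_function \<Omega> f" for f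
  proof -
    have gm: "grad f \<in> borel_measurable borel"
      using test_function_continuous_grad[OF f] by (rule borel_measurable_continuous_onI)
    have "(LINT x|lborel. T' x *\<^sub>R grad f x) = (LINT x|lebesgue. T' x *\<^sub>R grad f x)"
      using T' gm by (intro integral_completion[symmetric]) simp
    also have "\<dots> = (LINT x|lebesgue. indicator \<Omega> x *\<^sub>R (T' x *\<^sub>R grad f x))"
      using test_function_grad_eq_0[OF f] by (intro Bochner_Integration.integral_cong) (auto simp: indicator_def)
    also have "\<dots> = (LINT x|M. T' x *\<^sub>R grad f x)"
      by (rule integral_restrict_space[symmetric]) simp
    also have "\<dots> = (LINT x|M. T x *\<^sub>R grad f x)"
    proof (rule integral_cong_AE)
      show "AE x in M. T' x *\<^sub>R grad f x = T x *\<^sub>R grad f x"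
        using eq by (auto simp: AE_restrict_space_iff elim: eventually_mono)
      have "T' \<in> borel_measurable M"
        using T'(1) by (intro measurable_restrict_space1 measurable_completion) simp
      then show "(\<lambda>x. T' x *\<^sub>R grad f x) \<in> borel_measurable M"
        "(\<lambda>x. T x *\<^sub>R grad f x) \<in> borel_measurable M"
        using T(1) test_function_measurable[OF f] by simp_all
    qed
    finally show ?thesis .
  qed
  have "\<exists>r c. r > 0 \<and> (AE x in lebesgue. x \<in> ball z r \<longrightarrow> T x = c)" if z: "z \<in> \<Omega>" for z
  proof -
    obtain R where R: "R > 0" "ball z R \<subseteq> \<Omega>"
      "\<And>f. test_function (ball z R) f \<Longrightarrow> (LINT x|M. T x *\<^sub>R grad f x) = 0"
      using zero[OF z] by blast
    have "\<exists>c. AE x in lebesgue. x \<in> ball z (R / 4) \<longrightarrow> T' x = c"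
    proof (rule locally_constant_if_integral_grad_0[OF T' _ R(1)])
      show "(LINT x|lborel. T' x *\<^sub>R grad f x) = 0" if f: "test_function (ball z R) f" for f
        using int[OF test_function_mono[OF f R(2)]] R(3)[OF f] by simp
    qed
    then obtain c where c: "AE x in lebesgue. x \<in> ball z (R / 4) \<longrightarrow> T' x = c" ..
    have "AE x in lebesgue. x \<in> ball z (R / 4) \<longrightarrow> T x = c"
      using c eq
    proof eventually_elim
      fix x assume *: "x \<in> ball z (R / 4) \<longrightarrow> T' x = c" "x \<in> \<Omega> \<longrightarrow> T x = T' x"
      have "x \<in> \<Omega>" if "x \<in> ball z (R / 4)"
        using that R by auto
      with * show "x \<in> ball z (R / 4) \<longrightarrow> T x = c" by auto
    qed
    then show ?thesis using R(1) by (intro exI[of _ "R / 4"] exI[of _ c]) simp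
  qed
  then show ?thesis by (rule AE_constant_if_locally_constant)
qed

end

section \<open>Homogeneous quotients of Sobolev functions\<close>

text \<open>For d = 0 it is homogeneous of degree 0, and unlike s/t it is bounded: (a, b) = (1, 0)
  gives s^2/(s^2 + t^2) and (0, 1) gives s t/(s^2 + t^2). Positive d makes it smooth; for d = 0 the
  value at the origin is 0.\<close>

definition hquot :: "real \<Rightarrow> real \<Rightarrow> real \<Rightarrow> real \<Rightarrow> real \<Rightarrow> real" where
  "hquot a b d s t = s * (a * s + b * t) / (s\<^sup>2 + t\<^sup>2 + d)"

definition hquot_coeff1 :: "real \<Rightarrow> real \<Rightarrow> real \<Rightarrow> real \<Rightarrow> real \<Rightarrow> real" where
  "hquot_coeff1 a b d s t =
     (2 * a * s + b * t) / (s\<^sup>2 + t\<^sup>2 + d) - hquot a b d s t * (2 * s / (s\<^sup>2 + t\<^sup>2 + d))"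

definition hquot_coeff2 :: "real \<Rightarrow> real \<Rightarrow> real \<Rightarrow> real \<Rightarrow> real \<Rightarrow> real" where
  "hquot_coeff2 a b d s t =
     b * s / (s\<^sup>2 + t\<^sup>2 + d) - hquot a b d s t * (2 * t / (s\<^sup>2 + t\<^sup>2 + d))"

lemma hquot_bound:
  assumes d: "d \<ge> 0"
  shows "\<bar>hquot a b d s t\<bar> \<le> \<bar>a\<bar> + \<bar>b\<bar>"
proof (cases "s\<^sup>2 + t\<^sup>2 + d = 0")
  case False
  let ?D = "s\<^sup>2 + t\<^sup>2 + d"
  have D: "?D > 0" using False d by (simp add: order_less_le)
  have st: "\<bar>s\<bar> * \<bar>t\<bar> \<le> ?D"
  proof -
    have "2 * (\<bar>s\<bar> * \<bar>t\<bar>) \<le> s\<^sup>2 + t\<^sup>2"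
      using sum_squares_bound[of "\<bar>s\<bar>" "\<bar>t\<bar>"] by (simp add: mult.assoc)
    moreover have "\<bar>s\<bar> * \<bar>t\<bar> \<ge> 0" by simp
    ultimately show ?thesis using d by linarith
  qed
  have ss: "\<bar>s\<bar> * \<bar>s\<bar> \<le> ?D" using d by (simp add: power2_eq_square)
  have "\<bar>s * (a * s + b * t)\<bar> \<le> \<bar>a\<bar> * (\<bar>s\<bar> * \<bar>s\<bar>) + \<bar>b\<bar> * (\<bar>s\<bar> * \<bar>t\<bar>)"
    using abs_triangle_ineq[of "a * (s * s)" "b * (s * t)"] by (simp add: abs_mult algebra_simps)
  also have "\<dots> \<le> \<bar>a\<bar> * ?D + \<bar>b\<bar> * ?D"
    using st ss by (intro add_mono mult_left_mono) auto
  finally show ?thesis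
    using D by (simp add: hquot_def divide_le_eq distrib_right abs_divide)
qed (simp add: hquot_def)

lemma linear_over_square_bound:
  fixes s t d :: real
  assumes d: "d > 0"
  shows "\<bar>s\<bar> / (s\<^sup>2 + t\<^sup>2 + d) \<le> 1 + 1 / d" "\<bar>t\<bar> / (s\<^sup>2 + t\<^sup>2 + d) \<le> 1 + 1 / d"
proof -
  have D: "s\<^sup>2 + t\<^sup>2 + d > 0" using d by (simp add: add_nonneg_pos)
  have *: "\<bar>x\<bar> \<le> (1 + 1 / d) * (x\<^sup>2 + y\<^sup>2 + d)" for x y :: real
  proof -
    have "2 * \<bar>x\<bar> \<le> x\<^sup>2 + 1"
      using sum_squares_bound[of "\<bar>x\<bar>" 1] by simp
    then have "\<bar>x\<bar> \<le> x\<^sup>2 + 1" by linarith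
    also have "\<dots> \<le> (1 + 1 / d) * (x\<^sup>2 + y\<^sup>2 + d)"
      using d by (simp add: distrib_left distrib_right add_increasing2)
    finally show ?thesis .
  qed
  show "\<bar>s\<bar> / (s\<^sup>2 + t\<^sup>2 + d) \<le> 1 + 1 / d" "\<bar>t\<bar> / (s\<^sup>2 + t\<^sup>2 + d) \<le> 1 + 1 / d"
    using *[of s t] *[of t s] D by (simp_all add: divide_le_eq add.commute[of "t\<^sup>2"])
qed

text \<open>The constant blows up as d tends to 0, which is harmless: it is used for each fixed d,
  and the limit is controlled by \<open>hquot_euler\<close> instead.\<close>

lemma smooth_Lipschitz_pair_hquot:
  assumes d: "d > 0"
  shows "smooth_Lipschitz_pair (hquot a b d) (hquot_coeff1 a b d) (hquot_coeff2 a b d) (4 * (\<bar>a\<bar> + \<bar>b\<bar>) * (1 + 1 / d))"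
proof
  have D: "s\<^sup>2 + t\<^sup>2 + d > 0" for s t :: real using d by (simp add: add_nonneg_pos)
  then have D0: "s\<^sup>2 + t\<^sup>2 + d \<noteq> 0" for s t :: real by (metis less_irrefl)
  show "((\<lambda>z. hquot a b d (fst z) (snd z)) has_derivative
      (\<lambda>h. hquot_coeff1 a b d s t * fst h + hquot_coeff2 a b d s t * snd h)) (at (s, t))" for s t
  proof -
    let ?N = "s * (a * s + b * t)" and ?D = "s\<^sup>2 + t\<^sup>2 + d"
    let ?N' = "\<lambda>h. (2 * a * s + b * t) * fst h + b * s * snd h" and ?D' = "\<lambda>h. 2 * s * fst h + 2 * t * snd h"
    have N: "((\<lambda>z. fst z * (a * fst z + b * snd z)) has_derivative ?N') (at (s, t))"
      by (auto intro!: derivative_eq_intros simp: fun_eq_iff algebra_simps)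
    have D: "((\<lambda>z. (fst z)\<^sup>2 + (snd z)\<^sup>2 + d) has_derivative ?D') (at (s, t))"
      by (auto intro!: derivative_eq_intros simp: fun_eq_iff)
    have "((\<lambda>z. fst z * (a * fst z + b * snd z) / ((fst z)\<^sup>2 + (snd z)\<^sup>2 + d)) has_derivative
        (\<lambda>h. (?N' h * ?D - ?N * ?D' h) / (?D * ?D))) (at (s, t))"
      using has_derivative_divide'[OF N D] D0[of s t] by simp
    moreover have "(?N' h * ?D - ?N * ?D' h) / (?D * ?D) = hquot_coeff1 a b d s t * fst h + hquot_coeff2 a b d s t * snd h" for h
    proof -
      have "(?N' h * ?D - ?N * ?D' h) / (?D * ?D) = ?N' h / ?D - ?N / ?D * (?D' h / ?D)"
        using D0[of s t] by (simp add: diff_divide_distrib)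
      also have "\<dots> = hquot_coeff1 a b d s t * fst h + hquot_coeff2 a b d s t * snd h"
        unfolding hquot_coeff1_def hquot_coeff2_def hquot_def[symmetric]
        by (simp add: add_divide_distrib algebra_simps)
      finally show ?thesis .
    qed
    ultimately show ?thesis by (simp only: hquot_def)
  qed
  show "continuous_on UNIV (\<lambda>z. hquot_coeff1 a b d (fst z) (snd z))"
    "continuous_on UNIV (\<lambda>z. hquot_coeff2 a b d (fst z) (snd z))"
    unfolding hquot_def hquot_coeff1_def hquot_coeff2_def using D0 by (auto intro!: continuous_intros)
  fix s t
  let ?D = "s\<^sup>2 + t\<^sup>2 + d"
  let ?K = "1 + 1 / d"
  have q: "\<bar>hquot a b d s t\<bar> \<le> \<bar>a\<bar> + \<bar>b\<bar>" using d by (intro hquot_bound) simp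
  have K: "?K \<ge> 0" using d by simp
  note l = linear_over_square_bound[OF d, where s = s and t = t]
  have 1: "\<bar>hquot a b d s t * (2 * x / ?D)\<bar> \<le> (\<bar>a\<bar> + \<bar>b\<bar>) * (2 * ?K)" if "\<bar>x\<bar> / ?D \<le> ?K" for x
  proof -
    have "\<bar>2 * x / ?D\<bar> \<le> 2 * ?K" using that D[of s t] by (simp add: abs_mult)
    then show ?thesis unfolding abs_mult using q by (intro mult_mono) auto
  qed
  have 2: "\<bar>c * x / ?D\<bar> \<le> \<bar>c\<bar> * ?K" if "\<bar>x\<bar> / ?D \<le> ?K" for c x
    using mult_left_mono[OF that, of "\<bar>c\<bar>"] D[of s t] by (simp add: abs_mult)
  \<comment> \<open>The left-hand sides are (4|a| + 3|b|) y and (2|a| + 3|b|) y, whence the factor 4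
    in the Lipschitz constant.\<close>
  have 3: "\<bar>2 * a\<bar> * y + \<bar>b\<bar> * y + (\<bar>a\<bar> + \<bar>b\<bar>) * (2 * y) \<le> 4 * (\<bar>a\<bar> + \<bar>b\<bar>) * y \<and>
      \<bar>b\<bar> * y + (\<bar>a\<bar> + \<bar>b\<bar>) * (2 * y) \<le> 4 * (\<bar>a\<bar> + \<bar>b\<bar>) * y" if "y \<ge> 0" for y
    using mult_nonneg_nonneg[of "\<bar>a\<bar>" y] mult_nonneg_nonneg[of "\<bar>b\<bar>" y] that
    by (simp add: abs_mult algebra_simps)
  have "hquot_coeff1 a b d s t = 2 * a * s / ?D + b * t / ?D - hquot a b d s t * (2 * s / ?D)"
    by (simp add: hquot_coeff1_def add_divide_distrib)
  then have "\<bar>hquot_coeff1 a b d s t\<bar> \<le> \<bar>2 * a\<bar> * ?K + \<bar>b\<bar> * ?K + (\<bar>a\<bar> + \<bar>b\<bar>) * (2 * ?K)"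
    using 2[OF l(1), of "2 * a"] 2[OF l(2), of b] 1[OF l(1)] by linarith
  also have "\<dots> \<le> 4 * (\<bar>a\<bar> + \<bar>b\<bar>) * ?K"
    using 3[OF K] by (rule conjunct1)
  finally show "\<bar>hquot_coeff1 a b d s t\<bar> \<le> 4 * (\<bar>a\<bar> + \<bar>b\<bar>) * ?K" .
  have "\<bar>hquot_coeff2 a b d s t\<bar> \<le> \<bar>b\<bar> * ?K + (\<bar>a\<bar> + \<bar>b\<bar>) * (2 * ?K)"
    unfolding hquot_coeff2_def using 2[OF l(1), of b] 1[OF l(2)] by linarith
  also have "\<dots> \<le> 4 * (\<bar>a\<bar> + \<bar>b\<bar>) * ?K"
    using 3[OF K] by (rule conjunct2)
  finally show "\<bar>hquot_coeff2 a b d s t\<bar> \<le> 4 * (\<bar>a\<bar> + \<bar>b\<bar>) * ?K" .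
qed (simp add: hquot_def)

lemma C_k_hquot:
  fixes f g :: "'a::euclidean_space \<Rightarrow> real"
  assumes d: "d > 0" and f: "C_k k f" and g: "C_k k g"
  shows "C_k k (\<lambda>x. hquot a b d (f x) (g x))"
proof -
  have pos: "f x * f x + g x * g x + d > 0" for x
    using d by (simp add: add_nonneg_pos)
  have "C_k k (\<lambda>x. f x * (a * f x + b * g x) * (f x * f x + g x * g x + d) powr - 1)"
    by (intro C_k_mult C_k_add C_k_powr C_k_const f g pos)
  moreover have "f x * (a * f x + b * g x) * (f x * f x + g x * g x + d) powr - 1 = hquot a b d (f x) (g x)" for x
    using pos[of x] by (simp add: hquot_def powr_minus divide_inverse power2_eq_square)
  ultimately show ?thesis by (simp only:)
qed

text \<open>Euler's identity: the quotient is homogeneous of degree 0 up to the regularisation.\<close>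

lemma hquot_euler:
  assumes d: "d > 0"
  shows "hquot_coeff1 a b d s t * s + hquot_coeff2 a b d s t * t = 2 * hquot a b d s t * (d / (s\<^sup>2 + t\<^sup>2 + d))"
proof -
  have D: "s\<^sup>2 + t\<^sup>2 + d \<noteq> 0" using d by (metis add_nonneg_pos less_irrefl sum_power2_ge_zero)
  have "hquot_coeff1 a b d s t * s + hquot_coeff2 a b d s t * t =
      2 * hquot a b d s t - 2 * hquot a b d s t * ((s\<^sup>2 + t\<^sup>2) / (s\<^sup>2 + t\<^sup>2 + d))"
    unfolding hquot_coeff1_def hquot_coeff2_def hquot_def
    by (simp add: add_divide_distrib[symmetric] diff_divide_distrib[symmetric] algebra_simps power2_eq_square)
  also have "\<dots> = 2 * hquot a b d s t * (1 - (s\<^sup>2 + t\<^sup>2) / (s\<^sup>2 + t\<^sup>2 + d))"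
    by (simp add: algebra_simps)
  also have "1 - (s\<^sup>2 + t\<^sup>2) / (s\<^sup>2 + t\<^sup>2 + d) = d / (s\<^sup>2 + t\<^sup>2 + d)"
    using D by (simp add: field_simps)
  finally show ?thesis .
qed

text \<open>Off the origin the factor d / (s^2 + t^2 + d) tends to 0; at the origin it need not, but
  there the quotient itself vanishes.\<close>

lemma tendsto_hquot:
  assumes d: "d \<longlonglongrightarrow> 0"
  shows "(\<lambda>n. hquot a b (d n) s t) \<longlonglongrightarrow> hquot a b 0 s t"
    and "(\<lambda>n. 2 * hquot a b (d n) s t * (d n / (s\<^sup>2 + t\<^sup>2 + d n))) \<longlonglongrightarrow> 0"
proof -
  show 1: "(\<lambda>n. hquot a b (d n) s t) \<longlonglongrightarrow> hquot a b 0 s t"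
  proof (cases "s\<^sup>2 + t\<^sup>2 = 0")
    case True
    then show ?thesis by (simp add: hquot_def sum_power2_eq_zero_iff)
  next
    case False
    then show ?thesis unfolding hquot_def by (intro tendsto_intros d) auto
  qed
  show "(\<lambda>n. 2 * hquot a b (d n) s t * (d n / (s\<^sup>2 + t\<^sup>2 + d n))) \<longlonglongrightarrow> 0"
  proof (cases "s\<^sup>2 + t\<^sup>2 = 0")
    case True
    then show ?thesis by (simp add: hquot_def sum_power2_eq_zero_iff)
  next
    case False
    then have "(\<lambda>n. 2 * hquot a b (d n) s t * (d n / (s\<^sup>2 + t\<^sup>2 + d n))) \<longlonglongrightarrow> 2 * hquot a b 0 s t * (0 / (s\<^sup>2 + t\<^sup>2 + 0))"
      by (intro tendsto_intros 1 d) auto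
    then show ?thesis by simp
  qed
qed

context connected_domain
begin

text \<open>As the gradients are u X and v X, Euler's identity leaves only 2 q d / (u^2 + v^2 + d)
  times X for the regularised quotient q. This tends to 0 and is dominated by a multiple of the norm
  of X, so the quotient at d = 0 has weak gradient 0.\<close>

lemma hquot_AE_constant:
  assumes p: "p > 1" and u: "u \<in> W1p_0 p \<Omega>" and v: "v \<in> W1p_0 p \<Omega>"
    and gu: "AE x in M. \<nabla> u x = u x *\<^sub>R X x"
    and gv: "AE x in M. \<nabla> v x = v x *\<^sub>R X x"
    and X: "\<And>z. z \<in> \<Omega> \<Longrightarrow> \<exists>R>0. ball z R \<subseteq> \<Omega> \<and> integrable (lebesgue_on (ball z R)) X"
  shows "\<exists>c. AE x in M. hquot a b 0 (u x) (v x) = c"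
proof (rule AE_constant_if_weak_gradient_0)
  have um [measurable]: "u \<in> borel_measurable M" "v \<in> borel_measurable M"
    using W1pD[OF u] W1pD[OF v] by (auto simp: in_Lp_def)
  show Tm: "(\<lambda>x. hquot a b 0 (u x) (v x)) \<in> borel_measurable M"
    unfolding hquot_def by measurable
  show "\<bar>hquot a b 0 (u x) (v x)\<bar> \<le> \<bar>a\<bar> + \<bar>b\<bar>" for x by (rule hquot_bound) simp
  fix z assume z: "z \<in> \<Omega>"
  obtain R where R: "R > 0" "ball z R \<subseteq> \<Omega>" and XR: "integrable (lebesgue_on (ball z R)) X"
    using X[OF z] by blast
  have "(LINT x|M. hquot a b 0 (u x) (v x) *\<^sub>R grad f x) = 0" if fR: "test_function (ball z R) f" for f
  proof -
    define d where "d n = 1 / real (Suc n)" for n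
    have d: "d \<longlonglongrightarrow> 0" "\<And>n. d n > 0"
      unfolding d_def by (rule LIMSEQ_Suc[OF lim_1_over_n]) simp
    have f: "test_function \<Omega> f" by (rule test_function_mono[OF fR R(2)])
    obtain B where B: "\<And>x. \<bar>f x\<bar> \<le> B" "\<And>x. norm (grad f x) \<le> B" using test_function_bounded[OF f] by metis
    note fm [measurable] = test_function_measurable[OF f]
    let ?w = "\<lambda>n x. hquot a b (d n) (u x) (v x)"
    have w: "?w n \<in> W1p_0 p \<Omega>"
      "AE x in M. \<nabla> (?w n) x =
        hquot_coeff1 a b (d n) (u x) (v x) *\<^sub>R \<nabla> u x + hquot_coeff2 a b (d n) (u x) (v x) *\<^sub>R \<nabla> v x" for n
      by (rule W1p_0_compose_pair[OF smooth_Lipschitz_pair_hquot[OF d(2)] p _ u v]; simp add: C_k_hquot[OF d(2)])+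
    let ?c = "\<lambda>n x. 2 * ?w n x * (d n / ((u x)\<^sup>2 + (v x)\<^sup>2 + d n))"
    have wG: "AE x in M. \<nabla> (?w n) x = ?c n x *\<^sub>R X x" for n
      using w(2)[of n] gu gv
    proof eventually_elim
      fix x
      assume *: "\<nabla> (?w n) x =
        hquot_coeff1 a b (d n) (u x) (v x) *\<^sub>R \<nabla> u x + hquot_coeff2 a b (d n) (u x) (v x) *\<^sub>R \<nabla> v x"
        "\<nabla> u x = u x *\<^sub>R X x" "\<nabla> v x = v x *\<^sub>R X x"
      show "\<nabla> (?w n) x = ?c n x *\<^sub>R X x"
        unfolding * scaleR_scaleR scaleR_left_distrib[symmetric] hquot_euler[OF d(2)] ..
    qed
    have wGm [measurable]: "\<nabla> (?w n) \<in> borel_measurable M" for n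
      using W1pD(2)[OF w(1)] by (auto simp: in_Lp_def)
    have wm [measurable]: "?w n \<in> borel_measurable M" for n
      using W1pD(1)[OF w(1)] by (auto simp: in_Lp_def)
    have lim1: "(\<lambda>n. LINT x|M. ?w n x *\<^sub>R grad f x) \<longlonglongrightarrow> (LINT x|M. hquot a b 0 (u x) (v x) *\<^sub>R grad f x)"
    proof (rule integral_dominated_convergence)
      show "integrable M (\<lambda>x. (\<bar>a\<bar> + \<bar>b\<bar>) * B)" by simp
      show "AE x in M. (\<lambda>n. ?w n x *\<^sub>R grad f x) \<longlonglongrightarrow> hquot a b 0 (u x) (v x) *\<^sub>R grad f x"
        by (intro AE_I2 tendsto_scaleR tendsto_const tendsto_hquot(1) d)
      have "norm (?w n x *\<^sub>R grad f x) \<le> (\<bar>a\<bar> + \<bar>b\<bar>) * B" for n x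
        unfolding norm_scaleR using hquot_bound[of "d n" a b "u x" "v x"] d(2)[of n] B(2)[of x]
        by (intro mult_mono) auto
      then show "AE x in M. norm (?w n x *\<^sub>R grad f x) \<le> (\<bar>a\<bar> + \<bar>b\<bar>) * B" for n by simp
    qed (use Tm in measurable)
    have "integrable lebesgue (\<lambda>x. indicator (ball z R) x *\<^sub>R X x)"
      using XR by (simp add: integrable_restrict_space)
    then have "integrable lebesgue (\<lambda>x. indicator \<Omega> x *\<^sub>R (indicator (ball z R) x *\<^sub>R X x))"
      by (rule integrable_mult_indicator[OF sets_domain])
    then have Xi: "integrable M (\<lambda>x. indicator (ball z R) x *\<^sub>R X x)"
      by (simp only: integrable_restrict_space sets.Int_space_eq2 sets_domain)
    have lim2: "(\<lambda>n. LINT x|M. f x *\<^sub>R \<nabla> (?w n) x) \<longlonglongrightarrow> (LINT x|M. 0)"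
    proof (rule integral_dominated_convergence)
      show "integrable M (\<lambda>x. B * (2 * (\<bar>a\<bar> + \<bar>b\<bar>) * norm (indicator (ball z R) x *\<^sub>R X x)))"
        using Xi by (intro integrable_mult_right integrable_norm)
      have all: "AE x in M. \<forall>n. \<nabla> (?w n) x = ?c n x *\<^sub>R X x"
        using wG by (simp add: AE_all_countable)
      then show "AE x in M. (\<lambda>n. f x *\<^sub>R \<nabla> (?w n) x) \<longlonglongrightarrow> 0"
      proof eventually_elim
        fix x assume *: "\<forall>n. \<nabla> (?w n) x = ?c n x *\<^sub>R X x"
        have "(\<lambda>n. f x *\<^sub>R (?c n x *\<^sub>R X x)) \<longlonglongrightarrow> f x *\<^sub>R (0 *\<^sub>R X x)"
          by (intro tendsto_scaleR tendsto_const tendsto_hquot(2) d)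
        then show "(\<lambda>n. f x *\<^sub>R \<nabla> (?w n) x) \<longlonglongrightarrow> 0" using * by simp
      qed
      show "AE x in M. norm (f x *\<^sub>R \<nabla> (?w n) x) \<le>
          B * (2 * (\<bar>a\<bar> + \<bar>b\<bar>) * norm (indicator (ball z R) x *\<^sub>R X x))" for n
        using wG[of n]
      proof eventually_elim
        fix x assume *: "\<nabla> (?w n) x = ?c n x *\<^sub>R X x"
        have "\<bar>d n / ((u x)\<^sup>2 + (v x)\<^sup>2 + d n)\<bar> \<le> 1"
          using d(2)[of n] add_nonneg_pos[of "(u x)\<^sup>2 + (v x)\<^sup>2" "d n"] by (simp add: divide_le_eq)
        then have "\<bar>2 * ?w n x\<bar> * \<bar>d n / ((u x)\<^sup>2 + (v x)\<^sup>2 + d n)\<bar> \<le> 2 * (\<bar>a\<bar> + \<bar>b\<bar>) * 1"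
          using hquot_bound[of "d n" a b "u x" "v x"] d(2)[of n] by (intro mult_mono) auto
        then have c: "\<bar>?c n x\<bar> \<le> 2 * (\<bar>a\<bar> + \<bar>b\<bar>)" by (simp only: abs_mult mult_1_right)
        show "norm (f x *\<^sub>R \<nabla> (?w n) x) \<le> B * (2 * (\<bar>a\<bar> + \<bar>b\<bar>) * norm (indicator (ball z R) x *\<^sub>R X x))"
        proof (cases "x \<in> ball z R")
          case True
          then show ?thesis
            unfolding * norm_scaleR using B(1)[of x] c
            by (intro mult_mono) auto
        next
          case False
          then show ?thesis using test_function_eq_0[OF fR False] by simp
        qed
      qed
    qed measurable
    have "(LINT x|M. ?w n x *\<^sub>R grad f x) = - (LINT x|M. f x *\<^sub>R \<nabla> (?w n) x)" for n
      using W1pD(3)[OF w(1)] f by (auto simp: has_weak_gradient_def)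
    then have "(\<lambda>n. LINT x|M. ?w n x *\<^sub>R grad f x) \<longlonglongrightarrow> - (LINT x|M. 0)"
      using tendsto_minus[OF lim2] by (simp only:)
    from LIMSEQ_unique[OF lim1 this] show ?thesis by simp
  qed
  then show "\<exists>R>0. ball z R \<subseteq> \<Omega> \<and>
      (\<forall>f. test_function (ball z R) f \<longrightarrow> (LINT x|M. hquot a b 0 (u x) (v x) *\<^sub>R grad f x) = 0)"
    using R by blast
qed

text \<open>The zero function trivially has gradient 0 times X. Paired with it, u has as quotient
  the indicator of u \<noteq> 0, which is therefore constant; the constant 0 is excluded.\<close>

lemma AE_nonzero_if_logarithmic_gradient:
  assumes p: "p > 1" and u: "u \<in> W1p_0 p \<Omega>" "\<not> (AE x in M. u x = 0)"
    and gu: "AE x in M. \<nabla> u x = u x *\<^sub>R X x"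
    and X: "\<And>z. z \<in> \<Omega> \<Longrightarrow> \<exists>R>0. ball z R \<subseteq> \<Omega> \<and> integrable (lebesgue_on (ball z R)) X"
  shows "AE x in M. u x \<noteq> 0"
proof -
  have "AE x in M. \<nabla> (\<lambda>x. 0) x = 0 *\<^sub>R X x"
    using test_function_in_W1p_0(2)[OF p test_function_0]
    by eventually_elim (use grad_cmult[OF test_function_0, of 0] in simp)
  from hquot_AE_constant[OF p u(1) test_function_in_W1p_0(1)[OF p test_function_0] gu this X]
  obtain c where c: "AE x in M. hquot 1 0 0 (u x) 0 = c" by blast
  have q: "hquot 1 0 0 s 0 = (if s = 0 then 0 else 1)" for s
    by (simp add: hquot_def power2_eq_square)
  have "c \<noteq> 0"
  proof
    assume "c = 0"
    with c have "AE x in M. u x = 0"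
      unfolding q by (auto elim!: eventually_mono split: if_splits)
    with u(2) show False ..
  qed
  with c show ?thesis
    unfolding q by (auto elim!: eventually_mono split: if_splits)
qed

text \<open>u^2/(u^2 + v^2) and u v/(u^2 + v^2) are both constant, and their ratio is u/v.\<close>

lemma AE_proportional_if_logarithmic_gradients_eq:
  assumes p: "p > 1" and u: "u \<in> W1p_0 p \<Omega>" "AE x in M. u x \<noteq> 0"
    and v: "v \<in> W1p_0 p \<Omega>" "AE x in M. v x \<noteq> 0"
    and gu: "AE x in M. \<nabla> u x = u x *\<^sub>R X x"
    and gv: "AE x in M. \<nabla> v x = v x *\<^sub>R X x"
    and X: "\<And>z. z \<in> \<Omega> \<Longrightarrow> \<exists>R>0. ball z R \<subseteq> \<Omega> \<and> integrable (lebesgue_on (ball z R)) X"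
  shows "\<exists>k. AE x in M. u x = k * v x"
proof -
  note const = hquot_AE_constant[OF p u(1) v(1) gu gv X]
  obtain c1 where c1: "AE x in M. hquot 1 0 0 (u x) (v x) = c1" using const[of 1 0] by blast
  obtain c2 where c2: "AE x in M. hquot 0 1 0 (u x) (v x) = c2" using const[of 0 1] by blast
  have "AE x in M. u x = c1 / c2 * v x"
    using c1 c2 u(2) v(2)
  proof eventually_elim
    fix x assume *: "hquot 1 0 0 (u x) (v x) = c1" "hquot 0 1 0 (u x) (v x) = c2" "u x \<noteq> 0" "v x \<noteq> 0"
    have D: "(u x)\<^sup>2 + (v x)\<^sup>2 \<noteq> 0" using *(3) by (simp add: sum_power2_eq_zero_iff)
    have "c1 = u x * u x / ((u x)\<^sup>2 + (v x)\<^sup>2)" "c2 = u x * v x / ((u x)\<^sup>2 + (v x)\<^sup>2)"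
      using *(1,2) by (simp_all add: hquot_def)
    then have "c1 / c2 = u x / v x" using *(3,4) D by simp
    then show "u x = c1 / c2 * v x" using *(4) by simp
  qed
  then show ?thesis ..
qed

end

section \<open>Strict convexity of the Dirichlet energy along \<open>p\<close>-sums\<close>

text \<open>Mean value theorem and strict monotonicity of the derivative; a = 0 is computed
  directly, as the derivative formula is used at positive points only.\<close>

lemma powr_gt_tangent:
  fixes a b p :: real
  assumes p: "p > 1" and a: "a \<ge> 0" and b: "b > 0" and ab: "a \<noteq> b"
  shows "b powr p + p * b powr (p - 1) * (a - b) < a powr p"
proof -
  have der: "((\<lambda>x. x powr p) has_real_derivative p * x powr (p - 1)) (at x)" if "x > 0" for x :: real
    using that by (rule has_real_derivative_powr)
  consider "a > b" | "a = 0" | "0 < a" "a < b" using a ab by linarith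
  then show ?thesis
  proof cases
    case 1
    obtain c where c: "b < c" "c < a" "a powr p - b powr p = (a - b) * (p * c powr (p - 1))"
      using MVT2[OF 1, of "\<lambda>x. x powr p" "\<lambda>x. p * x powr (p - 1)"] der b by force
    have "b powr (p - 1) < c powr (p - 1)" using c b p by (intro powr_less_mono2) auto
    then have "(a - b) * (p * b powr (p - 1)) < (a - b) * (p * c powr (p - 1))"
      using 1 p by (intro mult_strict_left_mono) auto
    then show ?thesis using c(3) by (simp add: mult_ac)
  next
    case 2
    have "b powr (p - 1) * b = b powr p" using b by (simp add: powr_diff)
    then have "b powr p + p * b powr (p - 1) * (a - b) = (1 - p) * b powr p"
      using 2 by (simp add: left_diff_distrib mult.assoc)
    also have "\<dots> < 0" using p b by (simp add: mult_neg_pos)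
    finally show ?thesis using 2 by simp
  next
    case 3
    obtain c where c: "a < c" "c < b" "b powr p - a powr p = (b - a) * (p * c powr (p - 1))"
      using MVT2[OF 3(2), of "\<lambda>x. x powr p" "\<lambda>x. p * x powr (p - 1)"] der 3 by force
    have "c powr (p - 1) < b powr (p - 1)" using c 3 p by (intro powr_less_mono2) auto
    then have "(b - a) * (p * c powr (p - 1)) < (b - a) * (p * b powr (p - 1))"
      using 3 p by (intro mult_strict_left_mono) auto
    then show ?thesis using c(3) by (simp add: algebra_simps)
  qed
qed

text \<open>The tangent of t^p at the norm of the convex combination m, together with the triangle
  inequality, gives convexity. Without strictness all three norms agree, and expanding the square of
  m leaves \<theta> (1 - \<theta>) |\<xi> - \<eta>|^2 = 0.\<close>

lemma norm_powr_strictly_convex: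
  fixes \<xi> \<eta> :: "'a::real_inner"
  assumes p: "p > 1" and \<theta>: "0 < \<theta>" "\<theta> < 1" and ne: "\<xi> \<noteq> \<eta>"
  shows "norm (\<theta> *\<^sub>R \<xi> + (1 - \<theta>) *\<^sub>R \<eta>) powr p < \<theta> * norm \<xi> powr p + (1 - \<theta>) * norm \<eta> powr p"
proof -
  define m where "m = \<theta> *\<^sub>R \<xi> + (1 - \<theta>) *\<^sub>R \<eta>"
  have le: "norm m \<le> \<theta> * norm \<xi> + (1 - \<theta>) * norm \<eta>"
    unfolding m_def using norm_triangle_ineq[of "\<theta> *\<^sub>R \<xi>" "(1 - \<theta>) *\<^sub>R \<eta>"] \<theta> by simp
  have "norm m powr p < \<theta> * norm \<xi> powr p + (1 - \<theta>) * norm \<eta> powr p"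
  proof (cases "m = 0")
    case True
    have "\<xi> \<noteq> 0 \<or> \<eta> \<noteq> 0" using ne by auto
    then show ?thesis
    proof
      assume "\<xi> \<noteq> 0"
      then have "\<theta> * norm \<xi> powr p > 0" using \<theta> by simp
      moreover have "(1 - \<theta>) * norm \<eta> powr p \<ge> 0" using \<theta> by simp
      ultimately show ?thesis using True by simp
    next
      assume "\<eta> \<noteq> 0"
      then have "(1 - \<theta>) * norm \<eta> powr p > 0" using \<theta> by simp
      moreover have "\<theta> * norm \<xi> powr p \<ge> 0" using \<theta> by simp
      ultimately show ?thesis using True by simp
    qed
  next
    case False
    let ?b = "norm m"
    have b: "?b > 0" using False by simp
    define k where "k = p * ?b powr (p - 1)"
    have k: "k > 0" using p b by (simp add: k_def)
    have tan: "?b powr p + k * (norm x - ?b) \<le> norm x powr p" for x :: 'a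
      using powr_gt_tangent[OF p norm_ge_zero b, of x] by (cases "norm x = ?b") (auto simp: k_def)
    have base: "?b powr p \<le> \<theta> * (?b powr p + k * (norm \<xi> - ?b)) + (1 - \<theta>) * (?b powr p + k * (norm \<eta> - ?b))"
      using mult_left_mono[OF le, of k] k by (simp add: algebra_simps)
    have "norm \<xi> \<noteq> ?b \<or> norm \<eta> \<noteq> ?b"
    proof (rule ccontr)
      assume "\<not> (norm \<xi> \<noteq> ?b \<or> norm \<eta> \<noteq> ?b)"
      then have eq: "\<xi> \<bullet> \<xi> = m \<bullet> m" "\<eta> \<bullet> \<eta> = m \<bullet> m"
        by (simp_all add: dot_square_norm)
      have "m \<bullet> m = \<theta> * (\<xi> \<bullet> \<xi>) + (1 - \<theta>) * (\<eta> \<bullet> \<eta>) - \<theta> * (1 - \<theta>) * ((\<xi> - \<eta>) \<bullet> (\<xi> - \<eta>))"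
        unfolding m_def by (simp add: inner_add_left inner_add_right inner_diff_left inner_diff_right inner_commute algebra_simps)
      then have "\<theta> * (1 - \<theta>) * ((\<xi> - \<eta>) \<bullet> (\<xi> - \<eta>)) = 0" unfolding eq by (simp add: algebra_simps)
      then show False using ne \<theta> by simp
    qed
    then show ?thesis
    proof
      assume "norm \<xi> \<noteq> ?b"
      then have "\<theta> * (?b powr p + k * (norm \<xi> - ?b)) < \<theta> * norm \<xi> powr p"
        using powr_gt_tangent[OF p norm_ge_zero b, of \<xi>] \<theta> by (intro mult_strict_left_mono) (auto simp: k_def)
      moreover have "(1 - \<theta>) * (?b powr p + k * (norm \<eta> - ?b)) \<le> (1 - \<theta>) * norm \<eta> powr p"
        using tan[of \<eta>] \<theta> by (intro mult_left_mono) auto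
      ultimately show ?thesis using base by linarith
    next
      assume "norm \<eta> \<noteq> ?b"
      then have "(1 - \<theta>) * (?b powr p + k * (norm \<eta> - ?b)) < (1 - \<theta>) * norm \<eta> powr p"
        using powr_gt_tangent[OF p norm_ge_zero b, of \<eta>] \<theta> by (intro mult_strict_left_mono) (auto simp: k_def)
      moreover have "\<theta> * (?b powr p + k * (norm \<xi> - ?b)) \<le> \<theta> * norm \<xi> powr p"
        using tan[of \<xi>] \<theta> by (intro mult_left_mono) auto
      ultimately show ?thesis using base by linarith
    qed
  qed
  then show ?thesis by (simp only: m_def)
qed

lemma psum_coeff_0 [simp]: "psum_coeff p 0 t = 0"
  by (simp add: psum_coeff_def)

text \<open>Because (1/p - 1) p = -(p - 1), what remains is the share of |s|^p in the sum, raised to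
  p - 1. The logarithmic estimate measures how far this is below 1.\<close>

lemma abs_psum_coeff_powr:
  assumes p: "p > 1" and st: "\<bar>s\<bar> powr p + \<bar>t\<bar> powr p > 0"
  shows "\<bar>psum_coeff p s t\<bar> powr p = (\<bar>s\<bar> powr p / (\<bar>s\<bar> powr p + \<bar>t\<bar> powr p)) powr (p - 1)"
proof (cases "s = 0")
  case False
  let ?N = "\<bar>s\<bar> powr p + \<bar>t\<bar> powr p"
  have "\<bar>s\<bar> powr (p - 2) * \<bar>s\<bar> = \<bar>s\<bar> powr (p - 1)"
    using False powr_add[of "\<bar>s\<bar>" "p - 2" 1] by simp
  then have "\<bar>psum_coeff p s t\<bar> = ?N powr (1 / p - 1) * \<bar>s\<bar> powr (p - 1)"
    by (simp add: psum_coeff_def abs_mult mult.assoc)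
  then have "\<bar>psum_coeff p s t\<bar> powr p = ?N powr ((1 / p - 1) * p) * \<bar>s\<bar> powr ((p - 1) * p)"
    by (simp add: powr_mult powr_powr)
  also have "(1 / p - 1) * p = - (p - 1)" using p by (simp add: left_diff_distrib)
  also have "\<bar>s\<bar> powr ((p - 1) * p) = (\<bar>s\<bar> powr p) powr (p - 1)" by (simp add: powr_powr mult.commute)
  finally have "\<bar>psum_coeff p s t\<bar> powr p = ?N powr (- (p - 1)) * (\<bar>s\<bar> powr p) powr (p - 1)" .
  also have "\<dots> = (\<bar>s\<bar> powr p) powr (p - 1) / ?N powr (p - 1)"
    by (simp only: powr_minus_divide times_divide_eq_left mult_1_left)
  also have "\<dots> = (\<bar>s\<bar> powr p / ?N) powr (p - 1)"
    by (rule powr_divide[symmetric])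
  finally show ?thesis .
qed simp

text \<open>The logarithmic gradient of a p-sum is the convex combination of X/s and Y/t with
  weights |s|^p/N and |t|^p/N. Multiplying by N, the p-th power of the p-sum, turns convexity into
  subadditivity.\<close>

lemma psum_gradient_convex_combination:
  fixes X Y :: "'a::real_inner"
  assumes p: "p > 1" and s: "s \<noteq> 0" and t: "t \<noteq> 0"
  defines "N \<equiv> \<bar>s\<bar> powr p + \<bar>t\<bar> powr p"
  shows "norm (psum_coeff p s t *\<^sub>R X + psum_coeff p t s *\<^sub>R Y) powr p =
    N * norm ((\<bar>s\<bar> powr p / N) *\<^sub>R ((1 / s) *\<^sub>R X) + (1 - \<bar>s\<bar> powr p / N) *\<^sub>R ((1 / t) *\<^sub>R Y)) powr p"
    and "N * (\<bar>s\<bar> powr p / N * norm ((1 / s) *\<^sub>R X) powr p + (1 - \<bar>s\<bar> powr p / N) * norm ((1 / t) *\<^sub>R Y) powr p) =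
      norm X powr p + norm Y powr p"
    and "0 < \<bar>s\<bar> powr p / N" "\<bar>s\<bar> powr p / N < 1"
proof -
  have st: "\<bar>s\<bar> powr p > 0" "\<bar>t\<bar> powr p > 0" using s t by simp_all
  then have N: "N > 0" unfolding N_def by (rule add_pos_pos)
  show "0 < \<bar>s\<bar> powr p / N" "\<bar>s\<bar> powr p / N < 1" using st N by (simp_all add: N_def)
  have t': "1 - \<bar>s\<bar> powr p / N = \<bar>t\<bar> powr p / N"
    using N by (simp add: field_simps) (simp add: N_def)
  have c: "\<bar>x\<bar> powr (p - 2) * x = \<bar>x\<bar> powr p * (1 / x)" if "x \<noteq> 0" for x :: real
  proof -
    have "\<bar>x\<bar> powr p = \<bar>x\<bar> powr (p - 2) * \<bar>x\<bar> powr 2"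
      using powr_add[of "\<bar>x\<bar>" "p - 2" 2] by simp
    also have "\<bar>x\<bar> powr 2 = x * x" by (simp add: powr_numeral power2_eq_square)
    finally show ?thesis using that by simp
  qed
  have Np: "N powr (1 / p - 1) = N powr (1 / p) * (1 / N)"
    using N by (simp add: powr_diff)
  have 1: "psum_coeff p s t = N powr (1 / p) * (\<bar>s\<bar> powr p / N * (1 / s))"
    unfolding psum_coeff_def N_def[symmetric] mult.assoc c[OF s] Np by simp
  have 2: "psum_coeff p t s = N powr (1 / p) * (\<bar>t\<bar> powr p / N * (1 / t))"
    unfolding psum_coeff_def add.commute[of "\<bar>t\<bar> powr p"] N_def[symmetric] mult.assoc c[OF t] Np by simp
  have "psum_coeff p s t *\<^sub>R X + psum_coeff p t s *\<^sub>R Y = N powr (1 / p) *\<^sub>R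
      ((\<bar>s\<bar> powr p / N) *\<^sub>R ((1 / s) *\<^sub>R X) + (1 - \<bar>s\<bar> powr p / N) *\<^sub>R ((1 / t) *\<^sub>R Y))"
    unfolding 1 2 t' by (simp add: scaleR_right_distrib)
  then show "norm (psum_coeff p s t *\<^sub>R X + psum_coeff p t s *\<^sub>R Y) powr p =
    N * norm ((\<bar>s\<bar> powr p / N) *\<^sub>R ((1 / s) *\<^sub>R X) + (1 - \<bar>s\<bar> powr p / N) *\<^sub>R ((1 / t) *\<^sub>R Y)) powr p"
    using N p by (simp add: powr_mult powr_powr)
  have d: "\<bar>x\<bar> powr p * norm ((1 / x) *\<^sub>R Z) powr p = norm Z powr p" if "x \<noteq> 0" for x and Z :: 'a
    using that by (simp add: powr_mult[symmetric] del: powr_mult)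
  show "N * (\<bar>s\<bar> powr p / N * norm ((1 / s) *\<^sub>R X) powr p + (1 - \<bar>s\<bar> powr p / N) * norm ((1 / t) *\<^sub>R Y) powr p) =
      norm X powr p + norm Y powr p"
    unfolding t' using N d[OF s, of X] d[OF t, of Y] by (simp add: distrib_left del: norm_scaleR)
qed

text \<open>Convexity covers the points where neither function vanishes. If s = 0, the coefficient
  of X is 0 and that of Y is at most 1 in absolute value; t = 0 is symmetric.\<close>

lemma norm_psum_gradient_le:
  fixes X Y :: "'a::real_inner"
  assumes p: "p > 1"
  shows "norm (psum_coeff p s t *\<^sub>R X + psum_coeff p t s *\<^sub>R Y) powr p \<le> norm X powr p + norm Y powr p"
proof -
  have one: "norm (psum_coeff p r 0 *\<^sub>R Z) powr p \<le> norm Z powr p" for r and Z :: 'a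
  proof (cases "r = 0")
    case False
    then have "\<bar>psum_coeff p r 0\<bar> powr p = 1"
      using abs_psum_coeff_powr[OF p, of r 0] by simp
    then show ?thesis by (simp add: powr_mult)
  qed simp
  consider "s = 0" | "t = 0" | "s \<noteq> 0" "t \<noteq> 0" by blast
  then show ?thesis
  proof cases
    case 1
    then show ?thesis using one[of t Y] by (simp add: add_increasing)
  next
    case 2
    then show ?thesis using one[of s X] by (simp add: add_increasing2)
  next
    case 3
    note c = psum_gradient_convex_combination(1,2)[OF p 3, of X Y] psum_gradient_convex_combination(3,4)[OF p 3]
    let ?N = "\<bar>s\<bar> powr p + \<bar>t\<bar> powr p"
    let ?\<theta> = "\<bar>s\<bar> powr p / ?N"
    let ?\<xi> = "(1 / s) *\<^sub>R X" and ?\<eta> = "(1 / t) *\<^sub>R Y"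
    have "norm (?\<theta> *\<^sub>R ?\<xi> + (1 - ?\<theta>) *\<^sub>R ?\<eta>) powr p \<le> ?\<theta> * norm ?\<xi> powr p + (1 - ?\<theta>) * norm ?\<eta> powr p"
    proof (cases "?\<xi> = ?\<eta>")
      case True
      have "?\<theta> *\<^sub>R ?\<eta> + (1 - ?\<theta>) *\<^sub>R ?\<eta> = ?\<eta>"
        unfolding scaleR_left_distrib[symmetric] by simp
      then show ?thesis unfolding True by (simp add: algebra_simps del: norm_scaleR scaleR_scaleR)
    next
      case False
      then show ?thesis using norm_powr_strictly_convex[OF p c(3,4)] less_imp_le by blast
    qed
    then have "?N * norm (?\<theta> *\<^sub>R ?\<xi> + (1 - ?\<theta>) *\<^sub>R ?\<eta>) powr p \<le>
        ?N * (?\<theta> * norm ?\<xi> powr p + (1 - ?\<theta>) * norm ?\<eta> powr p)"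
      by (rule mult_left_mono) simp
    then show ?thesis unfolding c(1) c(2) .
  qed
qed

lemma norm_psum_gradient_eq_imp:
  fixes X Y :: "'a::real_inner"
  assumes p: "p > 1" and st: "s \<noteq> 0" "t \<noteq> 0"
    and eq: "norm (psum_coeff p s t *\<^sub>R X + psum_coeff p t s *\<^sub>R Y) powr p = norm X powr p + norm Y powr p"
  shows "(1 / s) *\<^sub>R X = (1 / t) *\<^sub>R Y"
proof (rule ccontr)
  note c = psum_gradient_convex_combination(1,2)[OF p st, of X Y] psum_gradient_convex_combination(3,4)[OF p st]
  assume "(1 / s) *\<^sub>R X \<noteq> (1 / t) *\<^sub>R Y"
  note norm_powr_strictly_convex[OF p c(3,4) this]
  moreover have "\<bar>s\<bar> powr p + \<bar>t\<bar> powr p > 0" using st by (simp add: add_pos_pos)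
  ultimately show False
    using eq unfolding c(1) c(2)[symmetric] by simp
qed

section \<open>Minimizing pairs\<close>

lemma powr_mult_powr_le:
  fixes a b :: real
  assumes "0 \<le> \<theta>" "\<theta> \<le> 1" "a \<ge> 0" "b \<ge> 0"
  shows "a powr \<theta> * b powr (1 - \<theta>) \<le> \<theta> * a + (1 - \<theta>) * b"
proof (cases "a = 0 \<or> b = 0")
  case False
  then show ?thesis using assms by (intro Youngs_inequality_0) auto
qed (use assms in auto)

text \<open>Concavity plus homogeneity of degree 1. Concretely, Young's inequality is applied to the
  shares of each pair in the totals, and the weighted shares add up to 1.\<close>

lemma powr_mult_powr_superadditive:
  fixes a1 a2 b1 b2 :: real
  assumes \<theta>: "0 \<le> \<theta>" "\<theta> \<le> 1" and nn: "a1 \<ge> 0" "a2 \<ge> 0" "b1 \<ge> 0" "b2 \<ge> 0"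
  shows "a1 powr \<theta> * b1 powr (1 - \<theta>) + a2 powr \<theta> * b2 powr (1 - \<theta>) \<le> (a1 + a2) powr \<theta> * (b1 + b2) powr (1 - \<theta>)"
proof (cases "a1 + a2 = 0 \<or> b1 + b2 = 0")
  case True
  then have "(a1 = 0 \<and> a2 = 0) \<or> (b1 = 0 \<and> b2 = 0)" using nn by linarith
  then show ?thesis by auto
next
  case False
  let ?A = "a1 + a2" and ?B = "b1 + b2"
  have AB: "?A > 0" "?B > 0" using False nn by linarith+
  let ?P = "?A powr \<theta> * ?B powr (1 - \<theta>)"
  have P: "?P \<ge> 0" by simp
  have *: "a powr \<theta> * b powr (1 - \<theta>) \<le> ?P * (\<theta> * (a / ?A) + (1 - \<theta>) * (b / ?B))" if "a \<ge> 0" "b \<ge> 0" for a b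
  proof -
    have "a powr \<theta> * b powr (1 - \<theta>) = ?P * ((a / ?A) powr \<theta> * (b / ?B) powr (1 - \<theta>))"
      using AB that by (simp add: powr_divide)
    also have "\<dots> \<le> ?P * (\<theta> * (a / ?A) + (1 - \<theta>) * (b / ?B))"
      using \<theta> AB that by (intro mult_left_mono powr_mult_powr_le) auto
    finally show ?thesis .
  qed
  have "\<theta> * (a1 / ?A) + (1 - \<theta>) * (b1 / ?B) + (\<theta> * (a2 / ?A) + (1 - \<theta>) * (b2 / ?B)) =
      \<theta> * ((a1 + a2) / ?A) + (1 - \<theta>) * ((b1 + b2) / ?B)"
    by (simp only: add_divide_distrib distrib_left add_ac)
  also have "\<dots> = 1" using AB by simp
  finally have "?P * (\<theta> * (a1 / ?A) + (1 - \<theta>) * (b1 / ?B)) + ?P * (\<theta> * (a2 / ?A) + (1 - \<theta>) * (b2 / ?B)) = ?P"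
    by (simp only: distrib_left[symmetric] mult_1_right)
  then show ?thesis using *[OF nn(1,3)] *[OF nn(2,4)] by linarith
qed

text \<open>Depends on the moduli only and grows with them, as comparison with p-sums requires; the
  signed coupling need not do either.\<close>

definition abs_coupling ::
    "'a::euclidean_space set \<Rightarrow> real \<Rightarrow> real \<Rightarrow> ('a \<Rightarrow> real) \<Rightarrow> ('a \<Rightarrow> real) \<Rightarrow> real" where
  "abs_coupling \<Omega> \<alpha> \<beta> u v = (LINT x|lebesgue_on \<Omega>. \<bar>u x\<bar> powr \<alpha> * \<bar>v x\<bar> powr \<beta>)"

definition dirichlet :: "'a::euclidean_space set \<Rightarrow> real \<Rightarrow> ('a \<Rightarrow> real) \<Rightarrow> real" where
  "dirichlet \<Omega> p u = (LINT x|lebesgue_on \<Omega>. norm (weak_grad \<Omega> u x) powr p)"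

lemma energy_eq: "energy \<Omega> p q \<alpha> \<beta> u v = \<alpha> / p * dirichlet \<Omega> p u + \<beta> / q * dirichlet \<Omega> q v"
  by (simp add: energy_def dirichlet_def)

lemma dirichlet_nonneg: "dirichlet \<Omega> p u \<ge> 0"
  unfolding dirichlet_def by (rule Bochner_Integration.integral_nonneg) simp

lemma rpow_mult_self:
  assumes "a > 0"
  shows "rpow \<bar>s\<bar> (a - 1) * s = sgn s * \<bar>s\<bar> powr a"
proof (cases "s = 0")
  case False
  have "rpow \<bar>s\<bar> (a - 1) = \<bar>s\<bar> powr (a - 1)" using False by (simp add: rpow_def)
  moreover have "\<bar>s\<bar> powr (a - 1) * \<bar>s\<bar> = \<bar>s\<bar> powr a"
    using False powr_add[of "\<bar>s\<bar>" "a - 1" 1] by simp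
  moreover have "s = sgn s * \<bar>s\<bar>" by (rule sgn_mult_abs[symmetric])
  ultimately show ?thesis by (metis mult.left_commute)
qed simp

definition minimizing_pair ::
    "'a::euclidean_space set \<Rightarrow> real \<Rightarrow> real \<Rightarrow> real \<Rightarrow> real \<Rightarrow> real \<Rightarrow> ('a \<Rightarrow> real) \<Rightarrow> ('a \<Rightarrow> real) \<Rightarrow> bool" where
  "minimizing_pair \<Omega> p q \<alpha> \<beta> \<mu> u v \<longleftrightarrow> u \<in> W1p_0 p \<Omega> \<and> v \<in> W1p_0 q \<Omega> \<and> \<mu> \<ge> 0 \<and>
     energy \<Omega> p q \<alpha> \<beta> u v = \<mu> * abs_coupling \<Omega> \<alpha> \<beta> u v \<and>
     (\<forall>U\<in>W1p_0 p \<Omega>. \<forall>V\<in>W1p_0 q \<Omega>. \<mu> * abs_coupling \<Omega> \<alpha> \<beta> U V \<le> energy \<Omega> p q \<alpha> \<beta> U V)"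

lemma abs_coupling_commute: "abs_coupling \<Omega> \<alpha> \<beta> u v = abs_coupling \<Omega> \<beta> \<alpha> v u"
  by (simp add: abs_coupling_def mult.commute)

lemma energy_commute: "energy \<Omega> p q \<alpha> \<beta> u v = energy \<Omega> q p \<beta> \<alpha> v u"
  by (simp add: energy_def)

lemma minimizing_pair_swap: "minimizing_pair \<Omega> p q \<alpha> \<beta> \<mu> u v \<Longrightarrow> minimizing_pair \<Omega> q p \<beta> \<alpha> \<mu> v u"
  unfolding minimizing_pair_def abs_coupling_commute[of \<Omega> \<beta>] energy_commute[of \<Omega> q] by blast

context bounded_domain
begin

lemma dirichlet_integrable:
  assumes "u \<in> W1p_0 p \<Omega>"
  shows "integrable M (\<lambda>x. norm (\<nabla> u x) powr p)"
  using W1pD(2)[OF assms] by (simp add: in_Lp_def)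

lemma dirichlet_cong_AE:
  assumes u: "u \<in> W1p_0 p \<Omega>" and eq: "AE x in M. \<nabla> u x = G x"
  shows "dirichlet \<Omega> p u = (LINT x|M. norm (G x) powr p)"
    and "integrable M (\<lambda>x. norm (G x) powr p)"
proof -
  have "in_Lp p \<Omega> G" by (rule in_Lp_AE_eq[OF W1pD(2)[OF u] eq])
  then show i: "integrable M (\<lambda>x. norm (G x) powr p)" by (simp add: in_Lp_def)
  show "dirichlet \<Omega> p u = (LINT x|M. norm (G x) powr p)"
    unfolding dirichlet_def
  proof (rule integral_cong_AE)
    show "AE x in M. norm (\<nabla> u x) powr p = norm (G x) powr p"
      using eq by eventually_elim simp
  qed (use i dirichlet_integrable[OF u] in auto)
qed

lemma dirichlet_test_function:
  assumes "p > 1" "test_function \<Omega> f"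
  shows "dirichlet \<Omega> p f = (LINT x|M. norm (grad f x) powr p)"
  using dirichlet_cong_AE(1)[OF test_function_in_W1p_0[OF assms]] .

lemma dirichlet_cmult:
  assumes p: "p > 1" and u: "u \<in> W1p_0 p \<Omega>"
  shows "dirichlet \<Omega> p (\<lambda>x. c * u x) = \<bar>c\<bar> powr p * dirichlet \<Omega> p u"
  unfolding dirichlet_cong_AE(1)[OF W1p_0_cmult[OF p u]] by (simp add: powr_mult dirichlet_def)

lemma grad_zero [simp]: "grad (\<lambda>x::'a. 0 :: real) x = 0"
  by (rule grad_eqI) simp

lemma zero_in_W1p_0: "p > 1 \<Longrightarrow> (\<lambda>x. 0) \<in> W1p_0 p \<Omega>"
  by (rule test_function_in_W1p_0(1)[OF _ test_function_0])

lemma AE_weak_grad_zero: "AE x in M. \<nabla> (\<lambda>x. 0) x = 0"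
  using test_function_in_W1p_0(2)[OF _ test_function_0, of 2] by simp

lemma dirichlet_psum_le:
  assumes p: "p > 1" and u: "u \<in> W1p_0 p \<Omega>" and v: "v \<in> W1p_0 p \<Omega>"
  shows "dirichlet \<Omega> p (\<lambda>x. psum p (u x) (v x)) \<le> dirichlet \<Omega> p u + dirichlet \<Omega> p v"
proof -
  have "dirichlet \<Omega> p (\<lambda>x. psum p (u x) (v x)) \<le>
      (LINT x|M. norm (\<nabla> u x) powr p + norm (\<nabla> v x) powr p)"
    unfolding dirichlet_cong_AE(1)[OF W1p_0_psum[OF p u v]]
    by (intro integral_mono dirichlet_cong_AE(2)[OF W1p_0_psum[OF p u v]] norm_psum_gradient_le[OF p]
        Bochner_Integration.integrable_add dirichlet_integrable u v)
  also have "\<dots> = dirichlet \<Omega> p u + dirichlet \<Omega> p v"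
    unfolding dirichlet_def by (intro Bochner_Integration.integral_add dirichlet_integrable u v)
  finally show ?thesis .
qed

text \<open>The defect in the pointwise inequality is nonnegative, and equality of the energies
  makes its integral 0.\<close>

lemma AE_psum_gradient_eq:
  assumes p: "p > 1" and u: "u \<in> W1p_0 p \<Omega>" and v: "v \<in> W1p_0 p \<Omega>"
    and eq: "dirichlet \<Omega> p (\<lambda>x. psum p (u x) (v x)) = dirichlet \<Omega> p u + dirichlet \<Omega> p v"
  shows "AE x in M. norm (psum_coeff p (u x) (v x) *\<^sub>R \<nabla> u x +
    psum_coeff p (v x) (u x) *\<^sub>R \<nabla> v x) powr p = norm (\<nabla> u x) powr p + norm (\<nabla> v x) powr p"
proof -
  let ?G = "\<lambda>x. psum_coeff p (u x) (v x) *\<^sub>R \<nabla> u x + psum_coeff p (v x) (u x) *\<^sub>R \<nabla> v x"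
  note G = dirichlet_cong_AE[OF W1p_0_psum[OF p u v]]
  let ?g = "\<lambda>x. norm (\<nabla> u x) powr p + norm (\<nabla> v x) powr p - norm (?G x) powr p"
  have int: "integrable M ?g"
    by (intro Bochner_Integration.integrable_diff Bochner_Integration.integrable_add dirichlet_integrable u v G(2))
  have "(LINT x|M. ?g x) = dirichlet \<Omega> p u + dirichlet \<Omega> p v - dirichlet \<Omega> p (\<lambda>x. psum p (u x) (v x))"
    unfolding G(1) using dirichlet_integrable[OF u] dirichlet_integrable[OF v] G(2)
    by (simp add: dirichlet_def)
  then have "(LINT x|M. ?g x) = 0" using eq by simp
  moreover have "AE x in M. 0 \<le> ?g x"
    using norm_psum_gradient_le[OF p] by (intro AE_I2) simp
  ultimately have "AE x in M. ?g x = 0"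
    using integral_nonneg_eq_0_iff_AE[OF int] by blast
  then show ?thesis by eventually_elim simp
qed

end

section \<open>The coupling, the infimum and the eigenfunctions\<close>

locale exponents = connected_domain +
  fixes p q \<alpha> \<beta> :: real
  assumes p: "p > 1" and q: "q > 1" and \<alpha>: "\<alpha> > 0" and \<beta>: "\<beta> > 0"
    and sum_1: "\<alpha> / p + \<beta> / q = 1"
begin

lemma exponent_bounds: "0 \<le> \<alpha> / p" "\<alpha> / p \<le> 1"
proof -
  have "\<beta> / q \<ge> 0" using \<beta> q by simp
  then show "\<alpha> / p \<le> 1" using sum_1 by linarith
  show "0 \<le> \<alpha> / p" using \<alpha> p by simp
qed

text \<open>As \<beta>/q = 1 - \<alpha>/p, the integrand is a weighted geometric mean of |s|^p and
  |t|^q, and Young's inequality bounds it by the arithmetic one.\<close>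

lemma coupling_integrand_bound:
  "\<bar>s\<bar> powr \<alpha> * \<bar>t\<bar> powr \<beta> \<le> \<alpha> / p * \<bar>s\<bar> powr p + \<beta> / q * \<bar>t\<bar> powr q"
  and coupling_integrand_eq:
  "\<bar>s\<bar> powr \<alpha> * \<bar>t\<bar> powr \<beta> = (\<bar>s\<bar> powr p) powr (\<alpha> / p) * (\<bar>t\<bar> powr q) powr (1 - \<alpha> / p)"
proof -
  have b: "1 - \<alpha> / p = \<beta> / q" using sum_1 by simp
  show eq: "\<bar>s\<bar> powr \<alpha> * \<bar>t\<bar> powr \<beta> = (\<bar>s\<bar> powr p) powr (\<alpha> / p) * (\<bar>t\<bar> powr q) powr (1 - \<alpha> / p)"
    unfolding b using p q by (simp add: powr_powr)
  from powr_mult_powr_le[OF exponent_bounds, of "\<bar>s\<bar> powr p" "\<bar>t\<bar> powr q"]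
  show "\<bar>s\<bar> powr \<alpha> * \<bar>t\<bar> powr \<beta> \<le> \<alpha> / p * \<bar>s\<bar> powr p + \<beta> / q * \<bar>t\<bar> powr q"
    unfolding eq unfolding b by simp
qed

lemma coupling_integrable:
  assumes u: "u \<in> W1p_0 p \<Omega>" and v: "v \<in> W1p_0 q \<Omega>"
  shows "integrable M (\<lambda>x. \<bar>u x\<bar> powr \<alpha> * \<bar>v x\<bar> powr \<beta>)"
proof (rule Bochner_Integration.integrable_bound)
  show "integrable M (\<lambda>x. \<alpha> / p * \<bar>u x\<bar> powr p + \<beta> / q * \<bar>v x\<bar> powr q)"
    using W1pD(1)[OF u] W1pD(1)[OF v] by (simp add: in_Lp_def)
  have [measurable]: "u \<in> borel_measurable M" "v \<in> borel_measurable M"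
    using W1pD(1)[OF u] W1pD(1)[OF v] by (auto simp: in_Lp_def)
  show "(\<lambda>x. \<bar>u x\<bar> powr \<alpha> * \<bar>v x\<bar> powr \<beta>) \<in> borel_measurable M" by measurable
  have "norm (\<bar>u x\<bar> powr \<alpha> * \<bar>v x\<bar> powr \<beta>) \<le> norm (\<alpha> / p * \<bar>u x\<bar> powr p + \<beta> / q * \<bar>v x\<bar> powr q)" for x
    using coupling_integrand_bound[of "u x" "v x"] by simp
  then show "AE x in M. norm (\<bar>u x\<bar> powr \<alpha> * \<bar>v x\<bar> powr \<beta>) \<le> norm (\<alpha> / p * \<bar>u x\<bar> powr p + \<beta> / q * \<bar>v x\<bar> powr q)"
    by simp
qed

lemma abs_coupling_nonneg: "abs_coupling \<Omega> \<alpha> \<beta> u v \<ge> 0"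
  unfolding abs_coupling_def by (rule Bochner_Integration.integral_nonneg) simp

lemma energy_nonneg: "energy \<Omega> p q \<alpha> \<beta> u v \<ge> 0"
  unfolding energy_eq using p q \<alpha> \<beta> by (simp add: dirichlet_nonneg)

lemma coupling_integrand:
  "rpow \<bar>s\<bar> (\<alpha> - 1) * rpow \<bar>t\<bar> (\<beta> - 1) * s * t = sgn s * sgn t * (\<bar>s\<bar> powr \<alpha> * \<bar>t\<bar> powr \<beta>)"
proof -
  have "rpow \<bar>s\<bar> (\<alpha> - 1) * rpow \<bar>t\<bar> (\<beta> - 1) * s * t = (rpow \<bar>s\<bar> (\<alpha> - 1) * s) * (rpow \<bar>t\<bar> (\<beta> - 1) * t)"
    by (simp only: mult_ac)
  then show ?thesis unfolding rpow_mult_self[OF \<alpha>] rpow_mult_self[OF \<beta>] by (simp only: mult_ac)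
qed

lemma coupling_eq_abs_coupling:
  assumes "\<And>x. u x \<ge> 0" "\<And>x. v x \<ge> 0"
  shows "coupling \<Omega> \<alpha> \<beta> u v = abs_coupling \<Omega> \<alpha> \<beta> u v"
  unfolding coupling_def abs_coupling_def coupling_integrand
proof (rule Bochner_Integration.integral_cong)
  fix x
  show "sgn (u x) * sgn (v x) * (\<bar>u x\<bar> powr \<alpha> * \<bar>v x\<bar> powr \<beta>) = \<bar>u x\<bar> powr \<alpha> * \<bar>v x\<bar> powr \<beta>"
    using assms(1)[of x] assms(2)[of x] by (cases "u x = 0 \<or> v x = 0") (auto simp: sgn_if)
qed simp

lemma coupling_le_abs_coupling:
  assumes u: "u \<in> W1p_0 p \<Omega>" and v: "v \<in> W1p_0 q \<Omega>"
  shows "\<bar>coupling \<Omega> \<alpha> \<beta> u v\<bar> \<le> abs_coupling \<Omega> \<alpha> \<beta> u v"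
proof -
  have "\<bar>coupling \<Omega> \<alpha> \<beta> u v\<bar> \<le> (LINT x|M. \<bar>sgn (u x) * sgn (v x) * (\<bar>u x\<bar> powr \<alpha> * \<bar>v x\<bar> powr \<beta>)\<bar>)"
    unfolding coupling_def coupling_integrand by (rule integral_abs_bound)
  also have "\<dots> \<le> abs_coupling \<Omega> \<alpha> \<beta> u v"
    unfolding abs_coupling_def
  proof (rule integral_mono'[OF coupling_integrable[OF u v]])
    fix x
    have "\<bar>sgn (u x) * sgn (v x)\<bar> \<le> 1" by (simp add: abs_mult abs_sgn_eq)
    then have "\<bar>sgn (u x) * sgn (v x)\<bar> * (\<bar>u x\<bar> powr \<alpha> * \<bar>v x\<bar> powr \<beta>) \<le> 1 * (\<bar>u x\<bar> powr \<alpha> * \<bar>v x\<bar> powr \<beta>)"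
      by (rule mult_right_mono) simp
    then show "\<bar>sgn (u x) * sgn (v x) * (\<bar>u x\<bar> powr \<alpha> * \<bar>v x\<bar> powr \<beta>)\<bar> \<le> \<bar>u x\<bar> powr \<alpha> * \<bar>v x\<bar> powr \<beta>"
      by (simp add: abs_mult)
  qed simp
  finally show ?thesis .
qed

lemma abs_coupling_cmult:
  "abs_coupling \<Omega> \<alpha> \<beta> (\<lambda>x. c * u x) (\<lambda>x. d * v x) = \<bar>c\<bar> powr \<alpha> * \<bar>d\<bar> powr \<beta> * abs_coupling \<Omega> \<alpha> \<beta> u v"
proof -
  have "\<bar>c * u x\<bar> powr \<alpha> * \<bar>d * v x\<bar> powr \<beta> = \<bar>c\<bar> powr \<alpha> * \<bar>d\<bar> powr \<beta> * (\<bar>u x\<bar> powr \<alpha> * \<bar>v x\<bar> powr \<beta>)" for x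
    by (simp add: abs_mult powr_mult mult_ac)
  then show ?thesis by (simp only: abs_coupling_def integral_mult_right_zero)
qed

lemma psum_0: "r > 1 \<Longrightarrow> psum r s 0 = \<bar>s\<bar>"
  by (simp add: psum_def powr_powr)

text \<open>Dividing the components by the \<open>p\<close>-th and the \<open>q\<close>-th root of the coupling makes the pair
  admissible, because \<open>\<alpha> / p + \<beta> / q = 1\<close>.\<close>

lemma lambda1_properties:
  assumes U: "U \<in> W1p_0 p \<Omega>" and V: "V \<in> W1p_0 q \<Omega>"
    and K: "abs_coupling \<Omega> \<alpha> \<beta> U V > 0"
  shows "lambda1 \<Omega> p q \<alpha> \<beta> * abs_coupling \<Omega> \<alpha> \<beta> U V \<le> energy \<Omega> p q \<alpha> \<beta> U V"
    and "lambda1 \<Omega> p q \<alpha> \<beta> \<ge> 0"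
proof -
  let ?S = "{energy \<Omega> p q \<alpha> \<beta> u v | u v.
            u \<in> W1p_0 p \<Omega> \<and> v \<in> W1p_0 q \<Omega> \<and> coupling \<Omega> \<alpha> \<beta> u v = 1}"
  define K where "K = abs_coupling \<Omega> \<alpha> \<beta> U V"
  have K0: "K > 0" using K by (simp add: K_def)
  \<comment> \<open>The p-sum with 0 is the absolute value. Passing to moduli does not raise the
    energy, and it makes the signed coupling of the constraint equal to the absolute one.\<close>
  define U' V' where "U' x = psum p (U x) 0" and "V' x = psum q (V x) 0" for x
  have W: "U' \<in> W1p_0 p \<Omega>" "V' \<in> W1p_0 q \<Omega>"
    unfolding U'_def[abs_def] V'_def[abs_def]
    by (rule W1p_0_psum[OF p U zero_in_W1p_0[OF p]], rule W1p_0_psum[OF q V zero_in_W1p_0[OF q]])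
  have dz: "dirichlet \<Omega> r (\<lambda>x. 0) = 0" if "r > 1" for r
    using dirichlet_test_function[OF that test_function_0] by simp
  have D: "dirichlet \<Omega> p U' \<le> dirichlet \<Omega> p U" "dirichlet \<Omega> q V' \<le> dirichlet \<Omega> q V"
    using dirichlet_psum_le[OF p U zero_in_W1p_0[OF p]] dirichlet_psum_le[OF q V zero_in_W1p_0[OF q]]
    unfolding U'_def[abs_def] V'_def[abs_def] dz[OF p] dz[OF q] by simp_all
  have abs: "\<bar>U' x\<bar> = \<bar>U x\<bar>" "\<bar>V' x\<bar> = \<bar>V x\<bar>" "U' x \<ge> 0" "V' x \<ge> 0" for x
    by (simp_all add: U'_def V'_def psum_0 p q)
  have K': "abs_coupling \<Omega> \<alpha> \<beta> U' V' = K" by (simp add: abs_coupling_def K_def abs)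
  define c d where "c = K powr (- 1 / p)" and "d = K powr (- 1 / q)"
  let ?u = "\<lambda>x. c * U' x" and ?v = "\<lambda>x. d * V' x"
  have cd: "c > 0" "d > 0" using K0 by (simp_all add: c_def d_def)
  have cp: "\<bar>c\<bar> powr p = 1 / K" "\<bar>d\<bar> powr q = 1 / K"
  proof -
    have "\<bar>c\<bar> powr p = K powr (- 1 / p * p)" "\<bar>d\<bar> powr q = K powr (- 1 / q * q)"
      unfolding abs_of_pos[OF cd(1)] abs_of_pos[OF cd(2)] unfolding c_def d_def by (rule powr_powr)+
    then show "\<bar>c\<bar> powr p = 1 / K" "\<bar>d\<bar> powr q = 1 / K"
      using p q K0 by (simp_all add: powr_minus_divide)
  qed
  have "\<bar>c\<bar> powr \<alpha> * \<bar>d\<bar> powr \<beta> = K powr (- 1)"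
  proof -
    have e: "- 1 / p * \<alpha> + - 1 / q * \<beta> = - 1" using sum_1 by simp
    have "\<bar>c\<bar> powr \<alpha> * \<bar>d\<bar> powr \<beta> = K powr (- 1 / p * \<alpha> + - 1 / q * \<beta>)"
      using cd by (simp only: c_def d_def abs_of_pos powr_powr powr_add)
    then show ?thesis by (simp only: e)
  qed
  then have "abs_coupling \<Omega> \<alpha> \<beta> ?u ?v = 1"
    unfolding abs_coupling_cmult K' using K0 by (simp add: powr_minus_divide)
  moreover have "coupling \<Omega> \<alpha> \<beta> ?u ?v = abs_coupling \<Omega> \<alpha> \<beta> ?u ?v"
    by (rule coupling_eq_abs_coupling) (use abs cd in simp_all)
  ultimately have mem: "energy \<Omega> p q \<alpha> \<beta> ?u ?v \<in> ?S"
    using W1p_0_cmult(1)[OF p W(1)] W1p_0_cmult(1)[OF q W(2)] by auto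
  have nn: "0 \<le> e" if "e \<in> ?S" for e using that energy_nonneg by auto
  then have "bdd_below ?S" by (rule bdd_belowI)
  with mem have "lambda1 \<Omega> p q \<alpha> \<beta> \<le> energy \<Omega> p q \<alpha> \<beta> ?u ?v"
    unfolding lambda1_def by (rule cInf_lower)
  also have "\<dots> = energy \<Omega> p q \<alpha> \<beta> U' V' / K"
    unfolding energy_eq dirichlet_cmult[OF p W(1)] dirichlet_cmult[OF q W(2)] cp
    by (simp add: add_divide_distrib)
  finally have "lambda1 \<Omega> p q \<alpha> \<beta> * K \<le> energy \<Omega> p q \<alpha> \<beta> U' V'"
    using K0 by (simp add: le_divide_eq)
  also have "\<dots> \<le> energy \<Omega> p q \<alpha> \<beta> U V"
    unfolding energy_eq using D p q \<alpha> \<beta> by (intro add_mono mult_left_mono) auto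
  finally show "lambda1 \<Omega> p q \<alpha> \<beta> * abs_coupling \<Omega> \<alpha> \<beta> U V \<le> energy \<Omega> p q \<alpha> \<beta> U V"
    by (simp add: K_def)
  show "lambda1 \<Omega> p q \<alpha> \<beta> \<ge> 0"
    unfolding lambda1_def using mem nn by (intro cInf_greatest) blast+
qed

lemma plaplace_form_self: "plaplace_form \<Omega> r u u = dirichlet \<Omega> r u"
proof -
  have "rpow (norm y) (r - 2) * (y \<bullet> y) = norm y powr r" for y :: 'a
  proof (cases "y = 0")
    case False
    then have "rpow (norm y) (r - 2) = norm y powr (r - 2)" by (simp add: rpow_def)
    moreover have "y \<bullet> y = norm y powr 2" using False by (simp add: dot_square_norm powr_numeral)
    ultimately show ?thesis using False by (simp add: powr_add[symmetric] del: powr_numeral)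
  qed simp
  then show ?thesis by (simp add: plaplace_form_def dirichlet_def)
qed

lemma plaplace_form_zero: "plaplace_form \<Omega> r u (\<lambda>x. 0) = 0"
  unfolding plaplace_form_def
  by (rule integral_eq_zero_AE) (use AE_weak_grad_zero in eventually_elim, simp)

text \<open>Testing with (u, 0) and with (0, v) separates the two equations, and the same coupling
  appears on both right-hand sides.\<close>

lemma weak_solution_dirichlet:
  assumes "weak_solution \<Omega> p q \<alpha> \<beta> \<mu> u v"
  shows "dirichlet \<Omega> p u = \<mu> * coupling \<Omega> \<alpha> \<beta> u v" "dirichlet \<Omega> q v = \<mu> * coupling \<Omega> \<alpha> \<beta> u v"
proof -
  have uv: "u \<in> W1p_0 p \<Omega>" "v \<in> W1p_0 q \<Omega>" using assms by (auto simp: weak_solution_def)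
  have eq: "plaplace_form \<Omega> p u \<eta> + plaplace_form \<Omega> q v \<zeta> =
          \<mu> * ((LINT x|M. rpow \<bar>u x\<bar> (\<alpha> - 1) * rpow \<bar>v x\<bar> (\<beta> - 1) * v x * \<eta> x) +
               (LINT x|M. rpow \<bar>u x\<bar> (\<alpha> - 1) * rpow \<bar>v x\<bar> (\<beta> - 1) * u x * \<zeta> x))"
    if "\<eta> \<in> W1p_0 p \<Omega>" "\<zeta> \<in> W1p_0 q \<Omega>" for \<eta> \<zeta>
    using assms that by (simp add: weak_solution_def)
  show "dirichlet \<Omega> p u = \<mu> * coupling \<Omega> \<alpha> \<beta> u v"
    using eq[OF uv(1) zero_in_W1p_0[OF q]]
    by (simp add: plaplace_form_self plaplace_form_zero coupling_def mult_ac)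
  show "dirichlet \<Omega> q v = \<mu> * coupling \<Omega> \<alpha> \<beta> u v"
    using eq[OF zero_in_W1p_0[OF p] uv(2)]
    by (simp add: plaplace_form_self plaplace_form_zero coupling_def mult_ac)
qed

lemma AE_weak_grad_0_if_dirichlet_0:
  assumes u: "u \<in> W1p_0 r \<Omega>" and D: "dirichlet \<Omega> r u = 0"
  shows "AE x in M. \<nabla> u x = u x *\<^sub>R 0"
proof -
  have "AE x in M. norm (\<nabla> u x) powr r = 0"
    using D integral_nonneg_eq_0_iff_AE[OF dirichlet_integrable[OF u]] by (simp add: dirichlet_def)
  then show ?thesis by eventually_elim simp
qed

text \<open>If the coupling vanished, so would both Dirichlet energies. Then u and v would have zero
  gradient and, not being identically zero, vanish almost nowhere, contradicting a zero integrand.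
  Positivity makes the constraint set of the infimum nonempty.\<close>

lemma eigenfunction_abs_coupling_pos:
  assumes ef: "eigenfunction \<Omega> p q \<alpha> \<beta> \<mu> u v"
  shows "abs_coupling \<Omega> \<alpha> \<beta> u v > 0"
proof (rule ccontr)
  assume "\<not> abs_coupling \<Omega> \<alpha> \<beta> u v > 0"
  then have K: "abs_coupling \<Omega> \<alpha> \<beta> u v = 0" using abs_coupling_nonneg[of u v] by linarith
  have sol: "weak_solution \<Omega> p q \<alpha> \<beta> \<mu> u v" and nz: "\<not> (AE x in M. u x = 0)" "\<not> (AE x in M. v x = 0)"
    using ef by (auto simp: eigenfunction_def)
  have uv: "u \<in> W1p_0 p \<Omega>" "v \<in> W1p_0 q \<Omega>" using sol by (auto simp: weak_solution_def)
  have "coupling \<Omega> \<alpha> \<beta> u v = 0" using coupling_le_abs_coupling[OF uv] K by simp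
  then have D: "dirichlet \<Omega> p u = 0" "dirichlet \<Omega> q v = 0" using weak_solution_dirichlet[OF sol] by simp_all
  have X: "\<exists>R>0. ball z R \<subseteq> \<Omega> \<and> integrable (lebesgue_on (ball z R)) (\<lambda>x. 0 :: 'a)" if "z \<in> \<Omega>" for z
    using open_domain that by (auto simp: open_contains_ball)
  have "AE x in M. u x \<noteq> 0"
    by (rule AE_nonzero_if_logarithmic_gradient[OF p uv(1) nz(1) AE_weak_grad_0_if_dirichlet_0[OF uv(1) D(1)] X])
  moreover have "AE x in M. v x \<noteq> 0"
    by (rule AE_nonzero_if_logarithmic_gradient[OF q uv(2) nz(2) AE_weak_grad_0_if_dirichlet_0[OF uv(2) D(2)] X])
  moreover have "AE x in M. \<bar>u x\<bar> powr \<alpha> * \<bar>v x\<bar> powr \<beta> = 0"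
    using K integral_nonneg_eq_0_iff_AE[OF coupling_integrable[OF uv]] by (simp add: abs_coupling_def)
  ultimately have "AE x in M. u x = 0" by eventually_elim auto
  with nz(1) show False ..
qed

text \<open>The weights add up to 1, so the energy is \<lambda> times the signed coupling. This is
  at most \<lambda> times the absolute coupling, hence at most the energy: equality holds
  throughout, whatever the signs of u and v.\<close>

lemma eigenfunction_imp_minimizing_pair:
  assumes ef: "eigenfunction \<Omega> p q \<alpha> \<beta> (lambda1 \<Omega> p q \<alpha> \<beta>) u v"
  shows "minimizing_pair \<Omega> p q \<alpha> \<beta> (lambda1 \<Omega> p q \<alpha> \<beta>) u v"
proof -
  let ?l = "lambda1 \<Omega> p q \<alpha> \<beta>"
  have sol: "weak_solution \<Omega> p q \<alpha> \<beta> ?l u v" using ef by (simp add: eigenfunction_def)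
  have uv: "u \<in> W1p_0 p \<Omega>" "v \<in> W1p_0 q \<Omega>" using sol by (auto simp: weak_solution_def)
  note K = eigenfunction_abs_coupling_pos[OF ef]
  note l = lambda1_properties[OF uv K]
  have min: "?l * abs_coupling \<Omega> \<alpha> \<beta> U V \<le> energy \<Omega> p q \<alpha> \<beta> U V" if "U \<in> W1p_0 p \<Omega>" "V \<in> W1p_0 q \<Omega>" for U V
    using lambda1_properties(1)[OF that] abs_coupling_nonneg[of U V] energy_nonneg[of U V]
    by (cases "abs_coupling \<Omega> \<alpha> \<beta> U V = 0") auto
  have "energy \<Omega> p q \<alpha> \<beta> u v = (\<alpha> / p + \<beta> / q) * (?l * coupling \<Omega> \<alpha> \<beta> u v)"
    unfolding energy_eq weak_solution_dirichlet[OF sol] by (simp only: distrib_right)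
  then have "energy \<Omega> p q \<alpha> \<beta> u v = ?l * coupling \<Omega> \<alpha> \<beta> u v" by (simp add: sum_1)
  also have "\<dots> \<le> ?l * abs_coupling \<Omega> \<alpha> \<beta> u v"
    using coupling_le_abs_coupling[OF uv] l(2) by (intro mult_left_mono) auto
  finally have "energy \<Omega> p q \<alpha> \<beta> u v = ?l * abs_coupling \<Omega> \<alpha> \<beta> u v"
    using l(1) by linarith
  then show ?thesis using uv l(2) min by (simp add: minimizing_pair_def)
qed

end

text \<open>For a \<ge> 1 because r^a \<le> r, for a < 1 by Young's inequality against 1. With a = p
  - 1 it linearises the energy defect.\<close>

lemma one_minus_powr_ge:
  fixes r a :: real
  assumes r: "0 \<le> r" "r \<le> 1" and a: "a > 0"
  shows "min 1 a * (1 - r) \<le> 1 - r powr a"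
proof (cases "a \<ge> 1")
  case True
  have "r powr a \<le> r powr 1" using r True by (intro powr_mono') auto
  then show ?thesis using True r by simp
next
  case False
  have "r powr a * 1 powr (1 - a) \<le> a * r + (1 - a) * 1"
    using False a r by (intro powr_mult_powr_le) auto
  then show ?thesis using False by (simp add: min_def algebra_simps)
qed

section \<open>The logarithmic estimate and proportionality of minimizers\<close>

context exponents
begin

text \<open>The p-sum increases |u| and thus the coupling with the same v. As (u, v) minimizes and
  the energy of v is unchanged, the energy of the first component cannot drop.\<close>

lemma minimizing_pair_dirichlet_le_psum:
  assumes min: "minimizing_pair \<Omega> p q \<alpha> \<beta> \<mu> u v" and w: "w \<in> W1p_0 p \<Omega>"
  shows "dirichlet \<Omega> p u \<le> dirichlet \<Omega> p (\<lambda>x. psum p (u x) (w x))"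
proof -
  have uv: "u \<in> W1p_0 p \<Omega>" "v \<in> W1p_0 q \<Omega>" and \<mu>: "\<mu> \<ge> 0"
    using min by (auto simp: minimizing_pair_def)
  let ?w = "\<lambda>x. psum p (u x) (w x)"
  have W: "?w \<in> W1p_0 p \<Omega>" by (rule W1p_0_psum(1)[OF p uv(1) w])
  have "\<bar>u x\<bar> \<le> psum p (u x) (w x)" for x
  proof -
    have "(\<bar>u x\<bar> powr p) powr (1 / p) \<le> psum p (u x) (w x)"
      unfolding psum_def using p by (intro powr_mono2) auto
    then show ?thesis using p by (simp add: powr_powr)
  qed
  then have "abs_coupling \<Omega> \<alpha> \<beta> u v \<le> abs_coupling \<Omega> \<alpha> \<beta> ?w v"
    unfolding abs_coupling_def using \<alpha>
    by (intro integral_mono coupling_integrable uv W mult_right_mono powr_mono2) (auto intro: order_trans[OF _ abs_ge_self])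
  then have "\<mu> * abs_coupling \<Omega> \<alpha> \<beta> u v \<le> \<mu> * abs_coupling \<Omega> \<alpha> \<beta> ?w v"
    using \<mu> by (rule mult_left_mono)
  moreover have "\<mu> * abs_coupling \<Omega> \<alpha> \<beta> ?w v \<le> energy \<Omega> p q \<alpha> \<beta> ?w v"
    using min W uv by (simp add: minimizing_pair_def)
  moreover have "energy \<Omega> p q \<alpha> \<beta> u v = \<mu> * abs_coupling \<Omega> \<alpha> \<beta> u v"
    using min by (simp add: minimizing_pair_def)
  ultimately have "\<alpha> / p * dirichlet \<Omega> p u \<le> \<alpha> / p * dirichlet \<Omega> p ?w"
    by (simp add: energy_eq)
  then show ?thesis using \<alpha> p by (simp add: divide_le_cancel)
qed

text \<open>Comparing \<open>u\<close> with the \<open>p\<close>-sum of \<open>u\<close> and a small multiple of a cutoff that is constant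
  near \<open>z\<close> yields a logarithmic estimate.\<close>

lemma minimizing_pair_log_estimate:
  assumes min: "minimizing_pair \<Omega> p q \<alpha> \<beta> \<mu> u v"
    and \<zeta>: "test_function \<Omega> \<zeta>" and z: "ball z R \<subseteq> \<Omega>"
    and plateau: "\<And>x. x \<in> ball z R \<Longrightarrow> \<zeta> x = 1" "\<And>x. x \<in> ball z R \<Longrightarrow> grad \<zeta> x = 0"
    and \<tau>: "\<tau> > 0"
  shows "integrable M (\<lambda>x. indicator (ball z R) x * (norm (\<nabla> u x) powr p / (\<bar>u x\<bar> powr p + \<tau>)))"
    and "(LINT x|M. indicator (ball z R) x * (norm (\<nabla> u x) powr p / (\<bar>u x\<bar> powr p + \<tau>))) \<le>
      dirichlet \<Omega> p \<zeta> / min 1 (p - 1)"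
proof -
  let ?Z = "\<lambda>x. indicator (ball z R) x * (norm (\<nabla> u x) powr p / (\<bar>u x\<bar> powr p + \<tau>))"
  define c where "c = min 1 (p - 1)"
  have c: "c > 0" using p by (simp add: c_def)
  have u: "u \<in> W1p_0 p \<Omega>" using min by (simp add: minimizing_pair_def)
  \<comment> \<open>Scaled so that t^p = \<tau>: on the plateau the p-sum is (|u|^p + \<tau>)^(1/p),
    and the perturbation has \<tau> times the energy of the cutoff.\<close>
  define t where "t = \<tau> powr (1 / p)"
  have t: "t > 0" "t powr p = \<tau>" using \<tau> p by (simp_all add: t_def powr_powr)
  let ?w = "\<lambda>x. t * \<zeta> x"
  have wt: "test_function \<Omega> ?w" by (rule test_function_cmult[OF \<zeta>])
  note w = test_function_in_W1p_0[OF p wt]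
  have Dw: "dirichlet \<Omega> p ?w = \<tau> * dirichlet \<Omega> p \<zeta>"
    using dirichlet_cmult[OF p test_function_in_W1p_0(1)[OF p \<zeta>], of t] t by simp
  let ?G = "\<lambda>x. psum_coeff p (u x) (?w x) *\<^sub>R \<nabla> u x + psum_coeff p (?w x) (u x) *\<^sub>R \<nabla> ?w x"
  note G = dirichlet_cong_AE[OF W1p_0_psum[OF p u w(1)]]
  let ?g = "\<lambda>x. norm (\<nabla> u x) powr p + norm (\<nabla> ?w x) powr p - norm (?G x) powr p"
  have int: "integrable M ?g"
    by (intro Bochner_Integration.integrable_diff Bochner_Integration.integrable_add dirichlet_integrable u w G(2))
  have "(LINT x|M. ?g x) = dirichlet \<Omega> p u + dirichlet \<Omega> p ?w - dirichlet \<Omega> p (\<lambda>x. psum p (u x) (?w x))"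
    unfolding G(1) using dirichlet_integrable[OF u] dirichlet_integrable[OF w(1)] G(2)
    by (simp add: dirichlet_def)
  also have "\<dots> \<le> \<tau> * dirichlet \<Omega> p \<zeta>"
    using minimizing_pair_dirichlet_le_psum[OF min w(1)] Dw by simp
  finally have le: "(LINT x|M. ?g x) \<le> \<tau> * dirichlet \<Omega> p \<zeta>" .
  have um [measurable]: "u \<in> borel_measurable M" "\<nabla> u \<in> borel_measurable M"
    using W1pD[OF u] by (auto simp: in_Lp_def)
  have bm [measurable]: "indicator (ball z R) \<in> borel_measurable M"
    using z by (intro measurable_restrict_space1 borel_measurable_indicator) simp
  have Z0: "?Z x \<ge> 0" for x using \<tau> by (simp add: add_nonneg_nonneg)
  show Zint: "integrable M ?Z"
  proof (rule Bochner_Integration.integrable_bound)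
    show "integrable M (\<lambda>x. 1 / \<tau> * norm (\<nabla> u x) powr p)"
      by (intro integrable_mult_right dirichlet_integrable u)
    have "?Z x \<le> 1 / \<tau> * norm (\<nabla> u x) powr p" for x
    proof -
      have "norm (\<nabla> u x) powr p / (\<bar>u x\<bar> powr p + \<tau>) \<le> norm (\<nabla> u x) powr p / \<tau>"
        using \<tau> by (intro divide_left_mono) (auto simp: add_nonneg_pos)
      then show ?thesis using \<tau> by (auto simp: indicator_def)
    qed
    then show "AE x in M. norm (?Z x) \<le> norm (1 / \<tau> * norm (\<nabla> u x) powr p)"
      using Z0 \<tau> by (intro AE_I2) (simp add: abs_of_nonneg)
    show "?Z \<in> borel_measurable M" by measurable
  qed
  have "(LINT x|M. c * \<tau> * ?Z x) \<le> (LINT x|M. ?g x)"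
  proof (rule integral_mono_AE)
    show "integrable M (\<lambda>x. c * \<tau> * ?Z x)" by (intro integrable_mult_right Zint)
    show "integrable M ?g" by (rule int)
    show "AE x in M. c * \<tau> * ?Z x \<le> ?g x"
      using w(2)
    proof eventually_elim
      fix x assume gw: "\<nabla> ?w x = grad ?w x"
      show "c * \<tau> * ?Z x \<le> ?g x"
      proof (cases "x \<in> ball z R")
        case False
        then show ?thesis using norm_psum_gradient_le[OF p, of "u x" "?w x"] by simp
      next
        case True
        let ?s = "\<bar>u x\<bar> powr p" and ?n = "norm (\<nabla> u x) powr p"
        have s: "?s + \<tau> > 0" using \<tau> by (simp add: add_nonneg_pos)
        have w1: "?w x = t" "\<nabla> ?w x = 0"
          using plateau[OF True] gw by (simp_all add: grad_cmult[OF \<zeta>])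
        have "\<bar>psum_coeff p (u x) t\<bar> powr p = (?s / (?s + \<tau>)) powr (p - 1)"
          using abs_psum_coeff_powr[OF p, of "u x" t] t s by simp
        \<comment> \<open>The cutoff has no gradient on the plateau, so only the term with the
          gradient of u remains and the defect is explicit.\<close>
        then have "?g x = ?n * (1 - (?s / (?s + \<tau>)) powr (p - 1))"
          unfolding w1 using p by (simp add: powr_mult algebra_simps)
        also have "\<dots> \<ge> ?n * (c * (1 - ?s / (?s + \<tau>)))"
          unfolding c_def using p s \<tau> by (intro mult_left_mono one_minus_powr_ge) auto
        also have "1 - ?s / (?s + \<tau>) = \<tau> / (?s + \<tau>)" using s by (simp add: field_simps)
        finally show ?thesis using True by (simp add: mult_ac)
      qed
    qed
  qed
  from order_trans[OF this le] have "c * \<tau> * (LINT x|M. ?Z x) \<le> \<tau> * dirichlet \<Omega> p \<zeta>"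
    by (simp only: integral_mult_right_zero)
  \<comment> \<open>Both sides are proportional to \<tau>; the bound that remains is independent of
    \<tau> and allows \<tau> to tend to 0.\<close>
  then have "\<tau> * (c * (LINT x|M. ?Z x)) \<le> \<tau> * dirichlet \<Omega> p \<zeta>" by (simp only: mult_ac)
  then have "c * (LINT x|M. ?Z x) \<le> dirichlet \<Omega> p \<zeta>"
    using \<tau> by (simp only: mult_le_cancel_left_pos)
  then show "(LINT x|M. ?Z x) \<le> dirichlet \<Omega> p \<zeta> / min 1 (p - 1)"
    using c by (simp add: c_def[symmetric] le_divide_eq mult.commute)
qed

text \<open>For \<tau> = 1/(n+1) the integrands of the estimate increase with n, so by monotone
  convergence their supremum is integrable and finite almost everywhere. On the ball it bounds (n+1)
  |\<nabla>u|^p for all n where u = 0, forcing \<nabla>u = 0, and bounds |\<nabla>u/u|^p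
  elsewhere.\<close>

lemma minimizing_pair_logarithmic_gradient_local:
  assumes min: "minimizing_pair \<Omega> p q \<alpha> \<beta> \<mu> u v" and z: "z \<in> \<Omega>"
  shows "\<exists>R>0. ball z R \<subseteq> \<Omega> \<and> (AE x in lebesgue. x \<in> ball z R \<longrightarrow> u x = 0 \<longrightarrow> \<nabla> u x = 0) \<and>
    integrable (lebesgue_on (ball z R)) (\<lambda>x. (1 / u x) *\<^sub>R \<nabla> u x)"
proof -
  obtain \<zeta> R where \<zeta>: "test_function \<Omega> \<zeta>" and R: "R > 0" "ball z R \<subseteq> \<Omega>"
    and plateau: "\<And>x. x \<in> ball z R \<Longrightarrow> \<zeta> x = 1" "\<And>x. x \<in> ball z R \<Longrightarrow> grad \<zeta> x = 0"
    by (rule plateau_exists[OF open_domain z]) (rule that; assumption)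
  have u: "u \<in> W1p_0 p \<Omega>" using min by (simp add: minimizing_pair_def)
  have um [measurable]: "u \<in> borel_measurable M" "\<nabla> u \<in> borel_measurable M"
    using W1pD[OF u] by (auto simp: in_Lp_def)
  have bm [measurable]: "indicator (ball z R) \<in> borel_measurable M"
    using R by (intro measurable_restrict_space1 borel_measurable_indicator) simp
  define Z where "Z n x = indicator (ball z R) x * (norm (\<nabla> u x) powr p / (\<bar>u x\<bar> powr p + 1 / real (Suc n)))" for n x
  define C where "C = dirichlet \<Omega> p \<zeta> / min 1 (p - 1)"
  note est = minimizing_pair_log_estimate[OF min \<zeta> R(2) plateau, folded C_def]
  have Z0: "Z n x \<ge> 0" for n x by (simp add: Z_def add_nonneg_nonneg)
  have Zint: "integrable M (Z n)" "(LINT x|M. Z n x) \<le> C" for n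
    unfolding Z_def[abs_def] by (rule est; simp)+
  have Zm: "(\<lambda>x. ennreal (Z n x)) \<in> borel_measurable M" for n
    using Zint(1)[of n] by measurable
  have inc: "incseq (\<lambda>n x. ennreal (Z n x))"
  proof (intro incseq_SucI le_funI ennreal_leI)
    fix n x
    have "1 / real (Suc (Suc n)) \<le> 1 / real (Suc n)" by (simp add: frac_le)
    then show "Z n x \<le> Z (Suc n) x"
      unfolding Z_def by (intro mult_left_mono divide_left_mono) (auto intro!: mult_pos_pos add_nonneg_pos)
  qed
  let ?S = "\<lambda>x. SUP n. ennreal (Z n x)"
  have Sm: "?S \<in> borel_measurable M"
    using Zm by (intro borel_measurable_SUP) auto
  have "(\<integral>\<^sup>+x. ?S x \<partial>M) = (SUP n. \<integral>\<^sup>+x. ennreal (Z n x) \<partial>M)"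
    by (rule nn_integral_monotone_convergence_SUP[OF inc Zm])
  also have "\<dots> \<le> ennreal C"
  proof (rule SUP_least)
    fix n
    have "(\<integral>\<^sup>+x. ennreal (Z n x) \<partial>M) = ennreal (LINT x|M. Z n x)"
      using Zint(1) Z0 by (intro nn_integral_eq_integral) auto
    also have "\<dots> \<le> ennreal C" by (rule ennreal_leI[OF Zint(2)])
    finally show "(\<integral>\<^sup>+x. ennreal (Z n x) \<partial>M) \<le> ennreal C" .
  qed
  finally have S: "(\<integral>\<^sup>+x. ?S x \<partial>M) \<le> ennreal C" .
  then have "(\<integral>\<^sup>+x. ?S x \<partial>M) \<noteq> \<infinity>" by (auto simp: top_unique)
  from nn_integral_noteq_infinite[OF Sm this] have fin: "AE x in M. ?S x \<noteq> \<infinity>" .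
  have bound: "Z n x \<le> enn2real (?S x)" if "?S x \<noteq> \<infinity>" for n x
  proof -
    have "ennreal (Z n x) \<le> ?S x" by (rule SUP_upper) simp
    moreover have "?S x < top" using that unfolding infinity_ennreal_def less_top .
    ultimately have "enn2real (ennreal (Z n x)) \<le> enn2real (?S x)" by (rule enn2real_mono)
    then show ?thesis using Z0 by simp
  qed
  \<comment> \<open>Since 1 / 0 = 0, this field is 0 at the zeros of u.\<close>
  let ?X = "\<lambda>x. (1 / u x) *\<^sub>R \<nabla> u x"
  have zero: "\<nabla> u x = 0" if S: "?S x \<noteq> \<infinity>" and x: "x \<in> ball z R" "u x = 0" for x
  proof -
    let ?n = "norm (\<nabla> u x) powr p"
    have "?n \<le> enn2real (?S x) * (1 / real (Suc n))" for n
      using bound[OF S, of n] x by (simp add: Z_def field_simps)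
    moreover have "(\<lambda>n. enn2real (?S x) * (1 / real (Suc n))) \<longlonglongrightarrow> enn2real (?S x) * 0"
      by (intro tendsto_mult tendsto_const LIMSEQ_Suc[OF lim_1_over_n])
    ultimately have "?n \<le> 0" by (intro LIMSEQ_le_const) auto
    then have "?n = 0" by (simp add: order_antisym)
    then show ?thesis by simp
  qed
  have Xb: "indicator (ball z R) x * norm (?X x) powr p \<le> enn2real (?S x)" if S: "?S x \<noteq> \<infinity>" for x
  proof (cases "u x = 0")
    case False
    have "(\<lambda>n. Z n x) \<longlonglongrightarrow> indicator (ball z R) x * (norm (\<nabla> u x) powr p / (\<bar>u x\<bar> powr p + 0))"
      unfolding Z_def using False by (intro tendsto_intros LIMSEQ_Suc[OF lim_1_over_n]) auto
    then have "indicator (ball z R) x * (norm (\<nabla> u x) powr p / (\<bar>u x\<bar> powr p + 0)) \<le> enn2real (?S x)"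
      by (rule LIMSEQ_le_const2) (use bound[OF S] in auto)
    moreover have "norm (?X x) powr p = norm (\<nabla> u x) powr p / (\<bar>u x\<bar> powr p + 0)"
      by (simp add: powr_divide)
    ultimately show ?thesis by simp
  qed simp
  have Sint: "integrable M (\<lambda>x. enn2real (?S x))"
  proof (rule integrableI_bounded)
    show "(\<lambda>x. enn2real (?S x)) \<in> borel_measurable M" using Sm by measurable
    have "(\<integral>\<^sup>+x. ennreal (norm (enn2real (?S x))) \<partial>M) \<le> (\<integral>\<^sup>+x. ?S x \<partial>M)"
      by (intro nn_integral_mono) (simp add: enn2real_nonneg ennreal_enn2real_if)
    also note S
    also have "ennreal C < \<infinity>" by simp
    finally show "(\<integral>\<^sup>+x. ennreal (norm (enn2real (?S x))) \<partial>M) < \<infinity>" .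
  qed
  have Xm: "?X \<in> borel_measurable M" by measurable
  have Xi: "integrable M (\<lambda>x. indicator (ball z R) x *\<^sub>R ?X x)"
  proof (rule Bochner_Integration.integrable_bound)
    show "integrable M (\<lambda>x. 1 + enn2real (?S x))" using Sint by simp
    show "(\<lambda>x. indicator (ball z R) x *\<^sub>R ?X x) \<in> borel_measurable M"
      by (rule borel_measurable_scaleR[OF bm Xm])
    show "AE x in M. norm (indicator (ball z R) x *\<^sub>R ?X x) \<le> norm (1 + enn2real (?S x))"
      using fin
    proof eventually_elim
      fix x assume S: "?S x \<noteq> \<infinity>"
      have "norm (?X x) \<le> 1 + norm (?X x) powr p"
        using p by (intro le_one_plus_powr) auto
      then have "norm (indicator (ball z R) x *\<^sub>R ?X x) \<le> 1 + indicator (ball z R) x * norm (?X x) powr p"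
        by (cases "x \<in> ball z R") (simp_all del: norm_scaleR)
      then show "norm (indicator (ball z R) x *\<^sub>R ?X x) \<le> norm (1 + enn2real (?S x))"
        using Xb[OF S] by (simp add: enn2real_nonneg del: norm_scaleR)
    qed
  qed
  have "integrable lebesgue (\<lambda>x. indicator \<Omega> x *\<^sub>R (indicator (ball z R) x *\<^sub>R ?X x))"
    using Xi by (simp only: integrable_restrict_space sets.Int_space_eq2 sets_domain)
  moreover have "indicator \<Omega> x *\<^sub>R (indicator (ball z R) x *\<^sub>R ?X x) = indicator (ball z R) x *\<^sub>R ?X x" for x
    using R by (auto simp: indicator_def)
  ultimately have "integrable lebesgue (\<lambda>x. indicator (ball z R) x *\<^sub>R ?X x)" by (simp only:)
  then have XR: "integrable (lebesgue_on (ball z R)) ?X"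
    by (simp add: integrable_restrict_space)
  have "AE x in lebesgue. x \<in> \<Omega> \<longrightarrow> ?S x \<noteq> \<infinity>"
    using fin by (simp add: AE_restrict_space_iff)
  then have "AE x in lebesgue. x \<in> ball z R \<longrightarrow> u x = 0 \<longrightarrow> \<nabla> u x = 0"
    by eventually_elim (use zero R(2) in blast)
  then show ?thesis using R XR by blast
qed

lemma minimizing_pair_logarithmic_gradient:
  assumes min: "minimizing_pair \<Omega> p q \<alpha> \<beta> \<mu> u v"
  shows "AE x in M. \<nabla> u x = u x *\<^sub>R ((1 / u x) *\<^sub>R \<nabla> u x)"
    and "\<And>z. z \<in> \<Omega> \<Longrightarrow> \<exists>R>0. ball z R \<subseteq> \<Omega> \<and> integrable (lebesgue_on (ball z R)) (\<lambda>x. (1 / u x) *\<^sub>R \<nabla> u x)"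
proof -
  note loc = minimizing_pair_logarithmic_gradient_local[OF min]
  show "AE x in M. \<nabla> u x = u x *\<^sub>R ((1 / u x) *\<^sub>R \<nabla> u x)"
  proof (rule AE_lebesgue_on_locally[OF open_domain])
    fix z assume "z \<in> \<Omega>"
    from loc[OF this] obtain R where R: "R > 0" "AE x in lebesgue. x \<in> ball z R \<longrightarrow> u x = 0 \<longrightarrow> \<nabla> u x = 0"
      by blast
    have "AE x in lebesgue. x \<in> ball z R \<longrightarrow> \<nabla> u x = u x *\<^sub>R ((1 / u x) *\<^sub>R \<nabla> u x)"
      using R(2) by eventually_elim auto
    then show "\<exists>U. open U \<and> z \<in> U \<and> (AE x in lebesgue. x \<in> U \<longrightarrow> \<nabla> u x = u x *\<^sub>R ((1 / u x) *\<^sub>R \<nabla> u x))"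
      using R(1) by (intro exI[of _ "ball z R"]) simp
  qed
  show "\<exists>R>0. ball z R \<subseteq> \<Omega> \<and> integrable (lebesgue_on (ball z R)) (\<lambda>x. (1 / u x) *\<^sub>R \<nabla> u x)"
    if "z \<in> \<Omega>" for z
    using loc[OF that] by blast
qed

text \<open>Hidden convexity: the Dirichlet energies are subadditive and the coupling is superadditive
  along \<open>p\<close>-sums, so two minimizing pairs must realize equality.\<close>

lemma minimizing_pairs_psum_dirichlet_eq:
  assumes min1: "minimizing_pair \<Omega> p q \<alpha> \<beta> \<mu> u v" and min2: "minimizing_pair \<Omega> p q \<alpha> \<beta> \<mu> \<phi> \<psi>"
  shows "dirichlet \<Omega> p (\<lambda>x. psum p (u x) (\<phi> x)) = dirichlet \<Omega> p u + dirichlet \<Omega> p \<phi>"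
proof -
  have W: "u \<in> W1p_0 p \<Omega>" "v \<in> W1p_0 q \<Omega>" "\<phi> \<in> W1p_0 p \<Omega>" "\<psi> \<in> W1p_0 q \<Omega>" and \<mu>: "\<mu> \<ge> 0"
    using min1 min2 by (auto simp: minimizing_pair_def)
  let ?w = "\<lambda>x. psum p (u x) (\<phi> x)" and ?z = "\<lambda>x. psum q (v x) (\<psi> x)"
  have wz: "?w \<in> W1p_0 p \<Omega>" "?z \<in> W1p_0 q \<Omega>"
    by (rule W1p_0_psum(1)[OF p W(1,3)], rule W1p_0_psum(1)[OF q W(2,4)])
  have psum_powr: "\<bar>psum r s t\<bar> powr r = \<bar>s\<bar> powr r + \<bar>t\<bar> powr r" if "r > 1" for r s t
    using that by (simp add: psum_def powr_powr)
  have "abs_coupling \<Omega> \<alpha> \<beta> u v + abs_coupling \<Omega> \<alpha> \<beta> \<phi> \<psi> =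
      (LINT x|M. \<bar>u x\<bar> powr \<alpha> * \<bar>v x\<bar> powr \<beta> + \<bar>\<phi> x\<bar> powr \<alpha> * \<bar>\<psi> x\<bar> powr \<beta>)"
    unfolding abs_coupling_def
    by (intro Bochner_Integration.integral_add[symmetric] coupling_integrable W)
  also have "\<dots> \<le> abs_coupling \<Omega> \<alpha> \<beta> ?w ?z"
    unfolding abs_coupling_def
  proof (intro integral_mono Bochner_Integration.integrable_add coupling_integrable W wz)
    fix x
    show "\<bar>u x\<bar> powr \<alpha> * \<bar>v x\<bar> powr \<beta> + \<bar>\<phi> x\<bar> powr \<alpha> * \<bar>\<psi> x\<bar> powr \<beta> \<le> \<bar>?w x\<bar> powr \<alpha> * \<bar>?z x\<bar> powr \<beta>"
      unfolding coupling_integrand_eq psum_powr[OF p] psum_powr[OF q]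
      by (rule powr_mult_powr_superadditive[OF exponent_bounds]) simp_all
  qed
  finally have "\<mu> * (abs_coupling \<Omega> \<alpha> \<beta> u v + abs_coupling \<Omega> \<alpha> \<beta> \<phi> \<psi>) \<le> \<mu> * abs_coupling \<Omega> \<alpha> \<beta> ?w ?z"
    using \<mu> by (rule mult_left_mono)
  moreover have "\<mu> * abs_coupling \<Omega> \<alpha> \<beta> ?w ?z \<le> energy \<Omega> p q \<alpha> \<beta> ?w ?z"
    using min1 wz by (simp add: minimizing_pair_def)
  moreover have "energy \<Omega> p q \<alpha> \<beta> u v = \<mu> * abs_coupling \<Omega> \<alpha> \<beta> u v" "energy \<Omega> p q \<alpha> \<beta> \<phi> \<psi> = \<mu> * abs_coupling \<Omega> \<alpha> \<beta> \<phi> \<psi>"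
    using min1 min2 by (simp_all add: minimizing_pair_def)
  ultimately have E: "energy \<Omega> p q \<alpha> \<beta> u v + energy \<Omega> p q \<alpha> \<beta> \<phi> \<psi> \<le> energy \<Omega> p q \<alpha> \<beta> ?w ?z"
    by (simp add: distrib_left)
  \<comment> \<open>Subadditivity bounds the share of the second component from above, so the lower
    bound for the whole energy has to be met by the first component.\<close>
  have "\<beta> / q * dirichlet \<Omega> q ?z \<le> \<beta> / q * (dirichlet \<Omega> q v + dirichlet \<Omega> q \<psi>)"
    using \<beta> q dirichlet_psum_le[OF q W(2,4)] by (intro mult_left_mono) auto
  with E have "\<alpha> / p * (dirichlet \<Omega> p u + dirichlet \<Omega> p \<phi>) \<le> \<alpha> / p * dirichlet \<Omega> p ?w"
    by (simp add: energy_eq distrib_left)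
  then have "dirichlet \<Omega> p u + dirichlet \<Omega> p \<phi> \<le> dirichlet \<Omega> p ?w"
    using \<alpha> p by (simp add: divide_le_cancel)
  with dirichlet_psum_le[OF p W(1,3)] show ?thesis by linarith
qed

text \<open>Once both functions vanish almost nowhere, equality in the convexity inequality
  identifies their logarithmic gradients, and functions sharing a locally integrable logarithmic
  gradient are proportional.\<close>

lemma minimizing_pairs_proportional:
  assumes min1: "minimizing_pair \<Omega> p q \<alpha> \<beta> \<mu> u v" and min2: "minimizing_pair \<Omega> p q \<alpha> \<beta> \<mu> \<phi> \<psi>"
    and nz: "\<not> (AE x in M. u x = 0)" "\<not> (AE x in M. \<phi> x = 0)"
  shows "\<exists>k. AE x in M. u x = k * \<phi> x"
proof -
  have W: "u \<in> W1p_0 p \<Omega>" "\<phi> \<in> W1p_0 p \<Omega>"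
    using min1 min2 by (auto simp: minimizing_pair_def)
  note X1 = minimizing_pair_logarithmic_gradient[OF min1]
  note X2 = minimizing_pair_logarithmic_gradient[OF min2]
  have u0: "AE x in M. u x \<noteq> 0"
    by (rule AE_nonzero_if_logarithmic_gradient[OF p W(1) nz(1) X1])
  have \<phi>0: "AE x in M. \<phi> x \<noteq> 0"
    by (rule AE_nonzero_if_logarithmic_gradient[OF p W(2) nz(2) X2])
  have "AE x in M. \<nabla> \<phi> x = \<phi> x *\<^sub>R ((1 / u x) *\<^sub>R \<nabla> u x)"
    using AE_psum_gradient_eq[OF p W minimizing_pairs_psum_dirichlet_eq[OF min1 min2]] u0 \<phi>0
  proof eventually_elim
    fix x
    assume *: "norm (psum_coeff p (u x) (\<phi> x) *\<^sub>R \<nabla> u x + psum_coeff p (\<phi> x) (u x) *\<^sub>R \<nabla> \<phi> x) powr p =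
      norm (\<nabla> u x) powr p + norm (\<nabla> \<phi> x) powr p" "u x \<noteq> 0" "\<phi> x \<noteq> 0"
    have "(1 / u x) *\<^sub>R \<nabla> u x = (1 / \<phi> x) *\<^sub>R \<nabla> \<phi> x"
      by (rule norm_psum_gradient_eq_imp[OF p *(2,3,1)])
    then show "\<nabla> \<phi> x = \<phi> x *\<^sub>R ((1 / u x) *\<^sub>R \<nabla> u x)"
      using *(3) by simp
  qed
  from AE_proportional_if_logarithmic_gradients_eq[OF p W(1) u0 W(2) \<phi>0 X1(1) this X1(2)]
  show ?thesis .
qed

end

theorem theorem2p1:
  fixes \<Omega> :: "'a::euclidean_space set"
    and p q \<alpha> \<beta> :: real
    and u v \<phi> \<psi> :: "'a \<Rightarrow> real"
  assumes "open \<Omega>" and "connected \<Omega>" and "bounded \<Omega>" and "\<Omega> \<noteq> {}"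
    and "lipschitz_boundary \<Omega>"
    and "p > 1" and "q > 1" and "\<alpha> > 0" and "\<beta> > 0"
    and "\<alpha> / p + \<beta> / q = 1"
    and "eigenfunction \<Omega> p q \<alpha> \<beta> (lambda1 \<Omega> p q \<alpha> \<beta>) u v"
    and "eigenfunction \<Omega> p q \<alpha> \<beta> (lambda1 \<Omega> p q \<alpha> \<beta>) \<phi> \<psi>"
  shows "\<exists>k\<^sub>1 k\<^sub>2 :: real. (AE x in lebesgue_on \<Omega>. u x = k\<^sub>1 * \<phi> x) \<and>
                    (AE x in lebesgue_on \<Omega>. v x = k\<^sub>2 * \<psi> x)"
proof -
  interpret exponents \<Omega> p q \<alpha> \<beta>
    using assms by unfold_locales auto
  \<comment> \<open>The exponents are exchanged, so that the result on first components also covers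
    v and \<psi>.\<close>
  interpret swap: exponents \<Omega> q p \<beta> \<alpha>
    using assms by unfold_locales auto
  note m = eigenfunction_imp_minimizing_pair[OF assms(11)] eigenfunction_imp_minimizing_pair[OF assms(12)]
  have nz: "\<not> (AE x in lebesgue_on \<Omega>. u x = 0)" "\<not> (AE x in lebesgue_on \<Omega>. v x = 0)"
    "\<not> (AE x in lebesgue_on \<Omega>. \<phi> x = 0)" "\<not> (AE x in lebesgue_on \<Omega>. \<psi> x = 0)"
    using assms(11,12) by (simp_all add: eigenfunction_def)
  show ?thesis
    using minimizing_pairs_proportional[OF m nz(1,3)]
      swap.minimizing_pairs_proportional[OF m[THEN minimizing_pair_swap] nz(2,4)]
    by blast
qed

end
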